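(* Let $\mathcal{N}:\mathcal{L}(A)\to\mathcal{L}(B)$ be a quantum channel whose complementary channel $\mathcal{N}^c:\mathcal{L}(A)\to\mathcal{L}(E)$ is a cq-channel, i.e. there are an orthonormal basis $\{|i\rangle\}$ of $A$ and states $\rho_i$ on $E$ with $\mathcal{N}^c(|i\rangle\langle j|)=\delta_{ij}\,\rho_i$. Let $(p_i)$ be any probability distribution on the index set of the basis, put $\overline{\rho}=\sum_i p_i\rho_i$, and let $M_i=\overline{\rho}^{-1/2}\,p_i\rho_i\,\overline{\rho}^{-1/2}$ be the POVM associated to the ensemble $\{p_i,\rho_i\}$, with corresponding qc-channel $\mathcal{M}(\psi)=\sum_i \operatorname{Tr}(\psi M_i)\,|i\rangle\langle i|$. Then the weak locking capacity of $\mathcal{N}$ satisfies $$L_W(\mathcal{N})\ \geq\ \widehat{H}(\mathcal{M}) := \min_{\psi\text{ state}} H(\mathcal{M}(\psi)),$$ where $H(\mathcal{M}(\psi))$ is the Shannon entropy of the distribution $(\operatorname{Tr}\psi M_i)_i$.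
   Context: All Hilbert spaces are finite dimensional; $\log$ is to base 2 and entropies are in bits. The inverse $\overline{\rho}^{-1/2}$ is taken on the support of $\overline{\rho}$; $(M_i)$ is then a POVM on that support, and states $\psi$ in the minimum range over states on it. A quantum channel $\mathcal{N}:\mathcal{L}(A)\to\mathcal{L}(B)$ is a completely positive trace preserving map. It has a Stinespring isometry $V:A\hookrightarrow B\otimes E$ with $\mathcal{N}(\rho)=\operatorname{Tr}_E V\rho V^\dagger$; the complementary channel is $\mathcal{N}^c(\rho)=\operatorname{Tr}_B V\rho V^\dagger$ (unique up to isometries on $E$). Channels whose complement is a cq-channel (also called Schur multipliers) have the form $\mathcal{N}(|i\rangle\langle i'|)=|i\rangle\langle i'|\otimes\operatorname{Tr}_E|\psi_i\rangle\langle\psi_{i'}|$, where $|\psi_i\rangle$ is a purification of $\rho_i$. Codes (with sublinear pre-shared secret, modelled by auxiliary ideal qubit channels). For integers $n\ge 1$, $\kappa\ge 0$, an $(n,\epsilon)$-code with $\kappa$ auxiliary qubits for $\mathcal{N}$ is a collection $\{(\rho_m,D_m): m=1,\dots,N\}$ of states $\rho_m$ on $(\mathbb{C}^2)^{\otimes\kappa}\otimes A^{\otimes n}$ and a POVM $(D_m)$ on $(\mathbb{C}^2)^{\otimes\kappa}\otimes B^{\otimes n}$ ($D_m\ge 0$, $\sum_m D_m=\mathbb{1}$) such that $$\frac1N\sum_{m=1}^N\operatorname{Tr}\Bigl[\bigl(\mathrm{id}_2^{\otimes\kappa}\otimes\mathcal{N}^{\otimes n}\bigr)(\rho_m)\,(\mathbb{1}-D_m)\Bigr]\le\epsilon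 .$$ Eve's state for message $m$ is $\omega_m=\bigl(\operatorname{Tr}^{\otimes\kappa}\otimes(\mathcal{N}^c)^{\otimes n}\bigr)(\rho_m)$ on $E^{\otimes n}$ (the auxiliary qubits are traced out, the complement of an ideal qubit channel being trivial). The code is $\delta$-weakly-locked if for every POVM $(Q_j)$ on $E^{\otimes n}$ there is a probability distribution $(\Omega_j)$ with $$\frac1N\sum_{m=1}^N\sum_j\bigl|\operatorname{Tr}(\omega_m Q_j)-\Omega_j\bigr|\le\delta .$$ The weak locking capacity $L_W(\mathcal{N})$ is the supremum of all $R$ such that, as $n\to\infty$, there exist $\delta_n$-weakly-locked $(n,\epsilon_n)$-codes for $\mathcal{N}$ with $\kappa_n=o(n)$ auxiliary qubits, $N_n\ge 2^{nR}$, and $\epsilon_n,\delta_n\to 0$. *)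

theory Defs
  imports "HOL-Analysis.Analysis" "HOL-Library.Landau_Symbols"
begin

text \<open>
  The Hilbert space with computational basis labelled by a finite set \<open>X\<close> is represented by functions
  on \<open>X\<close>, its operators by matrices \<open>'x \<Rightarrow> 'x \<Rightarrow> complex\<close>; entries outside \<open>X \<times> X\<close> are ignored.
  Tensor products are then products of label sets: words of length \<open>n\<close> over \<open>'a\<close> label the
  \<open>n\<close>-fold tensor power of the space labelled by the finite type \<open>'a\<close>.
\<close>

type_synonym 'x cvec = "'x \<Rightarrow> complex"
type_synonym 'x op = "'x \<Rightarrow> 'x \<Rightarrow> complex"

definition words :: "nat \<Rightarrow> 'a list set" where
  "words n = {xs. length xs = n}"

definition op_id :: "'x op" where
  "op_id = (\<lambda>x y. if x = y then 1 else 0)"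

definition op_apply :: "'x set \<Rightarrow> 'x op \<Rightarrow> 'x cvec \<Rightarrow> 'x cvec" where
  "op_apply X A v = (\<lambda>x. \<Sum>y\<in>X. A x y * v y)"

definition op_mult :: "'x set \<Rightarrow> 'x op \<Rightarrow> 'x op \<Rightarrow> 'x op" where
  "op_mult X A B = (\<lambda>x z. \<Sum>y\<in>X. A x y * B y z)"

definition op_trace :: "'x set \<Rightarrow> 'x op \<Rightarrow> complex" where
  "op_trace X A = (\<Sum>x\<in>X. A x x)"

definition inner_prod :: "'x set \<Rightarrow> 'x cvec \<Rightarrow> 'x cvec \<Rightarrow> complex" where
  "inner_prod X u v = (\<Sum>x\<in>X. cnj (u x) * v x)"

definition ket_bra :: "'x cvec \<Rightarrow> 'x cvec \<Rightarrow> 'x op" where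
  "ket_bra u v = (\<lambda>x y. u x * cnj (v y))"

definition basis_vec :: "'x \<Rightarrow> 'x cvec" where
  "basis_vec a = (\<lambda>x. if x = a then 1 else 0)"

text \<open>As many orthonormal vectors as the dimension, hence a basis.\<close>

definition orthonormal_basis :: "('a::finite \<Rightarrow> 'a cvec) \<Rightarrow> bool" where
  "orthonormal_basis b \<longleftrightarrow> (\<forall>i j. inner_prod UNIV (b i) (b j) = (if i = j then 1 else 0))"

definition psd :: "'x set \<Rightarrow> 'x op \<Rightarrow> bool" where
  "psd X A \<longleftrightarrow> (\<forall>v. inner_prod X v (op_apply X A v) \<in> \<real>\<^sub>\<ge>\<^sub>0)"

definition state :: "'x set \<Rightarrow> 'x op \<Rightarrow> bool" where
  "state X \<rho> \<longleftrightarrow> psd X \<rho> \<and> op_trace X \<rho> = 1"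

definition povm :: "'x set \<Rightarrow> nat \<Rightarrow> (nat \<Rightarrow> 'x op) \<Rightarrow> bool" where
  "povm X J Q \<longleftrightarrow>
     (\<forall>j<J. psd X (Q j)) \<and> (\<forall>x\<in>X. \<forall>y\<in>X. (\<Sum>j<J. Q j x y) = op_id x y)"

definition prob_dist :: "'i set \<Rightarrow> ('i \<Rightarrow> real) \<Rightarrow> bool" where
  "prob_dist I p \<longleftrightarrow> (\<forall>i\<in>I. 0 \<le> p i) \<and> (\<Sum>i\<in>I. p i) = 1"

text \<open>Partial traces over the first and the second tensor factor.\<close>

definition ptrace_fst :: "'s set \<Rightarrow> ('s \<times> 'x) op \<Rightarrow> 'x op" where
  "ptrace_fst S \<rho> = (\<lambda>x x'. \<Sum>s\<in>S. \<rho> (s, x) (s, x'))"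

definition ptrace_snd :: "'s set \<Rightarrow> ('x \<times> 's) op \<Rightarrow> 'x op" where
  "ptrace_snd S \<rho> = (\<lambda>x x'. \<Sum>s\<in>S. \<rho> (x, s) (x', s))"

text \<open>\<open>id \<otimes> \<Phi>\<close>: the map \<open>\<Phi>\<close> is applied to every block \<open>\<langle>s|\<rho>|s'\<rangle>\<close>.\<close>

definition id_tensor :: "('x op \<Rightarrow> 'y op) \<Rightarrow> ('s \<times> 'x) op \<Rightarrow> ('s \<times> 'y) op" where
  "id_tensor \<Phi> \<rho> = (\<lambda>(s, y) (s', y'). \<Phi> (\<lambda>x x'. \<rho> (s, x) (s', x')) y y')"

definition linear_map :: "('a op \<Rightarrow> 'b op) \<Rightarrow> bool" where
  "linear_map \<Phi> \<longleftrightarrow>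
     (\<forall>c \<rho> \<sigma>. \<Phi> (\<lambda>x y. c * \<rho> x y + \<sigma> x y) = (\<lambda>x y. c * \<Phi> \<rho> x y + \<Phi> \<sigma> x y))"

definition completely_positive :: "('a::finite op \<Rightarrow> 'b::finite op) \<Rightarrow> bool" where
  "completely_positive \<Phi> \<longleftrightarrow>
     (\<forall>(k::nat) \<rho>. psd ({..<k} \<times> UNIV) \<rho> \<longrightarrow> psd ({..<k} \<times> UNIV) (id_tensor \<Phi> \<rho>))"

definition trace_preserving :: "('a::finite op \<Rightarrow> 'b::finite op) \<Rightarrow> bool" where
  "trace_preserving \<Phi> \<longleftrightarrow> (\<forall>\<rho>. op_trace UNIV (\<Phi> \<rho>) = op_trace UNIV \<rho>)"

definition quantum_channel :: "('a::finite op \<Rightarrow> 'b::finite op) \<Rightarrow> bool" where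
  "quantum_channel \<Phi> \<longleftrightarrow> linear_map \<Phi> \<and> completely_positive \<Phi> \<and> trace_preserving \<Phi>"

text \<open>\<open>V y a\<close> is the matrix element \<open>\<langle>y|V|a\<rangle>\<close> of \<open>V : A \<rightarrow> Y\<close>; \<open>conjugate_by V \<rho>\<close> is \<open>V \<rho> V\<^sup>\<dagger>\<close>.\<close>

definition isometry :: "('y::finite \<Rightarrow> 'a::finite \<Rightarrow> complex) \<Rightarrow> bool" where
  "isometry V \<longleftrightarrow> (\<forall>a a'. (\<Sum>y\<in>UNIV. cnj (V y a) * V y a') = op_id a a')"

definition conjugate_by :: "('y::finite \<Rightarrow> 'a::finite \<Rightarrow> complex) \<Rightarrow> 'a op \<Rightarrow> 'y op" where
  "conjugate_by V \<rho> = (\<lambda>y y'. \<Sum>a\<in>UNIV. \<Sum>a'\<in>UNIV. V y a * \<rho> a a' * cnj (V y' a'))"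

definition complementary_channel ::
    "('a::finite op \<Rightarrow> 'b::finite op) \<Rightarrow> ('a op \<Rightarrow> 'e::finite op) \<Rightarrow> bool" where
  "complementary_channel \<N> \<N>c \<longleftrightarrow>
     (\<exists>V :: 'b \<times> 'e \<Rightarrow> 'a \<Rightarrow> complex. isometry V \<and>
        (\<forall>\<rho>. \<N> \<rho> = ptrace_snd UNIV (conjugate_by V \<rho>)) \<and>
        (\<forall>\<rho>. \<N>c \<rho> = ptrace_fst UNIV (conjugate_by V \<rho>)))"

text \<open>
  The \<open>n\<close>-fold tensor power \<open>\<Phi>\<^sup>\<otimes>\<^sup>n\<close>, which sends the matrix unit
  \<open>|x\<^sub>1\<dots>x\<^sub>n\<rangle>\<langle>x'\<^sub>1\<dots>x'\<^sub>n|\<close> to \<open>\<Phi>(|x\<^sub>1\<rangle>\<langle>x'\<^sub>1|) \<otimes> \<dots> \<otimes> \<Phi>(|x\<^sub>n\<rangle>\<langle>x'\<^sub>n|)\<close>, extended linearly.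
\<close>

definition tensor_power ::
    "nat \<Rightarrow> ('a::finite op \<Rightarrow> 'b::finite op) \<Rightarrow> 'a list op \<Rightarrow> 'b list op" where
  "tensor_power n \<Phi> \<rho> = (\<lambda>ys ys'. \<Sum>xs\<in>words n. \<Sum>xs'\<in>words n.
     \<rho> xs xs' * (\<Prod>k<n. \<Phi> (ket_bra (basis_vec (xs ! k)) (basis_vec (xs' ! k))) (ys ! k) (ys' ! k)))"

text \<open>
  Codes with \<open>\<kappa>\<close> auxiliary qubits and \<open>N\<close> messages \<open>m < N\<close>; the auxiliary qubits
  have label set \<open>words \<kappa> :: bool list set\<close>.
\<close>

definition code ::
    "('a::finite op \<Rightarrow> 'b::finite op) \<Rightarrow> nat \<Rightarrow> real \<Rightarrow> nat \<Rightarrow> nat \<Rightarrow>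
     (nat \<Rightarrow> (bool list \<times> 'a list) op) \<Rightarrow> (nat \<Rightarrow> (bool list \<times> 'b list) op) \<Rightarrow> bool" where
  "code \<N> n \<epsilon> \<kappa> N \<rho> D \<longleftrightarrow>
     (\<forall>m<N. state (words \<kappa> \<times> words n) (\<rho> m)) \<and>
     povm (words \<kappa> \<times> words n) N D \<and>
     (\<Sum>m<N. Re (op_trace (words \<kappa> \<times> words n)
        (op_mult (words \<kappa> \<times> words n) (id_tensor (tensor_power n \<N>) (\<rho> m))
           (\<lambda>x y. op_id x y - D m x y)))) / real N \<le> \<epsilon>"

definition eve_state ::
    "('a::finite op \<Rightarrow> 'e::finite op) \<Rightarrow> nat \<Rightarrow> nat \<Rightarrow> (bool list \<times> 'a list) op \<Rightarrow> 'e list op" where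
  "eve_state \<N>c n \<kappa> \<rho> = tensor_power n \<N>c (ptrace_fst (words \<kappa>) \<rho>)"

definition weakly_locked ::
    "('a::finite op \<Rightarrow> 'e::finite op) \<Rightarrow> nat \<Rightarrow> real \<Rightarrow> nat \<Rightarrow> nat \<Rightarrow>
     (nat \<Rightarrow> (bool list \<times> 'a list) op) \<Rightarrow> bool" where
  "weakly_locked \<N>c n \<delta> \<kappa> N \<rho> \<longleftrightarrow>
     (\<forall>J Q. povm (words n) J Q \<longrightarrow>
        (\<exists>\<Omega>. prob_dist {..<J} \<Omega> \<and>
           (\<Sum>m<N. \<Sum>j<J. cmod (op_trace (words n)
              (op_mult (words n) (eve_state \<N>c n \<kappa> (\<rho> m)) (Q j)) - of_real (\<Omega> j))) / real N
           \<le> \<delta>))"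

definition achievable_rate ::
    "('a::finite op \<Rightarrow> 'b::finite op) \<Rightarrow> ('a op \<Rightarrow> 'e::finite op) \<Rightarrow> real \<Rightarrow> bool" where
  "achievable_rate \<N> \<N>c R \<longleftrightarrow>
     (\<exists>(\<kappa> :: nat \<Rightarrow> nat) (\<epsilon> :: nat \<Rightarrow> real) (\<delta> :: nat \<Rightarrow> real).
        (\<lambda>n. real (\<kappa> n)) \<in> o(\<lambda>n. real n) \<and> \<epsilon> \<longlonglongrightarrow> 0 \<and> \<delta> \<longlonglongrightarrow> 0 \<and>
        (\<forall>\<^sub>F n in sequentially. \<exists>N \<rho> D.
           code \<N> n (\<epsilon> n) (\<kappa> n) N \<rho> D \<and> weakly_locked \<N>c n (\<delta> n) (\<kappa> n) N \<rho> \<and>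
           real N \<ge> 2 powr (real n * R)))"

text \<open>
  The value does not depend on which complementary channel \<open>\<N>c\<close> of \<open>\<N>\<close> is taken, as it is
  unique up to isometries on its output.
\<close>

definition weak_locking_capacity ::
    "('a::finite op \<Rightarrow> 'b::finite op) \<Rightarrow> ('a op \<Rightarrow> 'e::finite op) \<Rightarrow> ereal" where
  "weak_locking_capacity \<N> \<N>c = Sup (ereal ` {R. achievable_rate \<N> \<N>c R})"

text \<open>
  The power \<open>A\<^sup>-\<^sup>1\<^sup>/\<^sup>2\<close> of a positive semidefinite \<open>A\<close> on its support, by functional calculus: every
  eigenvector of \<open>A\<close> with eigenvalue \<open>l\<close> is one of \<open>A\<^sup>-\<^sup>1\<^sup>/\<^sup>2\<close> with eigenvalue \<open>l\<^sup>-\<^sup>1\<^sup>/\<^sup>2\<close>. Since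
  \<open>0 powr r = 0\<close>, the kernel of \<open>A\<close> is sent to \<open>0\<close>.
\<close>

definition inv_sqrt_on_support :: "'x::finite op \<Rightarrow> 'x op" where
  "inv_sqrt_on_support A = (THE T. \<forall>(l::real) v.
     op_apply UNIV A v = (\<lambda>x. of_real l * v x) \<longrightarrow>
     op_apply UNIV T v = (\<lambda>x. of_real (l powr (- 1 / 2)) * v x))"

definition support :: "'x::finite op \<Rightarrow> 'x cvec set" where
  "support A = range (op_apply UNIV A)"

definition average_state :: "('i::finite \<Rightarrow> real) \<Rightarrow> ('i \<Rightarrow> 'e op) \<Rightarrow> 'e op" where
  "average_state p \<rho> = (\<lambda>x y. \<Sum>i\<in>UNIV. of_real (p i) * \<rho> i x y)"

definition ensemble_povm ::
    "('i::finite \<Rightarrow> real) \<Rightarrow> ('i \<Rightarrow> 'e::finite op) \<Rightarrow> 'i \<Rightarrow> 'e op" where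
  "ensemble_povm p \<rho> i =
     (let T = inv_sqrt_on_support (average_state p \<rho>)
      in op_mult UNIV (op_mult UNIV T (\<lambda>x y. of_real (p i) * \<rho> i x y)) T)"

definition qc_channel :: "('i \<Rightarrow> 'e::finite op) \<Rightarrow> 'e op \<Rightarrow> 'i op" where
  "qc_channel M \<psi> = (\<lambda>i j. if i = j then op_trace UNIV (op_mult UNIV \<psi> (M i)) else 0)"

text \<open>Entropy in bits; \<open>log 2 0 = 0\<close> gives the usual convention for vanishing probabilities.\<close>

definition shannon_entropy :: "('i::finite \<Rightarrow> real) \<Rightarrow> real" where
  "shannon_entropy p = - (\<Sum>i\<in>UNIV. p i * log 2 (p i))"

text \<open>
  Minimum output entropy of the qc-channel of \<open>M\<close> over the states on the subspace \<open>S\<close>. The infimum is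
  over a compact set (nonempty if \<open>S \<noteq> {0}\<close>) and the entropy is continuous, so it is attained.
\<close>

definition min_output_entropy ::
    "'e cvec set \<Rightarrow> ('i::finite \<Rightarrow> 'e::finite op) \<Rightarrow> real" where
  "min_output_entropy S M =
     (INF \<psi>\<in>{\<psi>. state UNIV \<psi> \<and> support \<psi> \<subseteq> S}. shannon_entropy (\<lambda>i. Re (qc_channel M \<psi> i i)))"

end

theory Submission
  imports Defs "HOL-Real_Asymp.Real_Asymp"
begin

text \<open>
  A cq complement leaves the basis words perfectly distinguishable for Bob, so the pre-shared secret
  can be used as the seed of a hash function: message \<open>m\<close> and seed \<open>s\<close> are encoded as the mixture,
  weighted by \<open>p\<^sup>n\<close>, of the basis words that hash to \<open>m\<close> under \<open>s\<close>. Conditioned on an outcome of Eve's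
  measurement, every letter of the word, given the preceding ones, is distributed like \<open>\<M>(\<psi>)\<close> for some
  state \<open>\<psi>\<close> and so has entropy at least \<open>H\<close>, the minimum output entropy. An exponential moment turns this
  into a bound on the probability that the posterior weight of the word exceeds \<open>2\<^sup>-\<^sup>n\<^sup>(\<^sup>H\<^sup>-\<^sup>\<epsilon>\<^sup>)\<close>. Random hash
  functions with polynomially many seeds are near uniform on all such distributions simultaneously, so
  whatever Eve measures, the hash value stays almost uniform for her at any rate below \<open>H\<close>.
\<close>

subsection \<open>Hash functions that extract from every source of high min-entropy\<close>

text \<open>The obstacle is the order of choices: the code is fixed first, and Eve then picks any
  collective measurement out of a continuum, with any number of outcomes. No net over measurements
  is needed, because an outcome enters only through the posterior it induces on words, while the
  property asked of the hash function speaks only of sets \<open>T\<close> of messages. There are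
  \<open>2 ^ N\<close> of these, with \<open>N\<close> exponential in \<open>n\<close>, but far
  fewer seeds. A single word is therefore biased towards some given \<open>T\<close> with a
  probability much larger than \<open>2 ^ - N\<close>, and demanding that no word be biased would
  not survive the union bound. Only the simultaneous bias of more than \<open>N + 1\<close>
  independently hashed words is rare enough. The exceptional words cost \<open>(N + 1) / S\<close>
  against posteriors bounded by \<open>1 / S\<close>, which is why the rate must stay below the
  entropy.

  The measurement \<open>M\<close> arises from Bayes' rule: given an outcome \<open>Q\<close>, the
  posterior of a letter drawn from the ensemble is the output of its square-root measurement on a
  state that depends on \<open>Q\<close>. This turns a statement about all of Eve's operators into
  one about the minimum output entropy.\<close>

lemma exp_le_quadratic:
  fixes z :: real
  assumes "z \<le> 1"
  shows "exp z \<le> 1 + z + z\<^sup>2"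
proof (cases "0 \<le> z")
  case True
  then show ?thesis using exp_bound assms by simp
next
  case False
  \<comment> \<open>\<open>exp_bound\<close> covers only nonnegative arguments. The entropy estimate
    applies the lemma to \<open>s * ln r\<close>, which is unbounded below, so all negative
    \<open>z\<close> are treated, by \<open>(1 - u + u^2) * (1 + u) = 1 + u^3\<close>.\<close>
  define u where "u = - z"
  have u: "u > 0" using False u_def by simp
  have "exp u \<ge> 1 + u" by simp
  have "(1 - u + u\<^sup>2) * (1 + u) = 1 + u^3"
    by (simp add: algebra_simps power2_eq_square power3_eq_cube)
  then have "(1 - u + u\<^sup>2) * (1 + u) \<ge> 1" using u by simp
  moreover have pos: "1 - u + u\<^sup>2 > 0" 
  proof -
    have "1 - u + u\<^sup>2 = (u - 1/2)\<^sup>2 + 3/4" by (simp add: power2_eq_square algebra_simps)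
    moreover have "(u - 1/2)\<^sup>2 \<ge> 0" by simp
    ultimately show ?thesis by linarith
  qed
  ultimately have "(1 - u + u\<^sup>2) * exp u \<ge> 1"
    using mult_left_mono[OF \<open>exp u \<ge> 1 + u\<close>, of "1 - u + u\<^sup>2"] by linarith
  then have "exp (- u) \<le> 1 - u + u\<^sup>2"
    using pos by (simp add: exp_minus field_simps)
  then show ?thesis by (simp add: u_def)
qed

text \<open>For a uniform message the indicator of \<open>T\<close> minus its mean is centred, so
  the linear term of the quadratic bound on \<open>exp\<close> sums to zero and only
  \<open>l^2\<close> survives.\<close>

lemma exp_moment_le:
  fixes N :: nat and T :: "nat set" and l d :: real
  assumes N: "N > 0" and T: "T \<subseteq> {..<N}" and l: "0 \<le> l" "l \<le> 1"
  shows "(\<Sum>m<N. exp (l * (of_bool (m \<in> T) - card T / N))) \<le> N * exp (l\<^sup>2)"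
proof -
  define t where "t = card T / N"
  have fT: "finite T" using T finite_subset by blast
  have "card T \<le> N" using card_mono[OF _ T] by simp
  then have t: "0 \<le> t" "t \<le> 1" using N by (auto simp: t_def)
  have sT: "(\<Sum>m<N. of_bool (m \<in> T)) = real (card T)"
    using T by (simp add: sum.If_cases of_bool_def Int_absorb1)
  have "(\<Sum>m<N. exp (l * (of_bool (m \<in> T) - t))) \<le> (\<Sum>m<N. 1 + l * (of_bool (m \<in> T) - t) + l\<^sup>2)"
  proof (rule sum_mono)
    fix m
    define y where "y = of_bool (m \<in> T) - t"
    have y: "\<bar>y\<bar> \<le> 1" using t by (auto simp: y_def)
    have "\<bar>l * y\<bar> \<le> 1" using y l by (simp add: abs_mult mult_le_one)
    then have "exp (l * y) \<le> 1 + l * y + (l * y)\<^sup>2" by (intro exp_le_quadratic) simp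
    also have "(l*y)\<^sup>2 \<le> l\<^sup>2" using y l 
      by (simp add: power_mult_distrib mult_left_le abs_square_le_1)
    finally show "exp (l * (of_bool (m \<in> T) - t)) \<le> 1 + l * (of_bool (m \<in> T) - t) + l\<^sup>2"
      by (simp add: y_def)
  qed
  also have "\<dots> = N + l * ((\<Sum>m<N. of_bool (m \<in> T)) - N * t) + N * l\<^sup>2"
    by (simp add: sum.distrib sum_distrib_left[symmetric] sum_subtractf)
  also have "\<dots> = N * (1 + l\<^sup>2)" using N by (simp only: sT) (simp add: t_def algebra_simps)
  also have "\<dots> \<le> N * exp (l\<^sup>2)" by (intro mult_left_mono) auto
  finally show ?thesis by (simp add: t_def)
qed

text \<open>\<open>c\<close> is one row of the hash table: the values of a fixed point under all
  seeds. Only an excess over the fair share of \<open>T\<close> counts, since the distance between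
  two distributions is twice the positive part of their difference.\<close>

definition biased :: "'k set \<Rightarrow> nat \<Rightarrow> real \<Rightarrow> nat set \<Rightarrow> ('k \<Rightarrow> nat) \<Rightarrow> bool" where
  "biased Ks N d T c \<longleftrightarrow> (\<Sum>k\<in>Ks. of_bool (c k \<in> T)) > card Ks * (card T / N + d)"

text \<open>Chernoff's bound as a count of rows. The exponential moment \<open>w\<close> dominates
  the indicator of a biased row, and being a product over the seeds it has a sum over all rows that
  factorises.\<close>

lemma sum_exp_biased_le:
  fixes N :: nat and d :: real
  assumes N: "N > 0" and T: "T \<subseteq> {..<N}" and d: "0 \<le> d" "d \<le> 1" and "finite Ks"
  shows "\<exists>w. (\<forall>c. 0 \<le> w c \<and> (biased Ks N d T c \<longrightarrow> 1 \<le> w c)) \<and>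
    (\<Sum>c\<in>PiE Ks (\<lambda>_. {..<N}). w c) \<le> card (PiE Ks (\<lambda>_. {..<N})) * exp (- (card Ks * d\<^sup>2 / 4))"
proof -
  \<comment> \<open>The minimiser of \<open>l^2 - l * d\<close>, the exponent contributed by each
    seed; the minimum is \<open>- d^2 / 4\<close>.\<close>
  define l where "l = d / 2"
  define t where "t = card T / N"
  define w :: "('a \<Rightarrow> nat) \<Rightarrow> real" where "w c = (\<Prod>k\<in>Ks. exp (l * (of_bool (c k \<in> T) - t) - l * d))" for c
  have w1: "1 \<le> w c" if "biased Ks N d T c" for c
  proof -
    have "w c = exp (\<Sum>k\<in>Ks. l * (of_bool (c k \<in> T) - t) - l * d)"
      by (simp add: w_def exp_sum assms)
    also have "(\<Sum>k\<in>Ks. l * (of_bool (c k \<in> T) - t) - l * d) = 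
        l * ((\<Sum>k\<in>Ks. of_bool (c k \<in> T)) - card Ks * (t + d))"
      by (simp add: sum_subtractf sum_distrib_left[symmetric] algebra_simps)
    finally have e: "w c = exp (l * ((\<Sum>k\<in>Ks. of_bool (c k \<in> T)) - card Ks * (t + d)))" .
    have "0 \<le> l * ((\<Sum>k\<in>Ks. of_bool (c k \<in> T)) - card Ks * (t + d))"
      using that d by (intro mult_nonneg_nonneg) (auto simp: biased_def l_def t_def)
    then show ?thesis using e by simp
  qed
  have "(\<Sum>c\<in>PiE Ks (\<lambda>_. {..<N}). w c) = (\<Prod>k\<in>Ks. \<Sum>m<N. exp (l * (of_bool (m \<in> T) - t) - l * d))"
    unfolding w_def by (rule prod_sum_PiE[symmetric]) (use assms in auto)
  also have "\<dots> \<le> (\<Prod>k\<in>Ks. N * exp (- (d\<^sup>2 / 4)))"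
  proof (rule prod_mono, safe)
    show "0 \<le> (\<Sum>m<N. exp (l * (of_bool (m \<in> T) - t) - l * d))" by (intro sum_nonneg) auto
    have "(\<Sum>m<N. exp (l * (of_bool (m \<in> T) - t) - l * d)) =
       (\<Sum>m<N. exp (l * (of_bool (m \<in> T) - t))) * exp (- l * d)"
      by (simp add: sum_distrib_right exp_diff exp_minus divide_inverse)
    also have "\<dots> \<le> N * exp (l\<^sup>2) * exp (- l * d)"
      using exp_moment_le[OF N T, of l] d unfolding t_def by (intro mult_right_mono) (auto simp: l_def)
    also have "\<dots> = N * exp (l\<^sup>2 - l * d)" by (simp add: exp_diff exp_minus divide_inverse)
    also have "l\<^sup>2 - l * d = - (d\<^sup>2 / 4)" by (simp add: l_def power2_eq_square)
    finally show "(\<Sum>m<N. exp (l * (of_bool (m \<in> T) - t) - l * d)) \<le> N * exp (- (d\<^sup>2 / 4))" .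
  qed
  also have "\<dots> = N ^ card Ks * exp (- (card Ks * d\<^sup>2 / 4))"
    by (simp add: power_mult_distrib exp_of_nat_mult[symmetric])
  also have "real (N ^ card Ks) = card (PiE Ks (\<lambda>_. {..<N}))"
    by (simp add: card_PiE assms)
  finally have "(\<Sum>c\<in>PiE Ks (\<lambda>_. {..<N}). w c) \<le> card (PiE Ks (\<lambda>_. {..<N})) * exp (- (card Ks * d\<^sup>2 / 4))" .
  moreover have "0 \<le> w c" for c unfolding w_def by (intro prod_nonneg) auto
  ultimately show ?thesis using w1 by blast
qed

text \<open>\<open>2 ^ #{biased points}\<close> is at most a product over the points of independent factors with mean
  close to 1. This survives the union bound over all \<open>2 ^ N\<close> sets \<open>T\<close>.\<close>

lemma few_biased_points:
  fixes N :: nat and d :: real and X :: "'x set" and Ks :: "'k set"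
  assumes N: "N > 0" and d: "0 \<le> d" "d \<le> 1" and fin: "finite Ks" "finite X"
    and small: "card X * exp (- (card Ks * d\<^sup>2 / 4)) \<le> ln 2"
  shows "\<exists>h. (\<forall>x\<in>X. \<forall>k\<in>Ks. h x k < N) \<and>
     (\<forall>T\<subseteq>{..<N}. card {x\<in>X. biased Ks N d T (h x)} \<le> N + 1)"
proof (rule ccontr)
  assume neg: "\<not> ?thesis"
  define C where "C = PiE Ks (\<lambda>_. {..<N})"
  \<comment> \<open>\<open>G\<close> consists of all hash tables. Sums over \<open>G\<close> replace
    expectations, and the rows of distinct points are independent because \<open>G\<close> is a
    product.\<close>
  define G where "G = PiE X (\<lambda>_. C)"
  have fC: "finite C" unfolding C_def using fin by (intro finite_PiE) auto
  have fG: "finite G" unfolding G_def using fin fC by (intro finite_PiE) auto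
  have "C \<noteq> {}" using N by (auto simp: C_def PiE_eq_empty_iff)
  then have "G \<noteq> {}" by (auto simp: G_def PiE_eq_empty_iff)
  then have G0: "card G > 0" using fG by (simp add: card_gt_0_iff)
  define good where "good T w \<longleftrightarrow> (\<forall>c. 0 \<le> w c \<and> (biased Ks N d T c \<longrightarrow> 1 \<le> w c)) \<and>
    (\<Sum>c\<in>C. w c) \<le> card C * exp (- (card Ks * d\<^sup>2 / 4))" for T w
  define w where "w T = (SOME w. good T w)" for T
  have gw: "good T (w T)" if "T \<subseteq> {..<N}" for T
  proof -
    have "\<exists>w. good T w" using sum_exp_biased_le[OF N that d fin(1)] by (simp only: good_def C_def)
    then show ?thesis unfolding w_def by (rule someI_ex)
  qed
  have w: "\<And>T c. T \<subseteq> {..<N} \<Longrightarrow> 0 \<le> w T c"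
      "\<And>T c. T \<subseteq> {..<N} \<Longrightarrow> biased Ks N d T c \<Longrightarrow> 1 \<le> w T c"
      "\<And>T. T \<subseteq> {..<N} \<Longrightarrow> (\<Sum>c\<in>C. w T c) \<le> card C * exp (- (card Ks * d\<^sup>2 / 4))"
    using gw unfolding good_def by simp_all
  have lower: "2 ^ (N + 2) \<le> (\<Sum>T\<in>Pow {..<N}. \<Prod>x\<in>X. 1 + w T (g x))" if g: "g \<in> G" for g
  proof -
    have "\<forall>x\<in>X. \<forall>k\<in>Ks. g x k < N" using g by (auto simp: G_def C_def PiE_def Pi_def)
    then obtain T where T: "T \<subseteq> {..<N}" "card {x\<in>X. biased Ks N d T (g x)} > N + 1"
      using neg[unfolded not_ex, THEN spec, of g] by (auto simp: not_le)
    define Y where "Y = {x\<in>X. biased Ks N d T (g x)}"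
    have "(2::real) ^ (N+2) \<le> 2 ^ card Y" using T(2) by (intro power_increasing) (auto simp: Y_def)
    also have "\<dots> = (\<Prod>x\<in>Y. 2)" by simp
    also have "\<dots> \<le> (\<Prod>x\<in>Y. 1 + w T (g x))"
      using w(2)[OF T(1)] by (intro prod_mono) (auto simp: Y_def)
    also have "\<dots> \<le> (\<Prod>x\<in>X. 1 + w T (g x))"
      using w(1)[OF T(1)] fin by (intro prod_mono2) (auto simp: Y_def add_nonneg_nonneg)
    also have "\<dots> \<le> (\<Sum>T\<in>Pow {..<N}. \<Prod>x\<in>X. 1 + w T (g x))"
      by (rule member_le_sum) (use T w(1) in \<open>auto intro!: prod_nonneg add_nonneg_nonneg\<close>)
    finally show ?thesis .
  qed
  have upper: "(\<Sum>g\<in>G. \<Prod>x\<in>X. 1 + w T (g x)) \<le> 2 * card G" if T: "T \<subseteq> {..<N}" for T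
  proof -
    have "(\<Sum>g\<in>G. \<Prod>x\<in>X. 1 + w T (g x)) = (\<Prod>x\<in>X. \<Sum>c\<in>C. 1 + w T c)"
      unfolding G_def by (rule prod_sum_PiE[symmetric]) (use fin fC in auto)
    also have "\<dots> \<le> (\<Prod>x\<in>X. card C * exp (exp (- (card Ks * d\<^sup>2 / 4))))"
    proof (rule prod_mono, safe)
      show "0 \<le> (\<Sum>c\<in>C. 1 + w T c)" using w(1)[OF T] by (intro sum_nonneg) (auto simp: add_nonneg_nonneg)
      have "(\<Sum>c\<in>C. 1 + w T c) \<le> card C * (1 + exp (- (card Ks * d\<^sup>2 / 4)))"
        using w(3)[OF T] by (simp add: sum.distrib algebra_simps)
      also have "\<dots> \<le> card C * exp (exp (- (card Ks * d\<^sup>2 / 4)))"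
        by (intro mult_left_mono exp_ge_add_one_self) auto
      finally show "(\<Sum>c\<in>C. 1 + w T c) \<le> card C * exp (exp (- (card Ks * d\<^sup>2 / 4)))" .
    qed
    also have "\<dots> = card G * exp (card X * exp (- (card Ks * d\<^sup>2 / 4)))"
      using fin by (simp add: power_mult_distrib G_def card_PiE exp_of_nat_mult)
    also have "\<dots> \<le> card G * exp (ln 2)"
      using small by (intro mult_left_mono iffD2[OF exp_le_cancel_iff]) auto
    finally show ?thesis by simp
  qed
  \<comment> \<open>Double counting. If every table fails, each contributes at least
    \<open>2 ^ (N + 2)\<close>. Each of the \<open>2 ^ N\<close> sets contributes at most
    \<open>2 * card G\<close>, where the factor 2 is \<open>exp (ln 2)\<close> from
    \<open>small\<close>. The gap between the exponents \<open>N + 2\<close> and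
    \<open>N + 1\<close> fixes the number of biased points allowed.\<close>
  have "card G * 2 ^ (N+2) \<le> (\<Sum>g\<in>G. \<Sum>T\<in>Pow {..<N}. \<Prod>x\<in>X. 1 + w T (g x))"
    using sum_mono[OF lower, of G] by simp
  also have "\<dots> = (\<Sum>T\<in>Pow {..<N}. \<Sum>g\<in>G. \<Prod>x\<in>X. 1 + w T (g x))" by (rule sum.swap)
  also have "\<dots> \<le> (\<Sum>T\<in>Pow {..<N}. real (2 * card G))" using upper by (intro sum_mono) auto
  also have "\<dots> = card G * 2 ^ (N+1)" by (simp add: card_Pow)
  finally show False using G0 by simp
qed

text \<open>The points of weight above \<open>1 / S\<close> and the biased ones are negligible; \<open>h\<close> does not depend
  on \<open>q\<close>.\<close>

lemma hash_near_uniform: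
  fixes N :: nat and d S :: real and h :: "'x \<Rightarrow> 'k \<Rightarrow> nat"
  assumes N: "N > 0" and d: "0 \<le> d" and S: "0 < S" and fin: "finite Ks" "Ks \<noteq> {}" "finite X"
    and h: "\<forall>x\<in>X. \<forall>k\<in>Ks. h x k < N"
    and few: "\<forall>T\<subseteq>{..<N}. card {x\<in>X. biased Ks N d T (h x)} \<le> N + 1"
    and q: "\<And>x. x \<in> X \<Longrightarrow> 0 \<le> q x" "(\<Sum>x\<in>X. q x) = 1"
  shows "(\<Sum>m<N. \<bar>(\<Sum>x\<in>X. q x * ((\<Sum>k\<in>Ks. of_bool (h x k = m)) / card Ks)) - 1 / N\<bar>)
    \<le> 2 * ((\<Sum>x\<in>{x\<in>X. q x > 1 / S}. q x) + d + (N + 1) / S)"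
proof -
  define P where "P m = (\<Sum>x\<in>X. q x * ((\<Sum>k\<in>Ks. of_bool (h x k = m)) / card Ks))" for m
  \<comment> \<open>The messages that receive too much mass: \<open>P\<close> and the uniform
    distribution have the same total, so the distance is twice the excess on \<open>T\<close>. This
    set depends on \<open>q\<close>, which is harmless because \<open>few\<close> holds for all sets
    at once.\<close>
  define T where "T = {m. m < N \<and> P m > 1 / N}"
  define g where "g x = (\<Sum>k\<in>Ks. of_bool (h x k \<in> T)) / real (card Ks)" for x
  define t where "t = card T / N"
  have K0: "card Ks > 0" using fin by (simp add: card_gt_0_iff)
  have T: "T \<subseteq> {..<N}" by (auto simp: T_def)
  have fT: "finite T" using T finite_subset by blast
  have sumP: "(\<Sum>m\<in>M. P m) = (\<Sum>x\<in>X. q x * ((\<Sum>k\<in>Ks. of_bool (h x k \<in> M)) / card Ks))" if "finite M" for M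
  proof -
    have *: "(\<Sum>m\<in>M. of_bool (a = m)) = (of_bool (a \<in> M) :: real)" for a
      using that by (simp add: of_bool_def)
    have "(\<Sum>m\<in>M. P m) = (\<Sum>x\<in>X. \<Sum>m\<in>M. q x * ((\<Sum>k\<in>Ks. of_bool (h x k = m)) / card Ks))"
      unfolding P_def by (rule sum.swap)
    also have "\<dots> = (\<Sum>x\<in>X. q x * ((\<Sum>m\<in>M. \<Sum>k\<in>Ks. of_bool (h x k = m)) / card Ks))"
      by (simp add: sum_distrib_left sum_divide_distrib)
    also have "\<dots> = (\<Sum>x\<in>X. q x * ((\<Sum>k\<in>Ks. \<Sum>m\<in>M. of_bool (h x k = m)) / card Ks))"
      by (subst sum.swap) simp
    finally show ?thesis by (simp only: *)
  qed
  have "(\<Sum>m<N. P m) = (\<Sum>x\<in>X. q x * ((\<Sum>k\<in>Ks. of_bool (h x k \<in> {..<N})) / card Ks))"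
    by (rule sumP) simp
  also have "\<dots> = (\<Sum>x\<in>X. q x)" using h K0 by (intro sum.cong) auto
  finally have P1: "(\<Sum>m<N. P m) = 1" using q by simp
  have "(\<Sum>m<N. \<bar>P m - 1 / N\<bar>) = (\<Sum>m<N. 2 * (if m \<in> T then P m - 1 / N else 0) - (P m - 1 / N))"
    by (intro sum.cong) (auto simp: T_def)
  also have "\<dots> = 2 * (\<Sum>m<N. if m \<in> T then P m - 1 / N else 0)"
    using P1 N by (simp add: sum_subtractf sum_distrib_left)
  also have "(\<Sum>m<N. if m \<in> T then P m - 1 / N else 0) = (\<Sum>m\<in>T. P m - 1 / N)"
    using T by (simp add: sum.If_cases Int_absorb1)
  also have "\<dots> = (\<Sum>x\<in>X. q x * g x) - t"
    by (simp add: sum_subtractf sumP[OF fT] g_def t_def)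
  also have "\<dots> = (\<Sum>x\<in>X. q x * (g x - t))"
    by (simp add: right_diff_distrib sum_subtractf sum_distrib_right[symmetric] q)
  also have "\<dots> \<le> (\<Sum>x\<in>X. (if q x > 1 / S then q x else 0) + q x * d + 
      (if biased Ks N d T (h x) then 1 / S else 0))"
  proof (rule sum_mono)
    fix x assume x: "x \<in> X"
    have "(\<Sum>k\<in>Ks. of_bool (h x k \<in> T)) \<le> (\<Sum>k\<in>Ks. (1::real))" by (intro sum_mono) auto
    then have g1: "g x \<le> 1" using K0 by (simp add: g_def)
    have t0: "0 \<le> t" by (simp add: t_def)
    have gt: "g x - t \<le> 1" using g1 t0 by simp
    have qd: "0 \<le> q x * d" using q(1)[OF x] d by simp
    \<comment> \<open>Heavy points pay with their own weight, light biased points with at most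
      \<open>1 / S\<close> each, and every other point exceeds the fair share by at most
      \<open>d\<close>.\<close>
    consider "q x > 1 / S" | "q x \<le> 1/S" "biased Ks N d T (h x)" | "q x \<le> 1/S" "\<not> biased Ks N d T (h x)" by linarith
    then show "q x * (g x - t) \<le> (if q x > 1 / S then q x else 0) + q x * d + 
      (if biased Ks N d T (h x) then 1 / S else 0)"
    proof cases
      case 1
      then show ?thesis using mult_left_mono[OF gt q(1)[OF x]] qd S by (simp add: add_increasing2)
    next
      case 2
      then show ?thesis using mult_left_mono[OF gt q(1)[OF x]] qd by simp
    next
      case 3
      then have "g x \<le> t + d" using K0 by (simp add: biased_def g_def t_def field_simps)
      then show ?thesis using 3 mult_left_mono[of "g x - t" d, OF _ q(1)[OF x]] by simp
    qed
  qed
  also have "\<dots> = (\<Sum>x\<in>{x\<in>X. q x > 1 / S}. q x) + d + card {x\<in>X. biased Ks N d T (h x)} / S"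
    using fin q by (simp add: sum.distrib sum_distrib_right[symmetric] sum.inter_filter[symmetric])
  also have "\<dots> \<le> (\<Sum>x\<in>{x\<in>X. q x > 1 / S}. q x) + d + (N + 1) / S"
    using few T S by (intro add_mono divide_right_mono) (auto simp del: of_nat_Suc of_nat_add)
  finally show ?thesis unfolding P_def by (simp add: add.commute)
qed

subsection \<open>The spectral theorem\<close>

lemma inner_prod_add_right: "inner_prod X u (\<lambda>x. v x + w x) = inner_prod X u v + inner_prod X u w"
  by (simp add: inner_prod_def sum.distrib algebra_simps)

lemma inner_prod_add_left: "inner_prod X (\<lambda>x. u x + v x) w = inner_prod X u w + inner_prod X v w"
  by (simp add: inner_prod_def sum.distrib algebra_simps)

lemma inner_prod_diff_right: "inner_prod X u (\<lambda>x. v x - w x) = inner_prod X u v - inner_prod X u w"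
  by (simp add: inner_prod_def sum_subtractf algebra_simps)

lemma inner_prod_scale_right: "inner_prod X u (\<lambda>x. c * v x) = c * inner_prod X u v"
  by (simp add: inner_prod_def sum_distrib_left algebra_simps)

lemma inner_prod_scale_left: "inner_prod X (\<lambda>x. c * u x) v = cnj c * inner_prod X u v"
  by (simp add: inner_prod_def sum_distrib_left algebra_simps)

lemma inner_prod_sum_right:
  "inner_prod X u (\<lambda>x. \<Sum>i\<in>I. f i x) = (\<Sum>i\<in>I. inner_prod X u (f i))"
  by (simp add: inner_prod_def sum_distrib_left) (rule sum.swap)

lemma cnj_inner_prod: "cnj (inner_prod X u v) = inner_prod X v u"
  by (simp add: inner_prod_def mult.commute)

lemma inner_prod_self: "inner_prod X u u = of_real (\<Sum>x\<in>X. (cmod (u x))\<^sup>2)"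
  unfolding inner_prod_def of_real_sum
  by (intro sum.cong refl) (metis complex_norm_square mult.commute of_real_power)

lemma inner_prod_self_eq_0: "finite X \<Longrightarrow> inner_prod X u u = 0 \<longleftrightarrow> (\<forall>x\<in>X. u x = 0)"
  unfolding inner_prod_self of_real_eq_0_iff by (subst sum_nonneg_eq_0_iff) auto

lemma op_apply_add: "op_apply X A (\<lambda>x. v x + w x) = (\<lambda>x. op_apply X A v x + op_apply X A w x)"
  by (simp add: op_apply_def sum.distrib algebra_simps)

lemma op_apply_scale: "op_apply X A (\<lambda>x. c * v x) = (\<lambda>x. c * op_apply X A v x)"
  by (simp add: op_apply_def sum_distrib_left algebra_simps)

definition hermitian :: "'x op \<Rightarrow> bool" where
  "hermitian A \<longleftrightarrow> (\<forall>x y. A y x = cnj (A x y))"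

lemma inner_prod_hermitian:
  assumes "hermitian A"
  shows "inner_prod X u (op_apply X A v) = inner_prod X (op_apply X A u) v"
proof -
  have "inner_prod X u (op_apply X A v) = (\<Sum>x\<in>X. \<Sum>y\<in>X. cnj (u x) * (A x y * v y))"
    by (simp add: inner_prod_def op_apply_def sum_distrib_left)
  also have "\<dots> = (\<Sum>y\<in>X. \<Sum>x\<in>X. cnj (u x) * (A x y * v y))" by (rule sum.swap)
  also have "\<dots> = inner_prod X (op_apply X A u) v"
    unfolding inner_prod_def op_apply_def cnj_sum sum_distrib_right
    by (intro sum.cong refl) (metis assms hermitian_def complex_cnj_mult mult.assoc mult.commute)
  finally show ?thesis .
qed

text \<open>The maximiser of the Rayleigh quotient over the orthogonal complement of the
  eigenvectors already found is a further eigenvector.\<close>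

lemma eigenvector_in_complement:
  fixes A :: "'e::finite op" and b :: "'j \<Rightarrow> 'e cvec"
  assumes herm: "hermitian A" and J: "finite J" "card J < CARD('e)"
    and eig: "\<And>j. j \<in> J \<Longrightarrow> op_apply UNIV A (b j) = (\<lambda>x. of_real (m j) * b j x)"
  shows "\<exists>v l. inner_prod UNIV v v = 1 \<and> (\<forall>j\<in>J. inner_prod UNIV (b j) v = 0) \<and>
    op_apply UNIV A v = (\<lambda>x. of_real l * v x)"
proof -
  define q where "q u v = inner_prod UNIV u (op_apply UNIV A v)" for u v
  define W where "W = {v. \<forall>j\<in>J. inner_prod UNIV (b j) v = 0}"
  define S where "S = sphere 0 1 \<inter> {v :: complex ^ 'e. ($) v \<in> W}"
  have nrm: "inner_prod UNIV (($) v) (($) v) = of_real ((norm v)\<^sup>2)" for v :: "complex ^ 'e"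
    by (simp add: inner_prod_self norm_vec_def L2_set_def sum_nonneg)
  have cont: "continuous_on T (\<lambda>v :: complex ^ 'e. inner_prod UNIV c (($) v))" for c T
    unfolding inner_prod_def by (intro continuous_intros)
  have "{v :: complex ^ 'e. ($) v \<in> W} = (\<Inter>j\<in>J. {v. inner_prod UNIV (b j) (($) v) = 0})"
    by (auto simp: W_def)
  also have "closed \<dots>" by (intro closed_INT ballI closed_Collect_eq cont continuous_intros)
  finally have cS: "compact S" unfolding S_def by (intro compact_Int_closed) auto
  \<comment> \<open>Orthogonality in \<open>complex ^ 'e\<close> is that of a real space of
    dimension \<open>2 * CARD('e)\<close>. Being real-orthogonal to both \<open>b j\<close> and
    \<open>\<i> * b j\<close> kills the real and the imaginary part of the complex inner
    product.\<close>
  define B where "B = (\<Union>j\<in>J. {\<chi> x. b j x, \<chi> x. \<i> * b j x})"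
  have "card B \<le> (\<Sum>j\<in>J. card {\<chi> x. b j x, \<chi> x. \<i> * b j x})"
    unfolding B_def by (rule card_UN_le) (use J in auto)
  also have "\<dots> \<le> (\<Sum>j\<in>J. 2)" by (intro sum_mono) (simp add: card_insert_if)
  also have "\<dots> < DIM(complex ^ 'e)" using J by simp
  finally have "card B < DIM(complex ^ 'e)" .
  moreover have "finite B" using J by (auto simp: B_def)
  ultimately have "dim B < DIM(complex ^ 'e)" using dim_le_card'[of B] by linarith
  then obtain z where z: "z \<noteq> 0" "\<And>y. y \<in> span B \<Longrightarrow> orthogonal z y"
    using orthogonal_to_subspace_exists by blast
  have zW: "($) z \<in> W"
  proof -
    have "inner_prod UNIV (b j) (($) z) = 0" if j: "j \<in> J" for j
    proof (rule complex_eqI)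
      have "orthogonal z (\<chi> x. b j x)" "orthogonal z (\<chi> x. \<i> * b j x)"
        using j by (auto intro!: z span_base simp: B_def)
      then show "Re (inner_prod UNIV (b j) (($) z)) = Re 0" "Im (inner_prod UNIV (b j) (($) z)) = Im 0"
        by (simp_all add: orthogonal_def inner_vec_def inner_prod_def inner_complex_def
            algebra_simps sum_subtractf sum.distrib)
    qed
    then show ?thesis by (simp add: W_def)
  qed
  have scaleW: "(\<lambda>x. c * u x) \<in> W" if "u \<in> W" for c u
    using that by (simp add: W_def inner_prod_scale_right)
  have addW: "(\<lambda>x. u x + u' x) \<in> W" if "u \<in> W" "u' \<in> W" for u u'
    using that by (simp add: W_def inner_prod_add_right)
  define z' where "z' = (1 / norm z) *\<^sub>R z"
  have "($) z' = (\<lambda>x. of_real (1 / norm z) * z $ x)"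
    by (simp add: z'_def fun_eq_iff scaleR_conv_of_real[where 'a = complex])
  moreover have "norm z' = 1" using z(1) by (simp add: z'_def)
  ultimately have "z' \<in> S" using scaleW[OF zW, of "of_real (1 / norm z)"] by (simp add: S_def)
  then have neS: "S \<noteq> {}" by blast
  have "continuous_on S (\<lambda>v. Re (q (($) v) (($) v)))"
    unfolding q_def inner_prod_def op_apply_def by (intro continuous_intros)
  then obtain v0 where v0: "v0 \<in> S" "\<And>u. u \<in> S \<Longrightarrow> Re (q (($) u) (($) u)) \<le> Re (q (($) v0) (($) v0))"
    using continuous_attains_sup[OF cS neS] by blast
  define v where "v = ($) v0"
  define l where "l = Re (q v v)"
  have vW: "v \<in> W" and vv: "inner_prod UNIV v v = 1"
    using v0(1) nrm[of v0] by (auto simp: S_def v_def)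
  have q_herm: "q u w = cnj (q w u)" for u w
    unfolding q_def cnj_inner_prod by (rule inner_prod_hermitian[OF herm])
  have qvv: "q v v = of_real l"
    using q_herm[of v v] by (simp add: l_def complex_eq_iff)
  have max: "Re (q u u) \<le> l * Re (inner_prod UNIV u u)" if u: "u \<in> W" for u
  proof (cases "inner_prod UNIV u u = 0")
    case True
    then have "u = (\<lambda>_. 0)" using inner_prod_self_eq_0[of UNIV u] by auto
    then show ?thesis by (simp add: q_def inner_prod_def)
  next
    case False
    define r where "r = norm (\<chi> x. u x)"
    have r: "inner_prod UNIV u u = of_real (r\<^sup>2)" using nrm[of "\<chi> x. u x"]
      by (simp add: r_def vec_lambda_inverse)
    then have r0: "r > 0" using False by (simp add: r_def)
    define w where "w = (\<chi> x. of_real (1 / r) * u x)"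
    have wu: "($) w = (\<lambda>x. of_real (1 / r) * u x)" by (simp add: w_def fun_eq_iff)
    have "inner_prod UNIV (($) w) (($) w) = 1"
      unfolding wu inner_prod_scale_left inner_prod_scale_right r
      using r0 by (simp add: power2_eq_square)
    then have "(norm w)\<^sup>2 = 1" unfolding nrm by (metis of_real_eq_1_iff)
    then have "norm w = 1" by (simp add: power2_eq_1_iff) (smt (verit) norm_ge_zero)
    then have "w \<in> S" using scaleW[OF u, of "of_real (1 / r)"] by (simp add: S_def wu)
    from v0(2)[OF this] have "Re (q (($) w) (($) w)) \<le> l" by (simp add: l_def v_def)
    moreover have "q (($) w) (($) w) = of_real (1 / r\<^sup>2) * q u u"
      unfolding q_def wu inner_prod_scale_left op_apply_scale inner_prod_scale_right
      by (simp add: power2_eq_square)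
    ultimately have "Re (q u u) / r\<^sup>2 \<le> l" by simp
    then show ?thesis using r r0 by (simp add: field_simps)
  qed
  \<comment> \<open>The residual of the eigenvalue equation. It lies in the same complement, so
    \<open>v + t * w\<close> competes with \<open>v\<close> for every real \<open>t\<close>.\<close>
  define w where "w = (\<lambda>x. op_apply UNIV A v x - of_real l * v x)"
  have wW: "w \<in> W"
    unfolding W_def
  proof safe
    fix j assume j: "j \<in> J"
    have "inner_prod UNIV (b j) v = 0" using vW j by (simp add: W_def)
    moreover have "inner_prod UNIV (b j) (op_apply UNIV A v) = cnj (of_real (m j)) * inner_prod UNIV (b j) v"
      unfolding inner_prod_hermitian[OF herm] eig[OF j] inner_prod_scale_left ..
    ultimately show "inner_prod UNIV (b j) w = 0"
      by (simp add: w_def inner_prod_diff_right inner_prod_scale_right)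
  qed
  define n where "n = Re (inner_prod UNIV w w)"
  define c where "c = Re (q w w)"
  have ww: "inner_prod UNIV w w = of_real n" by (simp add: n_def inner_prod_self)
  have n0: "n \<ge> 0" by (simp add: n_def inner_prod_self sum_nonneg)
  have vw: "inner_prod UNIV v w = 0"
    using qvv vv by (simp add: w_def q_def inner_prod_diff_right inner_prod_scale_right)
  then have wv: "inner_prod UNIV w v = 0" using cnj_inner_prod[of UNIV v w] by simp
  have Av: "op_apply UNIV A v = (\<lambda>x. w x + of_real l * v x)" by (simp add: w_def)
  have qwv: "q w v = of_real n"
    unfolding q_def Av inner_prod_add_right inner_prod_scale_right wv ww by simp
  then have qvw: "q v w = of_real n" using q_herm[of v w] by simp
  \<comment> \<open>Maximality along \<open>v + t * w\<close>: the first-order gain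
    \<open>2 * t * n\<close> must be absorbed by terms of order \<open>t^2\<close>.\<close>
  have ineq: "2 * n \<le> t * (l * n - c)" if t: "t > 0" for t :: real
  proof -
    let ?u = "\<lambda>x. v x + of_real t * w x"
    have "Re (q ?u ?u) = l + 2 * t * n + t * t * c"
      unfolding q_def op_apply_add op_apply_scale inner_prod_add_left inner_prod_add_right
        inner_prod_scale_left inner_prod_scale_right
      unfolding q_def[symmetric] qvv qwv qvw by (simp add: c_def algebra_simps)
    moreover have "Re (inner_prod UNIV ?u ?u) = 1 + t * t * n"
      unfolding inner_prod_add_left inner_prod_add_right
        inner_prod_scale_left inner_prod_scale_right vv vw wv ww by simp
    ultimately have "l + 2 * t * n + t * t * c \<le> l * (1 + t * t * n)"
      using max[OF addW[OF vW scaleW[OF wW]], of "of_real t"] by simp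
    then have "t * (2 * n) \<le> t * (t * (l * n - c))" by (simp add: algebra_simps)
    then show ?thesis using t by simp
  qed
  have "n = 0"
  proof (rule ccontr)
    assume "n \<noteq> 0"
    then have n: "n > 0" using n0 by simp
    define D where "D = l * n - c"
    \<comment> \<open>This \<open>t\<close> is small enough to make the right-hand side at most
      \<open>n\<close>, which is impossible for positive \<open>n\<close>.\<close>
    have "2 * n \<le> n / (1 + \<bar>D\<bar>) * D" using ineq[of "n / (1 + \<bar>D\<bar>)"] n by (simp add: D_def add_pos_nonneg)
    also have "\<dots> \<le> n / (1 + \<bar>D\<bar>) * (1 + \<bar>D\<bar>)" using n by (intro mult_left_mono) auto
    also have "\<dots> = n" by simp
    finally show False using n by simp
  qed
  then have "w = (\<lambda>_. 0)" using ww inner_prod_self_eq_0[of UNIV w] by auto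
  then have "op_apply UNIV A v = (\<lambda>x. of_real l * v x)" by (simp add: Av)
  then show ?thesis using vv vW by (auto simp: W_def)
qed

text \<open>Eigenvectors are added one index at a time. The complement of those already found
  contains another as long as an index is left over.\<close>

theorem spectral_theorem:
  fixes A :: "'e::finite op"
  assumes herm: "hermitian A"
  shows "\<exists>b l. orthonormal_basis b \<and> (\<forall>i. op_apply UNIV A (b i) = (\<lambda>x. of_real (l i :: real) * b i x))"
proof -
  have "\<exists>b l. (\<forall>i\<in>J. \<forall>j\<in>J. inner_prod UNIV (b i) (b j) = (if i = j then 1 else 0)) \<and>
     (\<forall>i\<in>J. op_apply UNIV A (b i) = (\<lambda>x. of_real (l i :: real) * b i x))" for J :: "'e set"
    using finite[of J]
  proof induction
    case (insert a J)
    then obtain b l where b: "\<And>i j. i \<in> J \<Longrightarrow> j \<in> J \<Longrightarrow> inner_prod UNIV (b i) (b j) = (if i = j then 1 else 0)"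
       "\<And>i. i \<in> J \<Longrightarrow> op_apply UNIV A (b i) = (\<lambda>x. of_real (l i :: real) * b i x)" by blast
    have "card J < CARD('e)" using insert by (intro psubset_card_mono) auto
    then obtain v m where v: "inner_prod UNIV v v = 1" "\<And>j. j \<in> J \<Longrightarrow> inner_prod UNIV (b j) v = 0"
        "op_apply UNIV A v = (\<lambda>x. of_real m * v x)"
      using eigenvector_in_complement[OF herm insert(1) _ b(2), of "\<lambda>j. j"] by auto
    have v': "inner_prod UNIV v (b j) = 0" if "j \<in> J" for j
      using v(2)[OF that] cnj_inner_prod[of UNIV "b j" v] by simp
    have "j \<noteq> a" if "j \<in> J" for j using that insert by blast
    then show ?case using b v v' insert
      by (intro exI[of _ "b(a := v)"] exI[of _ "l(a := m)"]) auto
  qed simp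
  from this[of UNIV] show ?thesis by (simp add: orthonormal_basis_def)
qed

subsection \<open>Gram operators and functional calculus\<close>

definition spectral_op :: "('e::finite \<Rightarrow> 'e cvec) \<Rightarrow> ('e \<Rightarrow> complex) \<Rightarrow> 'e op" where
  "spectral_op b f = (\<lambda>x y. \<Sum>i\<in>UNIV. f i * b i x * cnj (b i y))"

text \<open>A weighted sum of rank-one operators \<open>|g k><g k|\<close>. States and projectors
  are kept in this form because positivity, traces and conjugation then reduce to the single terms;
  the isometry of the channel delivers the states in this form directly.\<close>

definition gram_op :: "'k set \<Rightarrow> ('k \<Rightarrow> real) \<Rightarrow> ('k \<Rightarrow> 'x cvec) \<Rightarrow> 'x op" where
  "gram_op I c g = (\<lambda>x y. \<Sum>k\<in>I. of_real (c k) * g k x * cnj (g k y))"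

lemma op_mult_assoc: "op_mult X (op_mult X A B) C = op_mult X A (op_mult X B C)"
proof (intro ext)
  fix x z
  have "op_mult X (op_mult X A B) C x z = (\<Sum>y\<in>X. \<Sum>w\<in>X. A x w * B w y * C y z)"
    by (simp add: op_mult_def sum_distrib_right)
  also have "\<dots> = (\<Sum>w\<in>X. \<Sum>y\<in>X. A x w * B w y * C y z)" by (rule sum.swap)
  also have "\<dots> = op_mult X A (op_mult X B C) x z"
    by (simp add: op_mult_def sum_distrib_left mult.assoc)
  finally show "op_mult X (op_mult X A B) C x z = op_mult X A (op_mult X B C) x z" .
qed

lemma op_apply_mult: "op_apply X (op_mult X A B) v = op_apply X A (op_apply X B v)"
proof
  fix x
  have "op_apply X (op_mult X A B) v x = (\<Sum>y\<in>X. \<Sum>w\<in>X. A x w * B w y * v y)"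
    by (simp add: op_mult_def op_apply_def sum_distrib_right)
  also have "\<dots> = (\<Sum>w\<in>X. \<Sum>y\<in>X. A x w * B w y * v y)" by (rule sum.swap)
  also have "\<dots> = op_apply X A (op_apply X B v) x"
    by (simp add: op_apply_def sum_distrib_left mult.assoc)
  finally show "op_apply X (op_mult X A B) v x = op_apply X A (op_apply X B v) x" .
qed

lemma op_trace_mult_commute: "op_trace X (op_mult X A B) = op_trace X (op_mult X B A)"
  unfolding op_trace_def op_mult_def by (subst sum.swap) (simp add: mult.commute)

lemma op_mult_scale_left: "op_mult X (\<lambda>x y. c * A x y) B = (\<lambda>x y. c * op_mult X A B x y)"
  by (simp add: op_mult_def sum_distrib_left mult.assoc)

lemma op_mult_scale_right: "op_mult X A (\<lambda>x y. c * B x y) = (\<lambda>x y. c * op_mult X A B x y)"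
  by (simp add: op_mult_def sum_distrib_left mult_ac)

lemma op_trace_scale: "op_trace X (\<lambda>x y. c * A x y) = c * op_trace X A"
  by (simp add: op_trace_def sum_distrib_left)

lemma op_trace_mult_sum_left:
  "op_trace X (op_mult X (\<lambda>x y. \<Sum>i\<in>I. A i x y) B) = (\<Sum>i\<in>I. op_trace X (op_mult X (A i) B))"
proof -
  have "op_trace X (op_mult X (\<lambda>x y. \<Sum>i\<in>I. A i x y) B) = (\<Sum>x\<in>X. \<Sum>y\<in>X. \<Sum>i\<in>I. A i x y * B y x)"
    by (simp add: op_trace_def op_mult_def sum_distrib_right)
  also have "\<dots> = (\<Sum>x\<in>X. \<Sum>i\<in>I. \<Sum>y\<in>X. A i x y * B y x)"
    by (intro sum.cong refl sum.swap)
  also have "\<dots> = (\<Sum>i\<in>I. \<Sum>x\<in>X. \<Sum>y\<in>X. A i x y * B y x)" by (rule sum.swap)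
  finally show ?thesis by (simp add: op_trace_def op_mult_def)
qed

lemma hermitian_gram_op: "hermitian (gram_op I c g)"
  by (simp add: hermitian_def gram_op_def algebra_simps)

lemma op_apply_gram_op:
  "op_apply X (gram_op I c g) v = (\<lambda>x. \<Sum>k\<in>I. of_real (c k) * inner_prod X (g k) v * g k x)"
proof
  fix x
  have "op_apply X (gram_op I c g) v x = (\<Sum>y\<in>X. \<Sum>k\<in>I. of_real (c k) * g k x * cnj (g k y) * v y)"
    by (simp add: op_apply_def gram_op_def sum_distrib_right)
  also have "\<dots> = (\<Sum>k\<in>I. \<Sum>y\<in>X. of_real (c k) * g k x * cnj (g k y) * v y)" by (rule sum.swap)
  finally show "op_apply X (gram_op I c g) v x = (\<Sum>k\<in>I. of_real (c k) * inner_prod X (g k) v * g k x)"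
    by (simp add: inner_prod_def sum_distrib_left sum_distrib_right mult_ac)
qed

lemma inner_prod_gram_op:
  "inner_prod X v (op_apply X (gram_op I c g) v) = of_real (\<Sum>k\<in>I. c k * (cmod (inner_prod X (g k) v))\<^sup>2)"
proof -
  have "inner_prod X v (op_apply X (gram_op I c g) v) =
      (\<Sum>k\<in>I. of_real (c k) * (inner_prod X (g k) v * cnj (inner_prod X (g k) v)))"
    unfolding op_apply_gram_op inner_prod_sum_right inner_prod_scale_right cnj_inner_prod
    by (simp add: mult.assoc)
  then show ?thesis by (simp add: complex_norm_square[symmetric])
qed

lemma nonneg_Reals_sum:
  fixes f :: "'k \<Rightarrow> complex"
  assumes "\<And>k. k \<in> I \<Longrightarrow> f k \<in> \<real>\<^sub>\<ge>\<^sub>0"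
  shows "sum f I \<in> \<real>\<^sub>\<ge>\<^sub>0"
  using assms by (induction I rule: infinite_finite_induct) auto

lemma psd_gram_op:
  assumes "\<And>k. k \<in> I \<Longrightarrow> 0 \<le> c k"
  shows "psd X (gram_op I c g)"
  unfolding psd_def inner_prod_gram_op nonneg_Reals_of_real_iff
  using assms by (auto intro!: sum_nonneg)

lemma op_trace_gram_op: "op_trace X (gram_op I c g) = (\<Sum>k\<in>I. of_real (c k) * inner_prod X (g k) (g k))"
  unfolding op_trace_def gram_op_def inner_prod_def sum_distrib_left
  by (subst sum.swap) (simp add: mult_ac)

lemma op_trace_gram_op_mult:
  "op_trace X (op_mult X (gram_op I c g) Q) = (\<Sum>k\<in>I. of_real (c k) * inner_prod X (g k) (op_apply X Q (g k)))"
proof -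
  have "op_trace X (op_mult X (gram_op I c g) Q) =
      (\<Sum>x\<in>X. \<Sum>y\<in>X. \<Sum>k\<in>I. of_real (c k) * g k x * cnj (g k y) * Q y x)"
    by (simp add: op_trace_def op_mult_def gram_op_def sum_distrib_right)
  also have "\<dots> = (\<Sum>y\<in>X. \<Sum>x\<in>X. \<Sum>k\<in>I. of_real (c k) * g k x * cnj (g k y) * Q y x)" by (rule sum.swap)
  also have "\<dots> = (\<Sum>y\<in>X. \<Sum>k\<in>I. \<Sum>x\<in>X. of_real (c k) * g k x * cnj (g k y) * Q y x)"
    by (intro sum.cong refl sum.swap)
  also have "\<dots> = (\<Sum>k\<in>I. \<Sum>y\<in>X. \<Sum>x\<in>X. of_real (c k) * g k x * cnj (g k y) * Q y x)" by (rule sum.swap)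
  finally show ?thesis
    by (simp add: inner_prod_def op_apply_def sum_distrib_left mult_ac)
qed

lemma op_trace_gram_op_psd:
  assumes "\<And>k. k \<in> I \<Longrightarrow> 0 \<le> c k" "psd X Q"
  shows "op_trace X (op_mult X (gram_op I c g) Q) \<in> \<real>\<^sub>\<ge>\<^sub>0"
  unfolding op_trace_gram_op_mult using assms
  by (auto intro!: nonneg_Reals_sum nonneg_Reals_mult_I simp: psd_def)

lemma conjugate_gram_op:
  assumes "hermitian S"
  shows "op_mult X (op_mult X S (gram_op I c g)) S = gram_op I c (\<lambda>k. op_apply X S (g k))"
proof (intro ext)
  fix x z
  have "op_mult X (op_mult X S (gram_op I c g)) S x z =
     (\<Sum>y\<in>X. \<Sum>w\<in>X. \<Sum>k\<in>I. of_real (c k) * (S x w * g k w) * (cnj (g k y) * S y z))"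
    by (simp add: op_mult_def gram_op_def sum_distrib_left sum_distrib_right mult_ac)
  also have "\<dots> = (\<Sum>y\<in>X. \<Sum>k\<in>I. \<Sum>w\<in>X. of_real (c k) * (S x w * g k w) * (cnj (g k y) * S y z))"
    by (intro sum.cong refl sum.swap)
  also have "\<dots> = (\<Sum>k\<in>I. \<Sum>y\<in>X. \<Sum>w\<in>X. of_real (c k) * (S x w * g k w) * (cnj (g k y) * S y z))"
    by (rule sum.swap)
  also have "\<dots> = (\<Sum>k\<in>I. \<Sum>y\<in>X. \<Sum>w\<in>X. of_real (c k) * (S x w * g k w) * cnj (S z y * g k y))"
  proof (intro sum.cong refl)
    fix k y w
    have "S y z = cnj (S z y)" using assms unfolding hermitian_def by blast
    then show "of_real (c k) * (S x w * g k w) * (cnj (g k y) * S y z) =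
        of_real (c k) * (S x w * g k w) * cnj (S z y * g k y)" by (simp only: complex_cnj_mult mult_ac)
  qed
  also have "\<dots> = gram_op I c (\<lambda>k. op_apply X S (g k)) x z"
    by (simp add: gram_op_def op_apply_def sum_distrib_left sum_distrib_right mult_ac) (intro sum.cong refl sum.swap)
  finally show "op_mult X (op_mult X S (gram_op I c g)) S x z = gram_op I c (\<lambda>k. op_apply X S (g k)) x z" .
qed

text \<open>The basis forms a square matrix with a left inverse, which in finite dimension is also a
  right inverse.\<close>

lemma orthonormal_basis_complete:
  fixes b :: "'e::finite \<Rightarrow> 'e cvec"
  assumes "orthonormal_basis b"
  shows "(\<Sum>i\<in>UNIV. b i x * cnj (b i y)) = (if x = y then 1 else 0)"
proof -
  define U :: "complex ^ 'e ^ 'e" where "U = (\<chi> x i. b i x)"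
  define V :: "complex ^ 'e ^ 'e" where "V = (\<chi> i x. cnj (b i x))"
  have "V ** U = mat 1"
    using assms by (simp add: vec_eq_iff matrix_matrix_mult_def mat_def U_def V_def
        orthonormal_basis_def inner_prod_def)
  then have "U ** V = mat 1" by (simp add: matrix_left_right_inverse)
  then have "(U ** V) $ x $ y = (if x = y then 1 else 0)" by (simp add: mat_def)
  then show ?thesis by (simp add: matrix_matrix_mult_def U_def V_def)
qed

lemma orthonormal_basis_expand:
  assumes "orthonormal_basis b"
  shows "v = (\<lambda>x. \<Sum>i\<in>UNIV. inner_prod UNIV (b i) v * b i x)"
proof
  fix x
  have "(\<Sum>i\<in>UNIV. inner_prod UNIV (b i) v * b i x) = (\<Sum>i\<in>UNIV. \<Sum>y\<in>UNIV. (b i x * cnj (b i y)) * v y)"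
    by (simp add: inner_prod_def sum_distrib_right sum_distrib_left mult_ac)
  also have "\<dots> = (\<Sum>y\<in>UNIV. \<Sum>i\<in>UNIV. (b i x * cnj (b i y)) * v y)" by (rule sum.swap)
  also have "\<dots> = v x"
    by (simp add: sum_distrib_right[symmetric] orthonormal_basis_complete[OF assms] if_distrib[of "\<lambda>c. c * _"] cong: if_cong)
  finally show "v x = (\<Sum>i\<in>UNIV. inner_prod UNIV (b i) v * b i x)" ..
qed

lemma op_eqI_basis:
  assumes b: "orthonormal_basis b" and eq: "\<And>i. op_apply UNIV A (b i) = op_apply UNIV B (b i)"
  shows "A = B"
proof (intro ext)
  fix x y
  have *: "C x y = (\<Sum>i\<in>UNIV. op_apply UNIV C (b i) x * cnj (b i y))" for C
  proof -
    have "(\<Sum>i\<in>UNIV. op_apply UNIV C (b i) x * cnj (b i y)) = (\<Sum>i\<in>UNIV. \<Sum>z\<in>UNIV. C x z * (b i z * cnj (b i y)))"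
      by (simp add: op_apply_def sum_distrib_right sum_distrib_left mult_ac)
    also have "\<dots> = (\<Sum>z\<in>UNIV. \<Sum>i\<in>UNIV. C x z * (b i z * cnj (b i y)))" by (rule sum.swap)
    also have "\<dots> = C x y"
      by (simp add: sum_distrib_left[symmetric] orthonormal_basis_complete[OF b] if_distrib[of "\<lambda>c. _ * c"] cong: if_cong)
    finally show ?thesis ..
  qed
  show "A x y = B x y" unfolding *[of A] *[of B] eq ..
qed

lemma op_apply_spectral_op:
  "op_apply UNIV (spectral_op b f) v = (\<lambda>x. \<Sum>i\<in>UNIV. f i * inner_prod UNIV (b i) v * b i x)"
proof
  fix x
  have "op_apply UNIV (spectral_op b f) v x = (\<Sum>y\<in>UNIV. \<Sum>i\<in>UNIV. f i * b i x * cnj (b i y) * v y)"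
    by (simp add: op_apply_def spectral_op_def sum_distrib_right)
  also have "\<dots> = (\<Sum>i\<in>UNIV. \<Sum>y\<in>UNIV. f i * b i x * cnj (b i y) * v y)" by (rule sum.swap)
  finally show "op_apply UNIV (spectral_op b f) v x = (\<Sum>i\<in>UNIV. f i * inner_prod UNIV (b i) v * b i x)"
    by (simp add: inner_prod_def sum_distrib_left sum_distrib_right mult_ac)
qed

lemma spectral_op_apply_basis:
  assumes "orthonormal_basis b"
  shows "op_apply UNIV (spectral_op b f) (b i) = (\<lambda>x. f i * b i x)"
  using assms unfolding op_apply_spectral_op orthonormal_basis_def
  by (simp add: mult_delta_left mult_delta_right)

lemma spectral_op_mult:
  assumes "orthonormal_basis b"
  shows "op_mult UNIV (spectral_op b f) (spectral_op b h) = spectral_op b (\<lambda>i. f i * h i)"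
  by (rule op_eqI_basis[OF assms])
    (simp add: op_apply_mult spectral_op_apply_basis[OF assms] op_apply_scale mult_ac)

lemma hermitian_spectral_op: "hermitian (spectral_op b (\<lambda>i. of_real (f i)))"
  by (simp add: hermitian_def spectral_op_def mult_ac)

lemma spectral_op_eq:
  assumes "orthonormal_basis b" "\<And>i. op_apply UNIV A (b i) = (\<lambda>x. of_real (l i) * b i x)"
  shows "A = spectral_op b (\<lambda>i. of_real (l i))"
  by (rule op_eqI_basis[OF assms(1)]) (simp add: assms(2) spectral_op_apply_basis[OF assms(1)])

text \<open>An eigenvector for \<open>m\<close> has components only along those \<open>b i\<close>
  with \<open>l i = m\<close>, so the right action on the basis is the right action on every
  eigenvector. Conversely the \<open>b i\<close> are themselves eigenvectors, which makes the
  operator unique.\<close>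

lemma inv_sqrt_on_support_spectral:
  fixes b :: "'e::finite \<Rightarrow> 'e cvec"
  assumes b: "orthonormal_basis b"
  shows "inv_sqrt_on_support (spectral_op b (\<lambda>i. of_real (l i))) = spectral_op b (\<lambda>i. of_real (l i powr (- 1 / 2)))"
  unfolding inv_sqrt_on_support_def
proof (rule the_equality, intro allI impI)
  fix m :: real and v
  assume eig: "op_apply UNIV (spectral_op b (\<lambda>i. of_real (l i))) v = (\<lambda>x. of_real m * v x)"
  have "(of_real (l i powr (- 1 / 2))) * inner_prod UNIV (b i) v = of_real (m powr (- 1 / 2)) * inner_prod UNIV (b i) v" for i
  proof -
    have "inner_prod UNIV (b i) (op_apply UNIV (spectral_op b (\<lambda>i. of_real (l i))) v) = of_real (l i) * inner_prod UNIV (b i) v"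
      by (simp add: inner_prod_hermitian[OF hermitian_spectral_op] spectral_op_apply_basis[OF b] inner_prod_scale_left)
    then have "of_real (l i) * inner_prod UNIV (b i) v = of_real m * inner_prod UNIV (b i) v"
      unfolding eig inner_prod_scale_right by (rule sym)
    then have "l i = m \<or> inner_prod UNIV (b i) v = 0" by (metis mult_cancel_right of_real_eq_iff)
    then show ?thesis by auto
  qed
  then have "op_apply UNIV (spectral_op b (\<lambda>i. of_real (l i powr (- 1 / 2)))) v =
      (\<lambda>x. \<Sum>i\<in>UNIV. of_real (m powr (- 1 / 2)) * inner_prod UNIV (b i) v * b i x)"
    unfolding op_apply_spectral_op by (simp only:)
  also have "\<dots> = (\<lambda>x. of_real (m powr (- 1 / 2)) * v x)"
  proof
    fix x
    have "v x = (\<Sum>i\<in>UNIV. inner_prod UNIV (b i) v * b i x)"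
      using orthonormal_basis_expand[OF b, of v] by (rule fun_cong)
    then show "(\<Sum>i\<in>UNIV. of_real (m powr (- 1 / 2)) * inner_prod UNIV (b i) v * b i x) = of_real (m powr (- 1 / 2)) * v x"
      by (simp add: sum_distrib_left mult.assoc)
  qed
  finally show "op_apply UNIV (spectral_op b (\<lambda>i. of_real (l i powr (- 1 / 2)))) v = (\<lambda>x. of_real (m powr (- 1 / 2)) * v x)" .
next
  fix T
  assume T: "\<forall>m v. op_apply UNIV (spectral_op b (\<lambda>i. of_real (l i))) v = (\<lambda>x. of_real m * v x) \<longrightarrow>
    op_apply UNIV T v = (\<lambda>x. of_real (m powr (- 1 / 2)) * v x)"
  show "T = spectral_op b (\<lambda>i. of_real (l i powr (- 1 / 2)))"
  proof (rule op_eqI_basis[OF b])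
    fix i
    have "op_apply UNIV T (b i) = (\<lambda>x. of_real (l i powr (- 1 / 2)) * b i x)"
      using T[rule_format, of "b i" "l i"] by (simp only: spectral_op_apply_basis[OF b])
    then show "op_apply UNIV T (b i) = op_apply UNIV (spectral_op b (\<lambda>i. of_real (l i powr (- 1 / 2)))) (b i)"
      by (simp only: spectral_op_apply_basis[OF b])
  qed
qed

subsection \<open>Posterior distributions as outputs of the qc-channel\<close>

lemma psd_conjugate:
  assumes "hermitian S" "psd X Q"
  shows "psd X (op_mult X (op_mult X S Q) S)"
  unfolding psd_def op_mult_assoc op_apply_mult inner_prod_hermitian[OF assms(1)]
  using assms(2) by (simp add: psd_def)

lemma psd_scale:
  assumes "psd X Q" "0 \<le> c"
  shows "psd X (\<lambda>x y. of_real c * Q x y)"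
proof -
  have "inner_prod X v (op_apply X (\<lambda>x y. of_real c * Q x y) v) = of_real c * inner_prod X v (op_apply X Q v)" for v
    by (simp add: inner_prod_def op_apply_def sum_distrib_left mult_ac)
  then show ?thesis using assms by (auto simp: psd_def intro!: nonneg_Reals_mult_I)
qed

lemma spectral_psd_gram:
  fixes A :: "'e::finite op"
  assumes "A = gram_op I c g" "\<And>k. k \<in> I \<Longrightarrow> 0 \<le> c k"
  obtains b l where "orthonormal_basis b" "\<And>i. 0 \<le> l i" "A = spectral_op b (\<lambda>i. of_real (l i))"
proof -
  have herm: "hermitian A" using assms hermitian_gram_op by blast
  obtain b l where b: "orthonormal_basis b" and
    l: "\<And>i. op_apply UNIV A (b i) = (\<lambda>x. of_real (l i :: real) * b i x)"
    using spectral_theorem[OF herm] by blast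
  have "0 \<le> l i" for i
  proof -
    have "inner_prod UNIV (b i) (op_apply UNIV A (b i)) = of_real (l i)"
      using b by (simp add: l inner_prod_scale_right orthonormal_basis_def)
    moreover have "psd UNIV A" using psd_gram_op assms by metis
    ultimately show ?thesis by (metis psd_def nonneg_Reals_of_real_iff)
  qed
  then show ?thesis using that b spectral_op_eq[OF b l] by blast
qed

lemma shannon_entropy_nonneg:
  assumes "\<And>i. 0 \<le> r i" "(\<Sum>i\<in>UNIV. r i) = 1"
  shows "0 \<le> shannon_entropy r"
proof -
  have "r i * log 2 (r i) \<le> 0" for i
  proof -
    have "r i \<le> (\<Sum>i\<in>UNIV. r i)" by (rule member_le_sum) (use assms in auto)
    then have "r i \<le> 1" using assms by simp
    then show ?thesis using assms(1)[of i]
      by (cases "r i = 0") (auto intro!: mult_nonneg_nonpos)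
  qed
  then have "(\<Sum>i\<in>UNIV. r i * log 2 (r i)) \<le> 0" by (intro sum_nonpos) auto
  then show ?thesis by (simp add: shannon_entropy_def)
qed

lemma average_state_gram:
  assumes "\<And>a. \<rho> a = gram_op UNIV (\<lambda>_. 1) (g a)"
  shows "average_state p \<rho> = gram_op UNIV (\<lambda>(a, k). p a) (\<lambda>(a, k). g a (k :: 'k::finite))"
proof (intro ext)
  fix x y
  have "gram_op UNIV (\<lambda>(a, k). p a) (\<lambda>(a, k). g a k) x y =
      (\<Sum>(a,k)\<in>UNIV \<times> UNIV. of_real (p a) * g a k x * cnj (g a k y))"
    by (simp add: gram_op_def case_prod_unfold)
  also have "\<dots> = (\<Sum>a\<in>UNIV. \<Sum>k\<in>UNIV. of_real (p a) * g a k x * cnj (g a k y))"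
    by (rule sum.cartesian_product[symmetric])
  finally show "average_state p \<rho> x y = gram_op UNIV (\<lambda>(a, k). p a) (\<lambda>(a, k). g a k) x y"
    by (simp add: average_state_def assms gram_op_def sum_distrib_left mult.assoc)
qed

text \<open>The state is \<open>\<psi> = A\<^sup>1\<^sup>/\<^sup>2 Q A\<^sup>1\<^sup>/\<^sup>2 / c\<close>, where \<open>A\<close> is the average state.\<close>

lemma min_output_entropy_le:
  fixes g :: "'a::finite \<Rightarrow> 'k::finite \<Rightarrow> 'e::finite cvec" and Q :: "'e op"
  assumes \<rho>: "\<And>a. \<rho> a = gram_op UNIV (\<lambda>_. 1) (g a)"
    and p: "\<And>a. 0 \<le> p a"
    and Q: "psd UNIV Q"
    and c: "op_trace UNIV (op_mult UNIV (average_state p \<rho>) Q) = of_real c" "0 < c"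
  shows "min_output_entropy (support (average_state p \<rho>)) (ensemble_povm p \<rho>)
    \<le> shannon_entropy (\<lambda>a. p a * Re (op_trace UNIV (op_mult UNIV (\<rho> a) Q)) / c)"
proof -
  let ?m = "op_mult UNIV" and ?tr = "op_trace UNIV"
  define A where "A = average_state p \<rho>"
  define X where "X a = gram_op UNIV (\<lambda>_. p a) (g a)" for a
  have X: "X a = (\<lambda>x y. of_real (p a) * \<rho> a x y)" for a
    by (simp add: X_def \<rho> gram_op_def sum_distrib_left mult.assoc)
  have Ag: "A = gram_op UNIV (\<lambda>(a, k). p a) (\<lambda>(a, k). g a k)"
    unfolding A_def by (rule average_state_gram[OF \<rho>])
  obtain b l where b: "orthonormal_basis b" and l: "\<And>i. 0 \<le> l i" and A: "A = spectral_op b (\<lambda>i. of_real (l i))"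
    by (rule spectral_psd_gram[OF Ag]) (use p in auto)
  \<comment> \<open>\<open>T\<close>, \<open>R\<close> and \<open>P\<close> are
    \<open>A^(-1/2)\<close>, \<open>A^(1/2)\<close> and the support projector of \<open>A\<close>.
    All are diagonal in the basis \<open>b\<close>, so their products reduce to the scalar
    identities \<open>sq\<close> and \<open>sq'\<close>.\<close>
  define T where "T = spectral_op b (\<lambda>i. of_real (l i powr (- 1 / 2)))"
  define R where "R = spectral_op b (\<lambda>i. of_real (sqrt (l i)))"
  define P where "P = spectral_op b (\<lambda>i. of_real (of_bool (l i \<noteq> 0)))"
  have herm: "hermitian T" "hermitian R" "hermitian P"
    unfolding T_def R_def P_def by (rule hermitian_spectral_op)+
  have T: "inv_sqrt_on_support A = T"
    unfolding A T_def by (rule inv_sqrt_on_support_spectral[OF b])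
  have sq: "l i powr (- 1 / 2) * sqrt (l i) = of_bool (l i \<noteq> 0)" for i
    using l[of i] by (cases "l i = 0") (auto simp: powr_half_sqrt[symmetric] powr_add[symmetric])
  have sq': "l i * l i powr (- 1 / 2) = sqrt (l i)" for i
    using l[of i] by (cases "l i = 0") (auto simp: powr_half_sqrt[symmetric] powr_mult_base)
  have TR: "?m T R = P" and RT: "?m R T = P" and AT: "?m A T = R" and PA: "?m P A = A" and RR: "?m R R = A"
    and TAT: "?m (?m T A) T = P"
    unfolding T_def R_def P_def A spectral_op_mult[OF b] of_real_mult[symmetric]
    using sq sq' l by (auto intro!: arg_cong[where f = "spectral_op b"] simp: mult_ac)
  have M: "ensemble_povm p \<rho> a = ?m (?m T (X a)) T" for a
    unfolding ensemble_povm_def Let_def X A_def[symmetric] T ..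
  \<comment> \<open>A kernel vector of \<open>A\<close> annihilates a sum of nonnegative terms
    \<open>p a * |<g a k, b i>|^2\<close>, hence each term; so every vector of positive weight lies
    in the support.\<close>
  have Pg: "op_apply UNIV P (g a k) = g a k" if "p a > 0" for a k
  proof -
    have ip: "inner_prod UNIV (b i) (g a k) = 0" if li: "l i = 0" for i
    proof -
      have "inner_prod UNIV (b i) (op_apply UNIV A (b i)) = 0"
        using li by (simp add: A spectral_op_apply_basis[OF b] inner_prod_def)
      then have "(\<Sum>(a,k)\<in>UNIV. p a * (cmod (inner_prod UNIV (g a k) (b i)))\<^sup>2) = 0"
        unfolding Ag inner_prod_gram_op of_real_eq_0_iff by (simp add: case_prod_unfold)
      then have "\<forall>x\<in>UNIV. (case x of (a,k) \<Rightarrow> p a * (cmod (inner_prod UNIV (g a k) (b i)))\<^sup>2) = 0"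
        by (subst (asm) sum_nonneg_eq_0_iff) (use p in auto)
      from bspec[OF this UNIV_I, of "(a, k)"] have "inner_prod UNIV (g a k) (b i) = 0"
        using \<open>p a > 0\<close> by simp
      then show ?thesis using cnj_inner_prod[of UNIV "g a k" "b i"] by simp
    qed
    have "op_apply UNIV P (g a k) = (\<lambda>x. \<Sum>i\<in>UNIV. inner_prod UNIV (b i) (g a k) * b i x)"
      unfolding P_def op_apply_spectral_op using ip by (intro ext sum.cong) auto
    then show ?thesis using orthonormal_basis_expand[OF b, of "g a k"] by simp
  qed
  have PXP: "?m (?m P (X a)) P = X a" for a
  proof (cases "p a = 0")
    case True
    then show ?thesis by (simp add: X_def gram_op_def op_mult_def)
  next
    case False
    then have "p a > 0" using p[of a] by simp
    then show ?thesis unfolding X_def conjugate_gram_op[OF herm(3)] using Pg by simp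
  qed
  have sumM: "(\<lambda>x y. \<Sum>a\<in>UNIV. ensemble_povm p \<rho> a x y) = P"
  proof -
    have AX: "A = (\<lambda>x y. \<Sum>a\<in>UNIV. X a x y)" by (simp add: A_def average_state_def X)
    have "?m (?m T A) T x z = (\<Sum>a\<in>UNIV. ?m (?m T (X a)) T x z)" for x z
    proof -
      have "?m (?m T A) T x z = (\<Sum>y\<in>UNIV. (\<Sum>w\<in>UNIV. \<Sum>a\<in>UNIV. T x w * X a w y * T y z))"
        by (simp add: op_mult_def AX sum_distrib_right sum_distrib_left mult_ac)
      also have "\<dots> = (\<Sum>y\<in>UNIV. (\<Sum>a\<in>UNIV. \<Sum>w\<in>UNIV. T x w * X a w y * T y z))"
        by (intro sum.cong refl sum.swap)
      also have "\<dots> = (\<Sum>a\<in>UNIV. \<Sum>y\<in>UNIV. \<Sum>w\<in>UNIV. T x w * X a w y * T y z)" by (rule sum.swap)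
      finally show ?thesis by (simp add: op_mult_def sum_distrib_right)
    qed
    then show ?thesis unfolding M TAT[symmetric] by (intro ext) simp
  qed
  define D where "D = {\<psi>. state UNIV \<psi> \<and> support \<psi> \<subseteq> support A}"
  define H where "H \<psi> = shannon_entropy (\<lambda>a. Re (qc_channel (ensemble_povm p \<rho>) \<psi> a a))" for \<psi>
  \<comment> \<open>The real infimum is a lower bound only once the entropies are bounded below.
    Their nonnegativity needs a normalised output, and the POVM elements sum only to
    \<open>P\<close>; the support condition supplies what is missing, as \<open>P\<close> fixes
    \<open>\<psi>\<close>.\<close>
  have "0 \<le> H \<psi>" if "\<psi> \<in> D" for \<psi>
    unfolding H_def
  proof (rule shannon_entropy_nonneg)
    have psd: "psd UNIV \<psi>" and tr: "?tr \<psi> = 1" and sup: "support \<psi> \<subseteq> support A"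
      using that by (auto simp: D_def state_def)
    fix a
    have "?tr (?m \<psi> (ensemble_povm p \<rho> a)) = ?tr (?m (gram_op UNIV (\<lambda>_. p a) (\<lambda>k. op_apply UNIV T (g a k))) \<psi>)"
      unfolding M X_def conjugate_gram_op[OF herm(1)] by (rule op_trace_mult_commute)
    also have "\<dots> \<in> \<real>\<^sub>\<ge>\<^sub>0" using p psd by (intro op_trace_gram_op_psd) auto
    finally show "0 \<le> Re (qc_channel (ensemble_povm p \<rho>) \<psi> a a)"
      by (simp add: qc_channel_def complex_nonneg_Reals_iff)
  next
    have psd: "psd UNIV \<psi>" and tr: "?tr \<psi> = 1" and sup: "support \<psi> \<subseteq> support A"
      using that by (auto simp: D_def state_def)
    have "?m P \<psi> = \<psi>"
    proof (rule op_eqI_basis[OF b])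
      fix i
      have "op_apply UNIV \<psi> (b i) \<in> support A" using sup by (auto simp: support_def)
      then obtain w where "op_apply UNIV \<psi> (b i) = op_apply UNIV A w" by (auto simp: support_def)
      then show "op_apply UNIV (?m P \<psi>) (b i) = op_apply UNIV \<psi> (b i)"
        by (simp add: op_apply_mult op_apply_mult[symmetric] PA)
    qed
    then have "1 = ?tr (?m P \<psi>)" using tr by simp
    also have "\<dots> = (\<Sum>a\<in>UNIV. ?tr (?m (ensemble_povm p \<rho> a) \<psi>))"
      unfolding sumM[symmetric] by (rule op_trace_mult_sum_left)
    also have "\<dots> = (\<Sum>a\<in>UNIV. qc_channel (ensemble_povm p \<rho>) \<psi> a a)"
      by (simp add: qc_channel_def op_trace_mult_commute[of _ _ \<psi>])
    finally have "Re 1 = Re (\<Sum>a\<in>UNIV. qc_channel (ensemble_povm p \<rho>) \<psi> a a)" by simp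
    then show "(\<Sum>a\<in>UNIV. Re (qc_channel (ensemble_povm p \<rho>) \<psi> a a)) = 1" by (simp add: Re_sum)
  qed
  then have bdd: "bdd_below (H ` D)" by (auto intro!: bdd_belowI[of _ 0])
  define \<psi> where "\<psi> = (\<lambda>x y. of_real (1 / c) * ?m (?m R Q) R x y)"
  have "?tr (?m (?m R Q) R) = ?tr (?m A Q)"
    by (simp only: op_trace_mult_commute[of UNIV "?m R Q" R] op_mult_assoc[symmetric] RR)
  then have "?tr \<psi> = 1" using c by (simp only: \<psi>_def op_trace_scale A_def) simp
  moreover have "psd UNIV \<psi>" unfolding \<psi>_def using c
    by (intro psd_scale psd_conjugate herm Q) auto
  moreover have "support \<psi> \<subseteq> support A"
  proof -
    have "\<psi> = ?m A (\<lambda>x y. of_real (1 / c) * ?m T (?m Q R) x y)"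
      unfolding \<psi>_def op_mult_scale_right op_mult_assoc[symmetric] AT ..
    then have "op_apply UNIV \<psi> v = op_apply UNIV A (op_apply UNIV (\<lambda>x y. of_real (1 / c) * ?m T (?m Q R) x y) v)" for v
      by (metis op_apply_mult)
    then show ?thesis by (auto simp: support_def)
  qed
  ultimately have "\<psi> \<in> D" by (simp add: D_def state_def)
  then have "Inf (H ` D) \<le> H \<psi>" using bdd by (intro cInf_lower) auto
  \<comment> \<open>Cyclicity of the trace pairs each \<open>R\<close> in \<open>\<psi>\<close> with
    a \<open>T\<close> in the POVM element. Both pairs collapse to \<open>P\<close>, which fixes
    \<open>X a\<close>, so only \<open>Q\<close> and \<open>X a\<close> remain.\<close>
  moreover have "qc_channel (ensemble_povm p \<rho>) \<psi> a a = of_real (p a / c) * ?tr (?m (\<rho> a) Q)" for a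
  proof -
    have "?m (?m (?m R Q) R) (?m (?m T (X a)) T) = ?m R (?m Q (?m (?m R T) (?m (X a) T)))"
      by (simp only: op_mult_assoc)
    then have "?tr (?m (?m (?m R Q) R) (?m (?m T (X a)) T)) = ?tr (?m (?m Q (?m (?m R T) (?m (X a) T))) R)"
      by (simp only: op_trace_mult_commute[of UNIV R])
    also have "\<dots> = ?tr (?m Q (?m (?m P (X a)) P))"
      unfolding RT op_mult_assoc TR ..
    also have "\<dots> = ?tr (?m (X a) Q)" unfolding PXP by (rule op_trace_mult_commute)
    also have "\<dots> = of_real (p a) * ?tr (?m (\<rho> a) Q)"
      unfolding X op_mult_scale_left op_trace_scale ..
    finally show ?thesis
      unfolding qc_channel_def M \<psi>_def op_mult_scale_left op_trace_scale by simp
  qed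
  ultimately show ?thesis
    by (simp add: min_output_entropy_def H_def D_def A_def)
qed

subsection \<open>Words, tensor powers and the decoder\<close>

definition word_vec :: "('i \<Rightarrow> 'x cvec) \<Rightarrow> 'i list \<Rightarrow> 'x list cvec" where
  "word_vec f y = (\<lambda>x. \<Prod>k<length y. f (y ! k) (x ! k))"

definition word_op :: "('i \<Rightarrow> 'x op) \<Rightarrow> 'i list \<Rightarrow> 'x list op" where
  "word_op f y = (\<lambda>x x'. \<Prod>k<length y. f (y ! k) (x ! k) (x' ! k))"

definition word_weight :: "('i \<Rightarrow> real) \<Rightarrow> 'i list \<Rightarrow> real" where
  "word_weight p y = (\<Prod>k<length y. p (y ! k))"

lemma length_words: "y \<in> words n \<Longrightarrow> length y = n"
  by (simp add: words_def)

lemma words_0: "words 0 = {[]}"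
  by (auto simp: words_def)

lemma words_Suc: "words (Suc n) = (\<lambda>(a, x). a # x) ` (UNIV \<times> words n)"
  by (auto simp: words_def length_Suc_conv)

lemma card_words: "card (words n :: 'a::finite list set) = CARD('a) ^ n"
  using card_lists_length_eq[of "UNIV :: 'a set" n] by (simp add: words_def)

lemma finite_words [simp]: "finite (words n :: 'a::finite list set)"
  using finite_lists_length_eq[of "UNIV :: 'a set" n] by (simp add: words_def)

lemma sum_words_Suc:
  fixes f :: "'a::finite list \<Rightarrow> 'c::comm_monoid_add"
  shows "(\<Sum>x\<in>words (Suc n). f x) = (\<Sum>a\<in>UNIV. \<Sum>x\<in>words n. f (a # x))"
proof -
  have "inj_on (\<lambda>(a, x). a # x) (UNIV \<times> words n :: ('a \<times> 'a list) set)" by (auto simp: inj_on_def)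
  then have "(\<Sum>x\<in>words (Suc n). f x) = (\<Sum>(a, x)\<in>UNIV \<times> words n. f (a # x))"
    by (simp add: words_Suc sum.reindex case_prod_unfold)
  then show ?thesis by (simp add: sum.cartesian_product)
qed

text \<open>Distributivity over \<open>n\<close> factors; through it traces over the
  \<open>n\<close>-fold space become products of single-letter traces.\<close>

lemma sum_words_prod:
  fixes f :: "nat \<Rightarrow> 'a::finite \<Rightarrow> 'c::comm_semiring_1"
  shows "(\<Sum>x\<in>words n. \<Prod>k<n. f k (x ! k)) = (\<Prod>k<n. \<Sum>a\<in>UNIV. f k a)"
proof (induction n arbitrary: f)
  case (Suc n)
  have "(\<Sum>x\<in>words (Suc n). \<Prod>k<Suc n. f k (x ! k)) = (\<Sum>a\<in>UNIV. f 0 a * (\<Sum>x\<in>words n. \<Prod>k<n. f (Suc k) (x ! k)))"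
    by (simp add: sum_words_Suc prod.lessThan_Suc_shift sum_distrib_left del: prod.lessThan_Suc)
  also have "\<dots> = (\<Sum>a\<in>UNIV. f 0 a) * (\<Prod>k<n. \<Sum>a\<in>UNIV. f (Suc k) a)"
    by (simp add: Suc.IH[of "\<lambda>k. f (Suc k)"] sum_distrib_right)
  finally show ?case by (simp add: prod.lessThan_Suc_shift del: prod.lessThan_Suc)
qed (simp add: words_0)

lemma sum_words_prod2:
  fixes f :: "nat \<Rightarrow> 'a::finite \<Rightarrow> 'b::finite \<Rightarrow> 'c::comm_semiring_1"
  shows "(\<Sum>x\<in>words n. \<Sum>x'\<in>words n. \<Prod>k<n. f k (x ! k) (x' ! k)) = (\<Prod>k<n. \<Sum>a\<in>UNIV. \<Sum>a'\<in>UNIV. f k a a')"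
proof -
  have "(\<Sum>x'\<in>words n. \<Prod>k<n. f k (x ! k) (x' ! k)) = (\<Prod>k<n. \<Sum>a'\<in>UNIV. f k (x ! k) a')" for x :: "'a list"
    by (rule sum_words_prod)
  then show ?thesis using sum_words_prod[of "\<lambda>k a. \<Sum>a'\<in>UNIV. f k a a'" n] by simp
qed

lemma prod_delta_words:
  assumes "x \<in> words n" "y \<in> words n"
  shows "(\<Prod>k<n. if x ! k = y ! k then 1 else 0) = (if x = y then 1 else 0 :: 'c::comm_semiring_1)"
proof (cases "x = y")
  case False
  then obtain k where k: "k < n" "x ! k \<noteq> y ! k" using assms by (auto simp: list_eq_iff_nth_eq words_def)
  then have "(\<Prod>k<n. if x ! k = y ! k then 1 else 0 :: 'c) = 0" by (intro prod_zero) auto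
  then show ?thesis using False by simp
qed simp

lemma word_op_Cons: "word_op f (a # y) (e # x) (e' # x') = f a e e' * word_op f y x x'"
  by (simp add: word_op_def prod.lessThan_Suc_shift del: prod.lessThan_Suc)

lemma word_weight_Cons: "word_weight p (a # y) = p a * word_weight p y"
  by (simp add: word_weight_def prod.lessThan_Suc_shift del: prod.lessThan_Suc)

lemma sum_word_weight:
  fixes p :: "'a::finite \<Rightarrow> real"
  shows "(\<Sum>y\<in>words n. word_weight p y) = (\<Sum>a\<in>UNIV. p a) ^ n"
  using sum_words_prod[of "\<lambda>_. p" n] by (simp add: word_weight_def length_words cong: sum.cong)

lemma word_weight_nonneg: "(\<And>a. 0 \<le> p a) \<Longrightarrow> 0 \<le> word_weight p y"
  by (simp add: word_weight_def prod_nonneg)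

lemma word_op_gram:
  fixes g :: "'i \<Rightarrow> 'k::finite \<Rightarrow> 'x cvec"
  assumes "\<And>i. f i = gram_op UNIV (\<lambda>_. 1) (g i)" and y: "y \<in> words n"
  shows "word_op f y = gram_op (words n) (\<lambda>_. 1) (\<lambda>ks x. \<Prod>k<n. g (y ! k) (ks ! k) (x ! k))"
  using y sum_words_prod[of "\<lambda>k a. g (y ! k) a (_ ! k) * cnj (g (y ! k) a (_ ! k))" n]
  by (simp add: word_op_def assms(1) gram_op_def prod.distrib length_words[OF y])

lemma op_trace_word_op_mult:
  fixes f h :: "'i \<Rightarrow> 'x::finite op"
  assumes "y \<in> words n" "z \<in> words n"
  shows "op_trace (words n) (op_mult (words n) (word_op f y) (word_op h z)) =
    (\<Prod>k<n. op_trace UNIV (op_mult UNIV (f (y ! k)) (h (z ! k))))"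
  using assms sum_words_prod2[of "\<lambda>k a a'. f (y ! k) a a' * h (z ! k) a' a" n]
  by (simp add: op_trace_def op_mult_def word_op_def prod.distrib assms[THEN length_words])

lemma op_trace_word_op:
  fixes f :: "'i \<Rightarrow> 'x::finite op"
  assumes "y \<in> words n"
  shows "op_trace (words n) (word_op f y) = (\<Prod>k<n. op_trace UNIV (f (y ! k)))"
  using assms sum_words_prod[of "\<lambda>k a. f (y ! k) a a" n]
  by (simp add: op_trace_def word_op_def length_words[OF assms])

lemma inner_prod_word_vec:
  fixes ket :: "'a::finite \<Rightarrow> 'a cvec"
  assumes "orthonormal_basis ket" "y \<in> words n"
  shows "inner_prod (words n) (word_vec ket y) (word_vec ket y) = 1"
proof -
  have "inner_prod (words n) (word_vec ket y) (word_vec ket y) =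
      (\<Prod>k<n. inner_prod UNIV (ket (y ! k)) (ket (y ! k)))"
    using assms(2) sum_words_prod[of "\<lambda>k a. cnj (ket (y ! k) a) * ket (y ! k) a" n]
    by (simp add: inner_prod_def word_vec_def prod.distrib length_words)
  then show ?thesis using assms(1) by (simp add: orthonormal_basis_def)
qed

text \<open>\<open>tensor_power\<close> is defined on matrix units of the computational basis,
  whereas code words are products of \<open>ket\<close> vectors. The coefficients \<open>C\<close>
  of the linear map make the change of basis factor over the letters.\<close>

lemma tensor_power_gram_op:
  fixes \<Phi> :: "'a::finite op \<Rightarrow> 'b::finite op"
  assumes lin: "\<And>\<rho>. \<Phi> \<rho> = (\<lambda>b b'. \<Sum>a\<in>UNIV. \<Sum>a'\<in>UNIV. \<rho> a a' * C a a' b b')"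
  shows "tensor_power n \<Phi> (gram_op (words n) w (word_vec ket)) =
    (\<lambda>b b'. \<Sum>y\<in>words n. of_real (w y) * word_op (\<lambda>i. \<Phi> (ket_bra (ket i) (ket i))) y b b')"
proof (intro ext)
  fix b b'
  have unit: "\<Phi> (ket_bra (basis_vec a) (basis_vec a')) = C a a'" for a a'
    by (simp add: lin ket_bra_def basis_vec_def mult_delta_left mult_delta_right if_distrib[of cnj] cong: if_cong)
  let ?F = "\<lambda>y k a a'. ket (y ! k) a * cnj (ket (y ! k) a') * C a a' (b ! k) (b' ! k)"
  have "tensor_power n \<Phi> (gram_op (words n) w (word_vec ket)) b b' =
     (\<Sum>x\<in>words n. \<Sum>x'\<in>words n. \<Sum>y\<in>words n. of_real (w y) * (\<Prod>k<n. ?F y k (x ! k) (x' ! k)))"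
    by (simp add: tensor_power_def unit gram_op_def word_vec_def length_words sum_distrib_right prod.distrib mult.assoc cong: sum.cong)
  also have "\<dots> = (\<Sum>x\<in>words n. \<Sum>y\<in>words n. \<Sum>x'\<in>words n. of_real (w y) * (\<Prod>k<n. ?F y k (x ! k) (x' ! k)))"
    by (intro sum.cong refl sum.swap)
  also have "\<dots> = (\<Sum>y\<in>words n. \<Sum>x\<in>words n. \<Sum>x'\<in>words n. of_real (w y) * (\<Prod>k<n. ?F y k (x ! k) (x' ! k)))"
    by (rule sum.swap)
  also have "\<dots> = (\<Sum>y\<in>words n. of_real (w y) * (\<Sum>x\<in>words n. \<Sum>x'\<in>words n. \<Prod>k<n. ?F y k (x ! k) (x' ! k)))"
    by (simp add: sum_distrib_left)
  also have "\<dots> = (\<Sum>y\<in>words n. of_real (w y) * (\<Prod>k<n. \<Sum>a\<in>UNIV. \<Sum>a'\<in>UNIV. ?F y k a a'))"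
    by (intro sum.cong refl arg_cong[where f = "\<lambda>c. _ * c"]) (rule sum_words_prod2[where f = "?F _"])
  also have "\<dots> = (\<Sum>y\<in>words n. of_real (w y) * word_op (\<lambda>i. \<Phi> (ket_bra (ket i) (ket i))) y b b')"
    by (simp add: word_op_def length_words lin ket_bra_def cong: sum.cong)
  finally show "tensor_power n \<Phi> (gram_op (words n) w (word_vec ket)) b b' =
    (\<Sum>y\<in>words n. of_real (w y) * word_op (\<lambda>i. \<Phi> (ket_bra (ket i) (ket i))) y b b')" .
qed

text \<open>The mixture of \<open>|s><s|\<close> tensored with the projector onto the word vector of
  \<open>y\<close>, with weights \<open>w s y\<close>: the auxiliary qubits hold the seed as
  classical data.\<close>

definition encoded_state :: "nat \<Rightarrow> nat \<Rightarrow> ('a \<Rightarrow> 'a cvec) \<Rightarrow> (bool list \<Rightarrow> 'a list \<Rightarrow> real) \<Rightarrow> (bool list \<times> 'a list) op" where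
  "encoded_state \<kappa> n ket w = gram_op (words \<kappa> \<times> words n) (\<lambda>(s, y). w s y)
     (\<lambda>(s, y) (s', x). if s' = s then word_vec ket y x else 0)"

lemma encoded_state_apply:
  fixes ket :: "'a::finite \<Rightarrow> 'a cvec"
  assumes "s \<in> words \<kappa>"
  shows "encoded_state \<kappa> n ket w (s, x) (s', x') =
    (if s = s' then gram_op (words n) (w s) (word_vec ket) x x' else 0)"
proof -
  have "encoded_state \<kappa> n ket w (s, x) (s', x') = (\<Sum>(t, y)\<in>words \<kappa> \<times> words n.
      of_real (w t y) * (if s = t then word_vec ket y x else 0) * cnj (if s' = t then word_vec ket y x' else 0))"
    by (simp add: encoded_state_def gram_op_def case_prod_unfold cong: if_cong)
  also have "\<dots> = (\<Sum>t\<in>words \<kappa>. \<Sum>y\<in>words n.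
      of_real (w t y) * (if s = t then word_vec ket y x else 0) * cnj (if s' = t then word_vec ket y x' else 0))"
    by (rule sum.cartesian_product[symmetric])
  also have "\<dots> = (\<Sum>t\<in>words \<kappa>. if s = t then (if s = s' then gram_op (words n) (w s) (word_vec ket) x x' else 0) else 0)"
    by (intro sum.cong refl) (auto simp: gram_op_def)
  finally show ?thesis using assms by simp
qed

lemma state_encoded_state:
  fixes ket :: "'a::finite \<Rightarrow> 'a cvec"
  assumes ket: "orthonormal_basis ket" and w: "\<And>s y. s \<in> words \<kappa> \<Longrightarrow> y \<in> words n \<Longrightarrow> 0 \<le> w s y"
    "(\<Sum>s\<in>words \<kappa>. \<Sum>y\<in>words n. w s y) = 1"
  shows "state (words \<kappa> \<times> words n) (encoded_state \<kappa> n ket w)"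
proof -
  have "op_trace (words \<kappa> \<times> words n) (encoded_state \<kappa> n ket w) =
     (\<Sum>s\<in>words \<kappa>. \<Sum>x\<in>words n. encoded_state \<kappa> n ket w (s, x) (s, x))"
    by (simp add: op_trace_def sum.cartesian_product case_prod_unfold)
  also have "\<dots> = (\<Sum>s\<in>words \<kappa>. op_trace (words n) (gram_op (words n) (w s) (word_vec ket)))"
    by (simp add: encoded_state_apply op_trace_def)
  also have "\<dots> = of_real (\<Sum>s\<in>words \<kappa>. \<Sum>y\<in>words n. w s y)"
    by (simp add: op_trace_gram_op inner_prod_word_vec[OF ket])
  finally show ?thesis using w unfolding state_def encoded_state_def
    by (auto intro!: psd_gram_op)
qed

lemma ptrace_fst_encoded_state:
  fixes ket :: "'a::finite \<Rightarrow> 'a cvec"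
  shows "ptrace_fst (words \<kappa>) (encoded_state \<kappa> n ket w) = gram_op (words n) (\<lambda>y. \<Sum>s\<in>words \<kappa>. w s y) (word_vec ket)"
proof (intro ext)
  fix x x'
  have "ptrace_fst (words \<kappa>) (encoded_state \<kappa> n ket w) x x' =
      (\<Sum>s\<in>words \<kappa>. \<Sum>y\<in>words n. of_real (w s y) * word_vec ket y x * cnj (word_vec ket y x'))"
    by (simp add: ptrace_fst_def encoded_state_apply gram_op_def)
  also have "\<dots> = (\<Sum>y\<in>words n. \<Sum>s\<in>words \<kappa>. of_real (w s y) * word_vec ket y x * cnj (word_vec ket y x'))"
    by (rule sum.swap)
  finally show "ptrace_fst (words \<kappa>) (encoded_state \<kappa> n ket w) x x' =
      gram_op (words n) (\<lambda>y. \<Sum>s\<in>words \<kappa>. w s y) (word_vec ket) x x'"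
    by (simp add: gram_op_def sum_distrib_right)
qed

text \<open>Bob reads the seed, measures every letter with \<open>P\<close>, and announces the hash
  of the word found; block-diagonality expresses that the seed is read in its own basis.\<close>

definition hash_decoder :: "nat \<Rightarrow> ('a \<Rightarrow> 'b op) \<Rightarrow> (bool list \<Rightarrow> 'a list \<Rightarrow> nat) \<Rightarrow> nat \<Rightarrow> (bool list \<times> 'b list) op" where
  "hash_decoder n P h m = (\<lambda>(s, b) (s', b').
     if s = s' then \<Sum>y\<in>words n. of_bool (h s y = m) * word_op P y b b' else 0)"

lemma psd_cong:
  assumes "\<And>x y. x \<in> X \<Longrightarrow> y \<in> X \<Longrightarrow> A x y = B x y" "psd X B"
  shows "psd X A"
proof -
  have "inner_prod X v (op_apply X A v) = inner_prod X v (op_apply X B v)" for v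
    using assms(1) by (simp add: inner_prod_def op_apply_def)
  then show ?thesis using assms(2) by (simp add: psd_def)
qed

lemma povm_hash_decoder:
  fixes P :: "'a::finite \<Rightarrow> 'b::finite op" and r :: "'a \<Rightarrow> 'k::finite \<Rightarrow> 'b cvec"
  assumes P: "\<And>i. P i = gram_op UNIV (\<lambda>_. 1) (r i)" "\<And>b b'. (\<Sum>i\<in>UNIV. P i b b') = (if b = b' then 1 else 0)"
    and h: "\<And>s y. s \<in> words \<kappa> \<Longrightarrow> y \<in> words n \<Longrightarrow> h s y < N"
  shows "povm (words \<kappa> \<times> words n) N (hash_decoder n P h)"
  unfolding povm_def
proof (intro conjI allI impI ballI)
  fix m
  define g where "g = (\<lambda>(s :: bool list, y, ks) (s', b). if s' = s then \<Prod>k<n. r (y ! k) (ks ! k) (b ! k) else 0)"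
  have psd: "psd (words \<kappa> \<times> words n) (gram_op (words \<kappa> \<times> words n \<times> words n) (\<lambda>(s, y, ks). of_bool (h s y = m)) g)"
    by (rule psd_gram_op) auto
  have eq: "hash_decoder n P h m z z' = gram_op (words \<kappa> \<times> words n \<times> words n) (\<lambda>(s, y, ks). of_bool (h s y = m)) g z z'"
    if zz: "z \<in> words \<kappa> \<times> words n" "z' \<in> words \<kappa> \<times> words n" for z z'
  proof -
    obtain s b s' b' where z: "z = (s, b)" "z' = (s', b')" and s: "s \<in> words \<kappa>" using zz by (cases z, cases z') auto
    have ob: "complex_of_real (of_bool c) = of_bool c" for c by simp
    let ?t = "\<lambda>t y ks. of_real (of_bool (h t y = m)) * g (t, y, ks) (s, b) * cnj (g (t, y, ks) (s', b'))"
    have "gram_op (words \<kappa> \<times> words n \<times> words n) (\<lambda>(s, y, ks). of_bool (h s y = m)) g z z' =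
       (\<Sum>t\<in>words \<kappa>. \<Sum>y\<in>words n. \<Sum>ks\<in>words n. ?t t y ks)"
      by (simp add: gram_op_def z sum.cartesian_product case_prod_unfold)
    also have "\<dots> = (\<Sum>t\<in>words \<kappa>. if s = t then (if s = s' then \<Sum>y\<in>words n. of_bool (h s y = m) * word_op P y b b' else 0) else 0)"
      by (intro sum.cong refl)
        (auto simp: g_def ob word_op_gram[OF P(1)] gram_op_def sum_distrib_left mult.assoc
          simp del: sum_of_bool_mult_eq sum_mult_of_bool_eq cong: sum.cong)
    finally show ?thesis using s by (simp add: hash_decoder_def z)
  qed
  show "psd (words \<kappa> \<times> words n) (hash_decoder n P h m)" by (rule psd_cong[OF eq psd])
next
  fix z z' :: "bool list \<times> 'b list"
  assume zz: "z \<in> words \<kappa> \<times> words n" "z' \<in> words \<kappa> \<times> words n"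
  obtain s b s' b' where z: "z = (s, b)" "z' = (s', b')" and s: "s \<in> words \<kappa>"
    and b: "b \<in> words n" "b' \<in> words n" using zz by (cases z, cases z') auto
  show "(\<Sum>m<N. hash_decoder n P h m z z') = op_id z z'"
  proof (cases "s = s'")
    case True
    have "(\<Sum>m<N. hash_decoder n P h m z z') = (\<Sum>y\<in>words n. \<Sum>m<N. of_bool (h s y = m) * word_op P y b b')"
      using True by (simp only: hash_decoder_def z case_prod_conv if_True simp_thms) (rule sum.swap)
    also have "\<dots> = (\<Sum>y\<in>words n. word_op P y b b')"
    proof (intro sum.cong refl)
      fix y :: "'a list" assume "y \<in> words n"
      then have "h s y < N" using h s by blast
      then show "(\<Sum>m<N. of_bool (h s y = m) * word_op P y b b') = word_op P y b b'"
        by (simp add: of_bool_def mult_delta_left)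
    qed
    also have "\<dots> = (\<Prod>k<n. \<Sum>i\<in>UNIV. P i (b ! k) (b' ! k))"
      using sum_words_prod[of "\<lambda>k i. P i (b ! k) (b' ! k)" n] by (simp add: word_op_def length_words cong: sum.cong)
    also have "\<dots> = op_id z z'"
      using True by (simp add: P(2) prod_delta_words[OF b] op_id_def z)
    finally show ?thesis .
  qed (simp add: hash_decoder_def z op_id_def)
qed

text \<open>By \<open>dec\<close> the letterwise measurement identifies the word with certainty, so
  the error is purely classical: the weight that \<open>w\<close> puts on pairs hashing elsewhere
  than to \<open>m\<close>.\<close>

lemma op_trace_decoding:
  fixes \<Phi> :: "'a::finite op \<Rightarrow> 'b::finite op" and P :: "'a \<Rightarrow> 'b op"
  assumes lin: "\<And>\<rho>. \<Phi> \<rho> = (\<lambda>b b'. \<Sum>a\<in>UNIV. \<Sum>a'\<in>UNIV. \<rho> a a' * C a a' b b')"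
    and tr: "\<And>i. op_trace UNIV (\<Phi> (ket_bra (ket i) (ket i))) = 1"
    and dec: "\<And>i j. op_trace UNIV (op_mult UNIV (\<Phi> (ket_bra (ket i) (ket i))) (P j)) = (if i = j then 1 else 0)"
  shows "op_trace (words \<kappa> \<times> words n) (op_mult (words \<kappa> \<times> words n)
      (id_tensor (tensor_power n \<Phi>) (encoded_state \<kappa> n ket w)) (\<lambda>x y. op_id x y - hash_decoder n P h m x y)) =
    of_real (\<Sum>s\<in>words \<kappa>. \<Sum>y\<in>words n. w s y * (1 - of_bool (h s y = m)))"
proof -
  define G where "G i = \<Phi> (ket_bra (ket i) (ket i))" for i
  define Z where "Z = id_tensor (tensor_power n \<Phi>) (encoded_state \<kappa> n ket w)"
  define F where "F s = (\<lambda>b b'. \<Sum>y\<in>words n. of_real (w s y) * word_op G y b b')" for s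
  define D where "D s = (\<lambda>b b'. \<Sum>y\<in>words n. of_bool (h s y = m) * word_op P y b b')" for s
  define R where "R s = (\<lambda>b b'. op_id b b' - D s b b')" for s
  have Z: "Z (s, b) (s, b') = F s b b'" if "s \<in> words \<kappa>" for s b b'
    using that by (simp add: Z_def id_tensor_def encoded_state_apply tensor_power_gram_op[OF lin] F_def G_def[abs_def])
  have DR: "op_id (s, b) (s', b') - hash_decoder n P h m (s, b) (s', b') = (if s = s' then R s b b' else 0)" for s b s' b'
    by (simp add: hash_decoder_def op_id_def R_def D_def)
  have one: "op_trace (words n) (op_mult (words n) (word_op G y) (R s)) = of_real (1 - of_bool (h s y = m))"
    if y: "y \<in> words n" for y s
  proof -
    have "op_trace (words n) (op_mult (words n) (word_op G y) (R s)) =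
       op_trace (words n) (op_mult (words n) (word_op G y) op_id) - op_trace (words n) (op_mult (words n) (word_op G y) (D s))"
      by (simp add: R_def op_trace_def op_mult_def algebra_simps sum_subtractf)
    also have "op_trace (words n) (op_mult (words n) (word_op G y) op_id) = op_trace (words n) (word_op G y)"
      by (simp add: op_trace_def op_mult_def op_id_def mult_delta_right)
    also have "\<dots> = 1" using tr by (simp add: op_trace_word_op[OF y] G_def)
    also have "op_trace (words n) (op_mult (words n) (word_op G y) (D s)) =
        (\<Sum>z\<in>words n. of_bool (h s z = m) * op_trace (words n) (op_mult (words n) (word_op G y) (word_op P z)))"
      unfolding op_trace_mult_commute[of _ "word_op G y"] D_def op_trace_mult_sum_left op_mult_scale_left op_trace_scale ..
    also have "\<dots> = (\<Sum>z\<in>words n. of_bool (h s z = m) * (if y = z then 1 else 0))"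
      using y by (intro sum.cong refl) (simp add: op_trace_word_op_mult G_def dec prod_delta_words)
    also have "\<dots> = of_bool (h s y = m)" using y by (simp add: mult_delta_right)
    finally show ?thesis by simp
  qed
  have "op_trace (words \<kappa> \<times> words n) (op_mult (words \<kappa> \<times> words n) Z (\<lambda>x y. op_id x y - hash_decoder n P h m x y)) =
     (\<Sum>s\<in>words \<kappa>. \<Sum>b\<in>words n. \<Sum>s'\<in>words \<kappa>. \<Sum>b'\<in>words n. Z (s, b) (s', b') * (if s' = s then R s' b' b else 0))"
    by (simp add: op_trace_def op_mult_def sum.cartesian_product' DR)
  also have "\<dots> = (\<Sum>s\<in>words \<kappa>. \<Sum>b\<in>words n. \<Sum>s'\<in>words \<kappa>. if s' = s then (\<Sum>b'\<in>words n. F s b b' * R s b' b) else 0)"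
    by (intro sum.cong refl) (auto simp: Z)
  also have "\<dots> = (\<Sum>s\<in>words \<kappa>. op_trace (words n) (op_mult (words n) (F s) (R s)))"
    by (simp add: op_trace_def op_mult_def)
  also have "\<dots> = (\<Sum>s\<in>words \<kappa>. \<Sum>y\<in>words n. of_real (w s y) * op_trace (words n) (op_mult (words n) (word_op G y) (R s)))"
    unfolding F_def op_trace_mult_sum_left op_mult_scale_left op_trace_scale ..
  also have "\<dots> = of_real (\<Sum>s\<in>words \<kappa>. \<Sum>y\<in>words n. w s y * (1 - of_bool (h s y = m)))"
    by (simp add: one cong: sum.cong)
  finally show ?thesis by (simp add: Z_def)
qed

lemma op_trace_eve_state:
  fixes \<Phi> :: "'a::finite op \<Rightarrow> 'e::finite op"
  assumes lin: "\<And>\<rho>. \<Phi> \<rho> = (\<lambda>b b'. \<Sum>a\<in>UNIV. \<Sum>a'\<in>UNIV. \<rho> a a' * C a a' b b')"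
  shows "op_trace (words n) (op_mult (words n) (eve_state \<Phi> n \<kappa> (encoded_state \<kappa> n ket w)) Q) =
    (\<Sum>y\<in>words n. of_real (\<Sum>s\<in>words \<kappa>. w s y) *
      op_trace (words n) (op_mult (words n) (word_op (\<lambda>i. \<Phi> (ket_bra (ket i) (ket i))) y) Q))"
  unfolding eve_state_def ptrace_fst_encoded_state tensor_power_gram_op[OF lin] op_trace_mult_sum_left
    op_mult_scale_left op_trace_scale ..

text \<open>Positive operators with vanishing products have orthogonal supports. Each support
  projector is \<open>G i\<close> times its pseudo-inverse, on either side, so vanishing products
  pass from the operators to the projectors.\<close>

lemma distinguishing_projectors:
  fixes G :: "'a::finite \<Rightarrow> 'b::finite op" and v :: "'a \<Rightarrow> 'k::finite \<Rightarrow> 'b cvec"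
  assumes G: "\<And>i. G i = gram_op UNIV (\<lambda>_. 1) (v i)"
    and orth: "\<And>i j. i \<noteq> j \<Longrightarrow> op_mult UNIV (G i) (G j) = (\<lambda>_ _. 0)"
    and tr: "\<And>i. op_trace UNIV (G i) = 1"
  shows "\<exists>P. (\<forall>i. P i = gram_op UNIV (\<lambda>_. 1) (\<lambda>c b. P i b c)) \<and>
    (\<forall>b b'. (\<Sum>i\<in>UNIV. P i b b') = (if b = b' then 1 else 0)) \<and>
    (\<forall>i j. op_trace UNIV (op_mult UNIV (G i) (P j)) = (if i = j then 1 else 0))"
proof -
  let ?m = "op_mult UNIV"
  let ?Z = "\<lambda>_ _. 0 :: complex"
  have "\<exists>P W. hermitian P \<and> ?m P P = P \<and> ?m (G i) P = G i \<and> P = ?m (G i) W \<and> P = ?m W (G i)" for i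
  proof -
    obtain b l where b: "orthonormal_basis b" and A: "G i = spectral_op b (\<lambda>i. of_real (l i))"
      by (rule spectral_psd_gram[OF G]) auto
    define P where "P = spectral_op b (\<lambda>i. of_real (of_bool (l i \<noteq> 0)))"
    \<comment> \<open>Since \<open>inverse 0 = 0\<close>, this is the pseudo-inverse, vanishing on
      the kernel.\<close>
    define W where "W = spectral_op b (\<lambda>i. of_real (inverse (l i)))"
    have "?m P P = P" "?m (G i) P = G i" "?m (G i) W = P" "?m W (G i) = P"
      unfolding P_def W_def A spectral_op_mult[OF b] by (rule arg_cong[where f = "spectral_op b"], force)+
    then show ?thesis using hermitian_spectral_op[of b] unfolding P_def by metis
  qed
  then obtain P W where herm: "\<And>i. hermitian (P i)" and PP: "\<And>i. ?m (P i) (P i) = P i"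
    and GP: "\<And>i. ?m (G i) (P i) = G i" and PGW: "\<And>i. P i = ?m (G i) (W i)" and PWG: "\<And>i. P i = ?m (W i) (G i)"
    by metis
  have GP0: "?m (G i) (P j) = ?Z" if "i \<noteq> j" for i j
    unfolding PGW[of j] op_mult_assoc[symmetric] orth[OF that] by (simp add: op_mult_def)
  have PP0: "?m (P i) (P j) = ?Z" if "i \<noteq> j" for i j
    unfolding PWG[of i] op_mult_assoc GP0[OF that] by (simp add: op_mult_def)
  define S where "S = (\<lambda>x y. \<Sum>i\<in>UNIV. P i x y)"
  have sum_delta: "(\<Sum>j\<in>UNIV. (if i = j then A else ?Z) x y) = A x y" for i :: 'a and A :: "'b op" and x y
    by (simp add: if_distrib[of "\<lambda>f. f _ _"])
  have mS: "?m A S = (\<lambda>x y. \<Sum>i\<in>UNIV. ?m A (P i) x y)" "?m S A = (\<lambda>x y. \<Sum>i\<in>UNIV. ?m (P i) A x y)" for A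
    unfolding S_def op_mult_def sum_distrib_left sum_distrib_right by (intro ext, rule sum.swap)+
  have PPd: "?m (P i) (P j) = (if i = j then P i else ?Z)" for i j
    using PP PP0 by auto
  have PS: "?m (P i) S = P i" for i
    unfolding mS PPd by (intro ext) (rule sum_delta)
  have SP: "?m S (P i) = P i" for i
    unfolding mS PPd eq_commute[of _ i] using sum_delta[of i "P i"] by (intro ext) (simp add: if_distrib cong: if_cong)
  have SS: "?m S S = S"
    unfolding mS(2)[of S] PS by (simp add: S_def)
  have hS: "hermitian S"
    using herm unfolding hermitian_def S_def cnj_sum by (intro allI sum.cong refl) blast
  have add: "?m (\<lambda>x y. A x y + B x y) C = (\<lambda>x y. ?m A C x y + ?m B C x y)"
    "?m C (\<lambda>x y. A x y + B x y) = (\<lambda>x y. ?m C A x y + ?m C B x y)"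
    "?m (\<lambda>x y. A x y - B x y) C = (\<lambda>x y. ?m A C x y - ?m B C x y)"
    "?m C (\<lambda>x y. A x y - B x y) = (\<lambda>x y. ?m C A x y - ?m C B x y)" for A B C
    by (simp_all add: op_mult_def algebra_simps sum.distrib sum_subtractf)
  have id: "?m A op_id = A" "?m op_id A = A" for A :: "'b op"
    by (simp_all add: op_mult_def op_id_def mult_delta_left mult_delta_right)
  \<comment> \<open>The projector onto the common kernel goes to an arbitrary index.\<close>
  define i0 where "i0 = (undefined :: 'a)"
  define D where "D i = (\<lambda>x y. P i x y + (if i = i0 then op_id x y - S x y else 0))" for i
  have D: "D i = (if i = i0 then (\<lambda>x y. P i x y + (op_id x y - S x y)) else P i)" for i
    by (simp add: D_def)
  have hD: "hermitian (D i)" for i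
    unfolding hermitian_def
  proof (intro allI)
    fix x y
    have "P i y x = cnj (P i x y)" "S y x = cnj (S x y)" "op_id y x = cnj (op_id x y)"
      using herm[of i] hS unfolding hermitian_def by (blast, blast, simp add: op_id_def)
    then show "D i y x = cnj (D i x y)" by (auto simp only: D complex_cnj_add complex_cnj_diff split: if_splits)
  qed
  have DD: "?m (D i) (D i) = D i" for i
    unfolding D by (simp add: add id PS SP SS PP)
  \<comment> \<open>A hermitian idempotent is the product of itself with its adjoint, so its own
    columns serve as Gram vectors.\<close>
  have gram: "D i = gram_op UNIV (\<lambda>_. 1) (\<lambda>c b. D i b c)" for i
  proof (intro ext)
    fix b b'
    have "D i b b' = (\<Sum>c\<in>UNIV. D i b c * D i c b')"
      by (subst DD[symmetric]) (simp add: op_mult_def)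
    also have "\<dots> = (\<Sum>c\<in>UNIV. D i b c * cnj (D i b' c))"
      using hD[of i] unfolding hermitian_def by (intro sum.cong refl) metis
    finally show "D i b b' = gram_op UNIV (\<lambda>_. 1) (\<lambda>c b. D i b c) b b'" by (simp add: gram_op_def)
  qed
  have sum1: "(\<Sum>i\<in>UNIV. D i b b') = (if b = b' then 1 else 0)" for b b'
    by (simp add: D_def sum.distrib S_def op_id_def)
  have tr1: "op_trace UNIV (?m (G i) (D j)) = (if i = j then 1 else 0)" for i j
  proof -
    have GS: "?m (G i) S = G i"
    proof -
      have "?m (G i) (P k) = (if i = k then G i else ?Z)" for k using GP GP0 by auto
      then show ?thesis unfolding mS by (simp only:) (intro ext sum_delta)
    qed
    have "?m (G i) (D j) = ?m (G i) (P j)"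
      unfolding D by (simp add: add id GS)
    then show ?thesis using GP[of i] GP0[of i j] tr[of i] by (auto simp: op_trace_def)
  qed
  show ?thesis using gram sum1 tr1 by (intro exI[of _ D] conjI allI)
qed

subsection \<open>Tail bound for the posterior of a word\<close>

text \<open>Controls the second-order term of \<open>r powr (1 + s)\<close> uniformly down to
  \<open>r = 0\<close>. With \<open>u = - ln r\<close> the claim is that \<open>u^2\<close> is at
  most \<open>2 * exp u\<close>, from the quadratic Taylor term.\<close>

lemma mult_ln_squared_le:
  fixes r :: real
  assumes "0 < r" "r \<le> 1"
  shows "r * (ln r)\<^sup>2 \<le> 2"
proof -
  define u where "u = - ln r"
  have u: "0 \<le> u" using assms by (simp add: u_def)
  have "1 + u + u\<^sup>2 / 2 \<le> exp u" using u by (rule exp_lower_Taylor_quadratic)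
  then have "u\<^sup>2 \<le> 2 * exp u" using u by linarith
  then have "r * u\<^sup>2 \<le> r * (2 * exp u)" using assms by (intro mult_left_mono) auto
  also have "\<dots> = 2" using assms by (simp add: u_def exp_minus)
  finally show ?thesis by (simp add: u_def)
qed

text \<open>Unlike a tail of \<open>- log r\<close>, the moment of order \<open>1 + s\<close> is multiplicative along the letters of a
  word; \<open>s\<close> is chosen small enough for the second-order term to be negligible.\<close>

lemma sum_powr_le_entropy:
  fixes r :: "'a::finite \<Rightarrow> real"
  assumes r: "\<And>a. 0 \<le> r a" "(\<Sum>a\<in>UNIV. r a) = 1" and s: "0 \<le> s"
  shows "(\<Sum>a\<in>UNIV. r a powr (1 + s)) \<le> exp (- (s * ln 2 * shannon_entropy r) + 2 * s\<^sup>2 * CARD('a))"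
proof -
  have "r a powr (1 + s) \<le> r a + s * (r a * ln (r a)) + 2 * s\<^sup>2" for a
  proof (cases "r a = 0")
    case False
    then have r0: "0 < r a" using r(1)[of a] by simp
    have "r a \<le> (\<Sum>a\<in>UNIV. r a)" by (rule member_le_sum) (use r in auto)
    then have r1: "r a \<le> 1" using r by simp
    have "s * ln (r a) \<le> 0" using s r0 r1 by (simp add: mult_nonneg_nonpos)
    then have "exp (s * ln (r a)) \<le> 1 + s * ln (r a) + (s * ln (r a))\<^sup>2" by (intro exp_le_quadratic) simp
    then have "r a * exp (s * ln (r a)) \<le> r a * (1 + s * ln (r a) + (s * ln (r a))\<^sup>2)"
      using r0 by (intro mult_left_mono) auto
    also have "\<dots> = r a + s * (r a * ln (r a)) + s\<^sup>2 * (r a * (ln (r a))\<^sup>2)"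
      by (simp add: algebra_simps power2_eq_square)
    also have "\<dots> \<le> r a + s * (r a * ln (r a)) + s\<^sup>2 * 2"
      using mult_ln_squared_le[OF r0 r1] by (intro add_left_mono mult_left_mono) auto
    finally have "r a * exp (s * ln (r a)) \<le> r a + s * (r a * ln (r a)) + s\<^sup>2 * 2" .
    moreover have "r a powr (1 + s) = r a * exp (s * ln (r a))"
      using r0 by (simp add: powr_add powr_def[of "r a" s])
    ultimately show ?thesis by (simp add: mult.commute)
  qed simp
  then have "(\<Sum>a\<in>UNIV. r a powr (1 + s)) \<le> (\<Sum>a\<in>UNIV. r a + s * (r a * ln (r a)) + 2 * s\<^sup>2)"
    by (intro sum_mono)
  also have "\<dots> = 1 + (s * (\<Sum>a\<in>UNIV. r a * ln (r a)) + 2 * s\<^sup>2 * CARD('a))"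
    by (simp add: sum.distrib sum_distrib_left r)
  also have "(\<Sum>a\<in>UNIV. r a * ln (r a)) = - (ln 2 * shannon_entropy r)"
    by (simp add: shannon_entropy_def log_def sum_distrib_left sum_negf)
  \<comment> \<open>Passing to the exponential gives a bound whose \<open>n\<close>-th power is
    again explicit.\<close>
  also have "1 + (s * - (ln 2 * shannon_entropy r) + 2 * s\<^sup>2 * CARD('a)) \<le>
      exp (s * - (ln 2 * shannon_entropy r) + 2 * s\<^sup>2 * CARD('a))"
    by (rule exp_ge_add_one_self)
  finally show ?thesis by (simp add: mult.assoc)
qed

section \<open>Splitting off the first letter of a measurement operator\<close>

definition cons_op :: "'x op \<Rightarrow> 'x list op \<Rightarrow> 'x list op" where
  "cons_op A B = (\<lambda>x x'. A (hd x) (hd x') * B (tl x) (tl x'))"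

lemma op_trace_cons_op_mult:
  fixes A :: "'x::finite op"
  shows "op_trace (words (Suc n)) (op_mult (words (Suc n)) (cons_op A B) Q) =
    (\<Sum>e\<in>UNIV. \<Sum>u\<in>words n. \<Sum>e'\<in>UNIV. \<Sum>u'\<in>words n. A e e' * B u u' * Q (e' # u') (e # u))"
  by (simp add: op_trace_def op_mult_def sum_words_Suc cons_op_def)

text \<open>The partial trace of \<open>(A \<otimes> 1) Q\<close> over the first letter: the
  operator that Eve's \<open>Q\<close> effectively applies to the remaining letters when the first
  is in state \<open>A\<close>. \<open>contract_snd\<close> is its mirror image, with the remaining
  letters in state \<open>B\<close>. These reduce a collective measurement to single
  letters.\<close>

definition contract_fst :: "'x::finite op \<Rightarrow> 'x list op \<Rightarrow> 'x list op" where
  "contract_fst A Q = (\<lambda>v v'. \<Sum>e\<in>UNIV. \<Sum>e'\<in>UNIV. A e e' * Q (e' # v) (e # v'))"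

definition contract_snd :: "nat \<Rightarrow> 'x list op \<Rightarrow> 'x::finite list op \<Rightarrow> 'x op" where
  "contract_snd n B Q = (\<lambda>e e'. \<Sum>u\<in>words n. \<Sum>u'\<in>words n. B u u' * Q (e # u') (e' # u))"

lemma op_trace_contract_fst:
  "op_trace (words n) (op_mult (words n) B (contract_fst A Q)) =
   op_trace (words (Suc n)) (op_mult (words (Suc n)) (cons_op A B) Q)"
proof -
  have "op_trace (words n) (op_mult (words n) B (contract_fst A Q)) =
     (\<Sum>u\<in>words n. \<Sum>u'\<in>words n. \<Sum>e\<in>UNIV. \<Sum>e'\<in>UNIV. A e e' * B u u' * Q (e' # u') (e # u))"
    by (simp add: op_trace_def op_mult_def contract_fst_def sum_distrib_left mult_ac)
  also have "\<dots> = (\<Sum>u\<in>words n. \<Sum>e\<in>UNIV. \<Sum>u'\<in>words n. \<Sum>e'\<in>UNIV. A e e' * B u u' * Q (e' # u') (e # u))"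
    by (intro sum.cong refl sum.swap)
  also have "\<dots> = (\<Sum>u\<in>words n. \<Sum>e\<in>UNIV. \<Sum>e'\<in>UNIV. \<Sum>u'\<in>words n. A e e' * B u u' * Q (e' # u') (e # u))"
    by (intro sum.cong refl sum.swap)
  also have "\<dots> = (\<Sum>e\<in>UNIV. \<Sum>u\<in>words n. \<Sum>e'\<in>UNIV. \<Sum>u'\<in>words n. A e e' * B u u' * Q (e' # u') (e # u))"
    by (rule sum.swap)
  finally show ?thesis by (simp only: op_trace_cons_op_mult)
qed

lemma op_trace_contract_snd:
  "op_trace UNIV (op_mult UNIV A (contract_snd n B Q)) =
   op_trace (words (Suc n)) (op_mult (words (Suc n)) (cons_op A B) Q)"
proof -
  have "op_trace UNIV (op_mult UNIV A (contract_snd n B Q)) =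
     (\<Sum>e\<in>UNIV. \<Sum>e'\<in>UNIV. \<Sum>u\<in>words n. \<Sum>u'\<in>words n. A e e' * B u u' * Q (e' # u') (e # u))"
    by (simp add: op_trace_def op_mult_def contract_snd_def sum_distrib_left mult_ac)
  also have "\<dots> = (\<Sum>e\<in>UNIV. \<Sum>u\<in>words n. \<Sum>e'\<in>UNIV. \<Sum>u'\<in>words n. A e e' * B u u' * Q (e' # u') (e # u))"
    by (intro sum.cong refl sum.swap)
  finally show ?thesis by (simp only: op_trace_cons_op_mult)
qed

lemma cons_op_gram_op:
  "cons_op (gram_op I c g) (gram_op J d h) =
   gram_op (I \<times> J) (\<lambda>(i, j). c i * d j) (\<lambda>(i, j) x. g i (hd x) * h j (tl x))"
  by (simp add: cons_op_def gram_op_def sum_product sum.cartesian_product case_prod_unfold mult_ac)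

lemma op_trace_cons_op_word_op:
  fixes f :: "'i \<Rightarrow> 'x::finite op"
  shows "op_trace (words (Suc n)) (op_mult (words (Suc n)) (cons_op (f a) (word_op f y)) Q) =
   op_trace (words (Suc n)) (op_mult (words (Suc n)) (word_op f (a # y)) Q)"
  by (simp add: op_trace_def op_mult_def sum_words_Suc cons_op_def word_op_Cons)

text \<open>Testing positivity against rank-one operators lets positivity of contracted operators
  follow from the trace identities for \<open>contract_fst\<close> and
  \<open>contract_snd\<close>.\<close>

lemma psd_iff_trace:
  "psd X Q \<longleftrightarrow> (\<forall>u. op_trace X (op_mult X (gram_op {()} (\<lambda>_. 1) (\<lambda>_. u)) Q) \<in> \<real>\<^sub>\<ge>\<^sub>0)"
  by (simp add: op_trace_gram_op_mult psd_def)

locale gram_ensemble =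
  fixes p :: "'a::finite \<Rightarrow> real" and \<rho> :: "'a \<Rightarrow> 'e::finite op" and g :: "'a \<Rightarrow> 'k::finite \<Rightarrow> 'e cvec"
  assumes gram: "\<And>a. \<rho> a = gram_op UNIV (\<lambda>_. 1) (g a)"
    and tr: "\<And>a. op_trace UNIV (\<rho> a) = 1"
    and p_nonneg: "\<And>a. 0 \<le> p a" and p_sum: "(\<Sum>a\<in>UNIV. p a) = 1"
begin

definition H_min :: real where
  "H_min = min_output_entropy (support (average_state p \<rho>)) (ensemble_povm p \<rho>)"

definition outcome :: "nat \<Rightarrow> 'e list op \<Rightarrow> 'a list \<Rightarrow> real" where
  "outcome n Q y = Re (op_trace (words n) (op_mult (words n) (word_op \<rho> y) Q))"

lemma word_trace_nonneg:
  assumes "y \<in> words n" "psd (words n) Q"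
  shows "op_trace (words n) (op_mult (words n) (word_op \<rho> y) Q) \<in> \<real>\<^sub>\<ge>\<^sub>0"
  unfolding word_op_gram[OF gram assms(1)] by (rule op_trace_gram_op_psd) (use assms in auto)

lemma outcome_nonneg: "y \<in> words n \<Longrightarrow> psd (words n) Q \<Longrightarrow> 0 \<le> outcome n Q y"
  using word_trace_nonneg by (simp add: outcome_def complex_nonneg_Reals_iff)

lemma of_real_outcome:
  "y \<in> words n \<Longrightarrow> psd (words n) Q \<Longrightarrow>
   op_trace (words n) (op_mult (words n) (word_op \<rho> y) Q) = of_real (outcome n Q y)"
  using word_trace_nonneg[of y n Q] by (auto simp: outcome_def complex_nonneg_Reals_iff complex_eq_iff)

text \<open>Dividing \<open>f\<close> by its total \<open>c\<close> gives an output distribution of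
  the qc-channel, of entropy at least \<open>H_min\<close> by \<open>min_output_entropy_le\<close>.
  Both sides are homogeneous of degree \<open>1 + s\<close>, which restores
  \<open>c\<close>.\<close>

lemma letter_powr_sum_le:
  assumes Q: "psd UNIV Q" and s: "0 < s"
  defines "f \<equiv> \<lambda>a. p a * Re (op_trace UNIV (op_mult UNIV (\<rho> a) Q))"
  shows "(\<Sum>a\<in>UNIV. f a powr (1 + s)) \<le> exp (- (s * ln 2 * H_min) + 2 * s\<^sup>2 * CARD('a)) * (\<Sum>a\<in>UNIV. f a) powr (1 + s)"
proof -
  define c where "c = (\<Sum>a\<in>UNIV. f a)"
  have nn: "op_trace UNIV (op_mult UNIV (\<rho> a) Q) \<in> \<real>\<^sub>\<ge>\<^sub>0" for a
    unfolding gram by (rule op_trace_gram_op_psd) (use Q in auto)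
  then have re: "op_trace UNIV (op_mult UNIV (\<rho> a) Q) = of_real (Re (op_trace UNIV (op_mult UNIV (\<rho> a) Q)))" for a
    by (simp add: complex_nonneg_Reals_iff complex_eq_iff)
  have f0: "0 \<le> f a" for a unfolding f_def using nn[of a] p_nonneg by (simp add: complex_nonneg_Reals_iff)
  have c0: "0 \<le> c" unfolding c_def by (intro sum_nonneg f0)
  show ?thesis
  proof (cases "c = 0")
    case True
    then have "\<forall>a\<in>UNIV. f a = 0" unfolding c_def by (subst (asm) sum_nonneg_eq_0_iff) (auto simp: f0)
    then show ?thesis by simp
  next
    case False
    then have c: "0 < c" using c0 by simp
    have "op_trace UNIV (op_mult UNIV (average_state p \<rho>) Q) = (\<Sum>a\<in>UNIV. of_real (p a) * op_trace UNIV (op_mult UNIV (\<rho> a) Q))"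
      unfolding average_state_def op_trace_mult_sum_left op_mult_scale_left op_trace_scale ..
    also have "\<dots> = of_real c"
      unfolding c_def f_def of_real_sum of_real_mult re[symmetric] ..
    finally have tr: "op_trace UNIV (op_mult UNIV (average_state p \<rho>) Q) = of_real c" .
    have "H_min \<le> shannon_entropy (\<lambda>a. f a / c)"
      unfolding H_min_def f_def by (rule min_output_entropy_le[OF gram p_nonneg Q tr c])
    then have H: "s * ln 2 * H_min \<le> s * ln 2 * shannon_entropy (\<lambda>a. f a / c)"
      using s by (intro mult_left_mono) auto
    have "(\<Sum>a\<in>UNIV. (f a / c) powr (1 + s)) \<le> exp (- (s * ln 2 * shannon_entropy (\<lambda>a. f a / c)) + 2 * s\<^sup>2 * CARD('a))"
      using f0 c s by (intro sum_powr_le_entropy) (auto simp: sum_divide_distrib[symmetric] c_def)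
    also have "\<dots> \<le> exp (- (s * ln 2 * H_min) + 2 * s\<^sup>2 * CARD('a))" using H by simp
    finally have "(\<Sum>a\<in>UNIV. f a powr (1 + s)) / c powr (1 + s) \<le> exp (- (s * ln 2 * H_min) + 2 * s\<^sup>2 * CARD('a))"
      using f0 c by (simp add: powr_divide sum_divide_distrib)
    then show ?thesis using c unfolding c_def[symmetric] by (simp add: divide_le_eq)
  qed
qed

text \<open>Induction on the first letter. Given that it is \<open>a\<close>, the other letters face
  \<open>contract_fst (\<rho> a) Q\<close>, to which the induction hypothesis applies; the totals
  left over are the weights of one letter under \<open>contract_snd n B Q\<close>, covered by the
  single-letter bound. Since \<open>Q\<close> is an arbitrary positive operator, entanglement across
  letters costs nothing.\<close>

lemma word_powr_sum_le:
  assumes Q: "psd (words n) Q" and s: "0 < s"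
  shows "(\<Sum>y\<in>words n. (word_weight p y * outcome n Q y) powr (1 + s)) \<le>
    exp (- (s * ln 2 * H_min) + 2 * s\<^sup>2 * CARD('a)) ^ n * (\<Sum>y\<in>words n. word_weight p y * outcome n Q y) powr (1 + s)"
  using Q
proof (induction n arbitrary: Q)
  case (Suc n)
  let ?\<beta> = "exp (- (s * ln 2 * H_min) + 2 * s\<^sup>2 * CARD('a))"
  \<comment> \<open>The tensor power of the average state, written as a mixture of words: the first
    letter is judged with all later letters averaged out.\<close>
  define B where "B = (\<lambda>u u'. \<Sum>y\<in>words n. of_real (word_weight p y) * word_op \<rho> y u u')"
  let ?f = "\<lambda>a. p a * Re (op_trace UNIV (op_mult UNIV (\<rho> a) (contract_snd n B Q)))"
  have cons: "op_trace (words n) (op_mult (words n) (word_op \<rho> y) (contract_fst (\<rho> a) Q)) =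
     op_trace (words (Suc n)) (op_mult (words (Suc n)) (word_op \<rho> (a # y)) Q)" for a y
    unfolding op_trace_contract_fst op_trace_cons_op_word_op ..
  have snd: "op_trace UNIV (op_mult UNIV A (contract_snd n B Q)) =
     (\<Sum>y\<in>words n. of_real (word_weight p y) * op_trace (words (Suc n)) (op_mult (words (Suc n)) (cons_op A (word_op \<rho> y)) Q))" for A
  proof -
    have "cons_op A B = (\<lambda>x x'. \<Sum>y\<in>words n. of_real (word_weight p y) * cons_op A (word_op \<rho> y) x x')"
      by (simp add: B_def cons_op_def sum_distrib_left mult_ac)
    then show ?thesis
      unfolding op_trace_contract_snd by (simp only: op_trace_mult_sum_left op_mult_scale_left op_trace_scale)
  qed
  have psd1: "psd (words n) (contract_fst (\<rho> a) Q)" for a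
    unfolding psd_iff_trace op_trace_contract_fst gram cons_op_gram_op
    using Suc.prems by (intro allI op_trace_gram_op_psd) auto
  have psd2: "psd UNIV (contract_snd n B Q)"
    unfolding psd_iff_trace snd
  proof (intro allI nonneg_Reals_sum nonneg_Reals_mult_I)
    fix u :: "'e cvec" and y :: "'a list" assume y: "y \<in> words n"
    show "complex_of_real (word_weight p y) \<in> \<real>\<^sub>\<ge>\<^sub>0" using word_weight_nonneg[of p y] p_nonneg by simp
    show "op_trace (words (Suc n)) (op_mult (words (Suc n)) (cons_op (gram_op {()} (\<lambda>_. 1) (\<lambda>_. u)) (word_op \<rho> y)) Q) \<in> \<real>\<^sub>\<ge>\<^sub>0"
      unfolding word_op_gram[OF gram y] cons_op_gram_op
      using Suc.prems by (intro op_trace_gram_op_psd) auto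
  qed
  have f: "(\<Sum>y\<in>words n. word_weight p (a # y) * outcome (Suc n) Q (a # y)) = ?f a" for a
    unfolding snd op_trace_cons_op_word_op
    by (simp add: outcome_def word_weight_Cons sum_distrib_left mult_ac)
  have nn: "0 \<le> (\<Sum>y\<in>words n. word_weight p y * outcome n (contract_fst (\<rho> a) Q) y)" for a
    using psd1 by (intro sum_nonneg mult_nonneg_nonneg word_weight_nonneg outcome_nonneg p_nonneg)
  have "(\<Sum>y\<in>words n. (word_weight p (a # y) * outcome (Suc n) Q (a # y)) powr (1 + s)) \<le> ?\<beta> ^ n * ?f a powr (1 + s)" for a
  proof -
    have "(\<Sum>y\<in>words n. (word_weight p (a # y) * outcome (Suc n) Q (a # y)) powr (1 + s)) =
       p a powr (1 + s) * (\<Sum>y\<in>words n. (word_weight p y * outcome n (contract_fst (\<rho> a) Q) y) powr (1 + s))"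
      using p_nonneg psd1 unfolding sum_distrib_left
      by (intro sum.cong refl, subst powr_mult[symmetric])
        (auto simp: word_weight_Cons outcome_def cons mult_ac)
    also have "\<dots> \<le> p a powr (1 + s) * (?\<beta> ^ n * (\<Sum>y\<in>words n. word_weight p y * outcome n (contract_fst (\<rho> a) Q) y) powr (1 + s))"
      by (intro mult_left_mono Suc.IH psd1) auto
    also have "\<dots> = ?\<beta> ^ n * (p a * (\<Sum>y\<in>words n. word_weight p y * outcome n (contract_fst (\<rho> a) Q) y)) powr (1 + s)"
      using p_nonneg nn by (simp add: powr_mult)
    also have "p a * (\<Sum>y\<in>words n. word_weight p y * outcome n (contract_fst (\<rho> a) Q) y) = ?f a"
      unfolding f[symmetric] by (simp add: word_weight_Cons outcome_def cons sum_distrib_left mult_ac)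
    finally show ?thesis .
  qed
  then have "(\<Sum>y\<in>words (Suc n). (word_weight p y * outcome (Suc n) Q y) powr (1 + s)) \<le> (\<Sum>a\<in>UNIV. ?\<beta> ^ n * ?f a powr (1 + s))"
    unfolding sum_words_Suc by (intro sum_mono)
  also have "\<dots> \<le> ?\<beta> ^ n * (?\<beta> * (\<Sum>a\<in>UNIV. ?f a) powr (1 + s))"
    unfolding sum_distrib_left[symmetric] by (intro mult_left_mono letter_powr_sum_le psd2 s) auto
  finally show ?case unfolding sum_words_Suc f by (simp add: mult_ac)
qed (simp add: words_0)

text \<open>Markov's inequality for the \<open>s\<close>-th power of \<open>q\<close> under
  \<open>q\<close> itself: on heavy words \<open>(S * q y) powr s\<close> is at least 1.\<close>

lemma heavy_words_le:
  assumes Q: "psd (words n) Q" and s: "0 < s" and S: "0 < S"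
  defines "\<Omega> \<equiv> (\<Sum>y\<in>words n. word_weight p y * outcome n Q y)"
  defines "q \<equiv> \<lambda>y. word_weight p y * outcome n Q y / \<Omega>"
  assumes \<Omega>: "0 < \<Omega>"
  shows "(\<Sum>y\<in>{y\<in>words n. q y > 1 / S}. q y) \<le> S powr s * exp (- (s * ln 2 * H_min) + 2 * s\<^sup>2 * CARD('a)) ^ n"
proof -
  let ?\<beta> = "exp (- (s * ln 2 * H_min) + 2 * s\<^sup>2 * CARD('a))"
  have f0: "0 \<le> word_weight p y * outcome n Q y" if "y \<in> words n" for y
    using that Q by (intro mult_nonneg_nonneg word_weight_nonneg outcome_nonneg p_nonneg)
  have "(\<Sum>y\<in>{y\<in>words n. q y > 1 / S}. q y) \<le> (\<Sum>y\<in>{y\<in>words n. q y > 1 / S}. S powr s * q y powr (1 + s))"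
  proof (intro sum_mono)
    fix y assume "y \<in> {y\<in>words n. q y > 1 / S}"
    then have y: "q y > 1 / S" by simp
    then have q0: "q y > 0" using S by (meson less_trans zero_less_divide_1_iff)
    have "1 \<le> S * q y" using y S by (simp add: field_simps)
    then have "1 \<le> (S * q y) powr s" using s by (simp add: ge_one_powr_ge_zero)
    then have "q y * 1 \<le> q y * (S * q y) powr s" using q0 by (intro mult_left_mono) auto
    then show "q y \<le> S powr s * q y powr (1 + s)"
      using q0 S by (simp add: powr_mult powr_add mult_ac)
  qed
  also have "\<dots> \<le> (\<Sum>y\<in>words n. S powr s * q y powr (1 + s))"
    by (intro sum_mono2) auto
  also have "\<dots> = S powr s * ((\<Sum>y\<in>words n. (word_weight p y * outcome n Q y) powr (1 + s)) / \<Omega> powr (1 + s))"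
    using f0 \<Omega> by (simp add: q_def powr_divide sum_distrib_left sum_divide_distrib cong: sum.cong)
  also have "\<dots> \<le> S powr s * ?\<beta> ^ n"
    using word_powr_sum_le[OF Q s] \<Omega> S unfolding \<Omega>_def[symmetric]
    by (intro mult_left_mono) (auto simp: divide_le_eq)
  finally show ?thesis .
qed

end

subsection \<open>Codes from hash functions\<close>

lemma psd_op_id:
  assumes "finite X"
  shows "psd X op_id"
proof -
  have "inner_prod X v (op_apply X op_id v) = inner_prod X v v" for v
    using assms by (simp add: inner_prod_def op_apply_def op_id_def mult_delta_left)
  then show ?thesis by (auto simp: psd_def inner_prod_self intro!: sum_nonneg simp del: of_real_sum)
qed

context gram_ensemble
begin

definition mean_outcome :: "nat \<Rightarrow> 'e list op \<Rightarrow> real" where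
  "mean_outcome n Q = (\<Sum>y\<in>words n. word_weight p y * outcome n Q y)"

text \<open>The deviation is relative to \<open>mean_outcome n Q\<close>, so adding it up over the
  elements of a POVM gives \<open>\<delta>\<close> however many outcomes there are. The identity as
  \<open>Q\<close> yields the uniformity of the message weights.\<close>

definition uniform_hash :: "nat \<Rightarrow> nat \<Rightarrow> nat \<Rightarrow> (bool list \<Rightarrow> 'a list \<Rightarrow> nat) \<Rightarrow> real \<Rightarrow> bool" where
  "uniform_hash n \<kappa> N h \<delta> \<longleftrightarrow> (\<forall>s\<in>words \<kappa>. \<forall>y\<in>words n. h s y < N) \<and>
    (\<forall>Q. psd (words n) Q \<longrightarrow>
      (\<Sum>m<N. \<bar>(\<Sum>y\<in>words n. word_weight p y * outcome n Q y *
         ((\<Sum>s\<in>words \<kappa>. of_bool (h s y = m)) / 2 ^ \<kappa>)) - mean_outcome n Q / N\<bar>) \<le> \<delta> * mean_outcome n Q)"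

lemma mean_outcome_nonneg: "psd (words n) Q \<Longrightarrow> 0 \<le> mean_outcome n Q"
  unfolding mean_outcome_def
  by (intro sum_nonneg mult_nonneg_nonneg word_weight_nonneg outcome_nonneg p_nonneg)

text \<open>The table is fixed before any \<open>Q\<close> appears; each \<open>Q\<close> then only
  supplies a posterior \<open>q\<close>. The three error terms come from heavy words, the bias
  tolerance and the exceptional words.\<close>

lemma uniform_hash_exists:
  fixes s S d :: real
  assumes N: "0 < N" and d: "0 \<le> d" "d \<le> 1" and S: "0 < S" and s: "0 < s"
    and small: "CARD('a) ^ n * exp (- (2 ^ \<kappa> * d\<^sup>2 / 4)) \<le> ln 2"
  shows "\<exists>h. uniform_hash n \<kappa> N h
    (2 * (S powr s * exp (- (s * ln 2 * H_min) + 2 * s\<^sup>2 * CARD('a)) ^ n + d + real (N + 1) / S))"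
proof -
  let ?\<delta> = "2 * (S powr s * exp (- (s * ln 2 * H_min) + 2 * s\<^sup>2 * CARD('a)) ^ n + d + real (N + 1) / S)"
  have cK: "card (words \<kappa> :: bool list set) = 2 ^ \<kappa>" by (simp add: card_words)
  have ne: "(words \<kappa> :: bool list set) \<noteq> {}" using cK by (metis card.empty power_not_zero zero_neq_numeral)
  have cX: "card (words n :: 'a list set) = CARD('a) ^ n" by (rule card_words)
  obtain h :: "'a list \<Rightarrow> bool list \<Rightarrow> nat" where h: "\<forall>y\<in>words n. \<forall>k\<in>words \<kappa>. h y k < N"
    and few: "\<forall>T\<subseteq>{..<N}. card {y\<in>words n. biased (words \<kappa>) N d T (h y)} \<le> N + 1"
    using few_biased_points[of N d "words \<kappa> :: bool list set" "words n :: 'a list set"] N d small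
    by (auto simp: cK cX)
  have dev: "(\<Sum>m<N. \<bar>(\<Sum>y\<in>words n. word_weight p y * outcome n Q y *
         ((\<Sum>s\<in>words \<kappa>. of_bool (h y s = m)) / 2 ^ \<kappa>)) - mean_outcome n Q / N\<bar>) \<le> ?\<delta> * mean_outcome n Q"
    if Q: "psd (words n) Q" for Q
  proof (cases "mean_outcome n Q = 0")
    case True
    have "\<forall>y\<in>words n. word_weight p y * outcome n Q y = 0"
      using True unfolding mean_outcome_def
      by (subst (asm) sum_nonneg_eq_0_iff)
        (use Q in \<open>auto intro!: mult_nonneg_nonneg word_weight_nonneg outcome_nonneg p_nonneg\<close>)
    then have "(\<Sum>y\<in>words n. word_weight p y * outcome n Q y * ((\<Sum>s\<in>words \<kappa>. of_bool (h y s = m)) / 2 ^ \<kappa>)) = 0" for m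
      by (intro sum.neutral) simp
    then show ?thesis using True by simp
  next
    case False
    define \<Omega> where "\<Omega> = mean_outcome n Q"
    have \<Omega>: "0 < \<Omega>" using False mean_outcome_nonneg[OF Q] by (simp add: \<Omega>_def)
    define q where "q y = word_weight p y * outcome n Q y / \<Omega>" for y
    have q0: "0 \<le> q y" if "y \<in> words n" for y
      unfolding q_def using that \<Omega> Q
      by (intro divide_nonneg_pos mult_nonneg_nonneg word_weight_nonneg outcome_nonneg p_nonneg)
    have q1: "(\<Sum>y\<in>words n. q y) = 1"
      using \<Omega> by (simp add: q_def sum_divide_distrib[symmetric] mean_outcome_def[symmetric] \<Omega>_def)
    have "(\<Sum>m<N. \<bar>(\<Sum>y\<in>words n. q y * ((\<Sum>s\<in>words \<kappa>. of_bool (h y s = m)) / 2 ^ \<kappa>)) - 1 / N\<bar>)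
      \<le> 2 * ((\<Sum>y\<in>{y\<in>words n. q y > 1 / S}. q y) + d + real (N + 1) / S)"
      using hash_near_uniform[OF N d(1) S _ ne _ h few q0 q1] by (simp add: cK)
    also have "\<dots> \<le> ?\<delta>"
    proof -
      have "(\<Sum>y\<in>{y\<in>words n. q y > 1 / S}. q y) \<le> S powr s * exp (- (s * ln 2 * H_min) + 2 * s\<^sup>2 * CARD('a)) ^ n"
        using heavy_words_le[OF Q, of s S] s S \<Omega> by (simp add: q_def \<Omega>_def mean_outcome_def)
      then show ?thesis by simp
    qed
    finally have *: "(\<Sum>m<N. \<bar>(\<Sum>y\<in>words n. q y * ((\<Sum>s\<in>words \<kappa>. of_bool (h y s = m)) / 2 ^ \<kappa>)) - 1 / N\<bar>) \<le> ?\<delta>" .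
    have "(\<Sum>y\<in>words n. word_weight p y * outcome n Q y * c y) - \<Omega> / N = \<Omega> * ((\<Sum>y\<in>words n. q y * c y) - 1 / N)" for c
      using \<Omega> by (simp add: q_def right_diff_distrib sum_distrib_left)
    then have "(\<Sum>m<N. \<bar>(\<Sum>y\<in>words n. word_weight p y * outcome n Q y *
         ((\<Sum>s\<in>words \<kappa>. of_bool (h y s = m)) / 2 ^ \<kappa>)) - \<Omega> / N\<bar>) =
       \<Omega> * (\<Sum>m<N. \<bar>(\<Sum>y\<in>words n. q y * ((\<Sum>s\<in>words \<kappa>. of_bool (h y s = m)) / 2 ^ \<kappa>)) - 1 / N\<bar>)"
      by (simp only: abs_mult abs_of_pos[OF \<Omega>] sum_distrib_left)
    also have "\<dots> \<le> \<Omega> * ?\<delta>" using * \<Omega> by (intro mult_left_mono) auto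
    finally show ?thesis by (simp only: \<Omega>_def mult.commute)
  qed
  have "uniform_hash n \<kappa> N (\<lambda>s y. h y s) ?\<delta>"
    unfolding uniform_hash_def using h dev by (intro conjI ballI allI impI) blast+
  then show ?thesis by blast
qed

lemma outcome_povm_sum:
  assumes "povm (words n) J Q" "y \<in> words n"
  shows "(\<Sum>j<J. outcome n (Q j) y) = 1"
proof -
  have "(\<Sum>j<J. op_trace (words n) (op_mult (words n) (word_op \<rho> y) (Q j))) =
     op_trace (words n) (op_mult (words n) (\<lambda>x x'. \<Sum>j<J. Q j x x') (word_op \<rho> y))"
    by (simp only: op_trace_mult_sum_left op_trace_mult_commute[of _ "word_op \<rho> y"])
  also have "\<dots> = (\<Sum>x\<in>words n. \<Sum>x'\<in>words n. op_id x x' * word_op \<rho> y x' x)"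
    using assms(1) by (simp add: op_trace_def op_mult_def povm_def)
  also have "\<dots> = op_trace (words n) (word_op \<rho> y)"
    by (simp add: op_trace_def op_id_def mult_delta_left)
  also have "\<dots> = 1" by (simp add: op_trace_word_op[OF assms(2)] tr)
  finally show ?thesis unfolding outcome_def Re_sum[symmetric] by simp
qed

lemma outcome_op_id: "y \<in> words n \<Longrightarrow> outcome n op_id y = 1"
  using outcome_povm_sum[of n 1 "\<lambda>_. op_id" y] psd_op_id[of "words n :: 'e list set"] by (simp add: povm_def)

lemma mean_outcome_op_id: "mean_outcome n op_id = 1"
  by (simp add: mean_outcome_def outcome_op_id sum_word_weight p_sum cong: sum.cong)

text \<open>\<open>t m\<close> is the probability that a random word and seed hash to
  \<open>m\<close>, and \<open>U m j / t m\<close> is Eve's probability of outcome \<open>j\<close>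
  given such a message. One \<open>\<delta>\<close> pays for the distance of \<open>t\<close> from
  uniform, another for that of \<open>U m j\<close> from \<open>\<Omega> j / N\<close>; hence the
  factor 2 in the locking bound.\<close>

lemma code_of_uniform_hash:
  fixes \<N> :: "'a op \<Rightarrow> 'b::finite op" and \<N>c :: "'a op \<Rightarrow> 'e op"
  assumes ket: "orthonormal_basis ket"
    and linN: "\<And>\<sigma>. \<N> \<sigma> = (\<lambda>b b'. \<Sum>a\<in>UNIV. \<Sum>a'\<in>UNIV. \<sigma> a a' * C a a' b b')"
    and linE: "\<And>\<sigma>. \<N>c \<sigma> = (\<lambda>b b'. \<Sum>a\<in>UNIV. \<Sum>a'\<in>UNIV. \<sigma> a a' * C' a a' b b')"
    and trN: "\<And>i. op_trace UNIV (\<N> (ket_bra (ket i) (ket i))) = 1"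
    and \<N>c: "\<And>i. \<N>c (ket_bra (ket i) (ket i)) = \<rho> i"
    and P: "\<And>i. P i = gram_op UNIV (\<lambda>_. 1) (r i :: 'k2::finite \<Rightarrow> 'b cvec)"
      "\<And>b b'. (\<Sum>i\<in>UNIV. P i b b') = (if b = b' then 1 else 0)"
    and dec: "\<And>i j. op_trace UNIV (op_mult UNIV (\<N> (ket_bra (ket i) (ket i))) (P j)) = (if i = j then 1 else 0)"
    and h: "uniform_hash n \<kappa> N h \<delta>" and N: "0 < N"
  shows "\<exists>\<sigma> D. code \<N> n \<delta> \<kappa> N \<sigma> D \<and> weakly_locked \<N>c n (2 * \<delta>) \<kappa> N \<sigma>"
proof -
  define K where "K = (2::real) ^ \<kappa>"
  have K: "K > 0" "real (card (words \<kappa> :: bool list set)) = K" by (simp_all add: K_def card_words)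
  define v where "v m y = (\<Sum>s\<in>words \<kappa>. of_bool (h s y = m)) / K" for m y
  define t where "t m = (\<Sum>y\<in>words n. word_weight p y * v m y)" for m
  \<comment> \<open>A message that no word hashes to is sent as the average state: it cannot be decoded, but there
    are few such messages and Eve learns nothing from them.\<close>
  define w where "w m s y = (if t m > 0 then word_weight p y * of_bool (h s y = m) / (K * t m) else word_weight p y / K)" for m s y
  define \<sigma> where "\<sigma> m = encoded_state \<kappa> n ket (w m)" for m
  have ww0: "0 \<le> word_weight p y" for y by (intro word_weight_nonneg p_nonneg)
  have v0: "0 \<le> v m y" for m y using K by (simp add: v_def sum_nonneg)
  have t0: "0 \<le> t m" for m unfolding t_def by (intro sum_nonneg mult_nonneg_nonneg ww0 v0)
  have w0: "0 \<le> w m s y" for m s y using ww0 t0 K by (simp add: w_def)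
  have wsum: "(\<Sum>s\<in>words \<kappa>. w m s y) = (if t m > 0 then word_weight p y * v m y / t m else word_weight p y)" for m y
    using K by (simp add: w_def v_def sum_distrib_left sum_divide_distrib
        del: sum_of_bool_eq sum_of_bool_mult_eq sum_mult_of_bool_eq)
  have w1: "(\<Sum>s\<in>words \<kappa>. \<Sum>y\<in>words n. w m s y) = 1" for m
  proof -
    have "(\<Sum>s\<in>words \<kappa>. \<Sum>y\<in>words n. w m s y) = (\<Sum>y\<in>words n. \<Sum>s\<in>words \<kappa>. w m s y)" by (rule sum.swap)
    then show ?thesis
      by (cases "t m > 0") (simp_all add: wsum sum_divide_distrib[symmetric] t_def[symmetric] sum_word_weight p_sum)
  qed
  have unif: "(\<Sum>m<N. \<bar>(\<Sum>y\<in>words n. word_weight p y * outcome n Q y * v m y) - mean_outcome n Q / N\<bar>) \<le> \<delta> * mean_outcome n Q"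
    if "psd (words n) Q" for Q using h that by (simp add: uniform_hash_def v_def K_def)
  have hN: "h s y < N" if "s \<in> words \<kappa>" "y \<in> words n" for s y using h that by (simp add: uniform_hash_def)
  have t_dev: "(\<Sum>m<N. \<bar>t m - 1 / N\<bar>) \<le> \<delta>"
    using unif[OF psd_op_id[OF finite_words]] by (simp add: mean_outcome_op_id outcome_op_id t_def cong: sum.cong)
  define err where "err m = (\<Sum>s\<in>words \<kappa>. \<Sum>y\<in>words n. w m s y * (1 - of_bool (h s y = m)))" for m
  \<comment> \<open>Messages that are hit decode without error. An unhit one has
    \<open>t m = 0\<close>, so its error of at most \<open>1 / N\<close> is covered by its own
    deviation from uniform.\<close>
  have err: "err m / N \<le> \<bar>t m - 1 / N\<bar>" for m
  proof (cases "t m > 0")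
    case True
    have "err m = 0" unfolding err_def by (intro sum.neutral ballI) (simp add: w_def True)
    then show ?thesis by simp
  next
    case False
    have "err m \<le> (\<Sum>s\<in>words \<kappa>. \<Sum>y\<in>words n. w m s y)"
      unfolding err_def by (intro sum_mono) (use w0 in auto)
    then show ?thesis using False t0[of m] N by (simp add: w1 divide_right_mono)
  qed
  have "code \<N> n \<delta> \<kappa> N \<sigma> (hash_decoder n P h)"
    unfolding code_def
  proof (intro conjI allI impI)
    show "state (words \<kappa> \<times> words n) (\<sigma> m)" for m
      unfolding \<sigma>_def by (rule state_encoded_state[OF ket w0 w1])
    show "povm (words \<kappa> \<times> words n) N (hash_decoder n P h)"
      by (rule povm_hash_decoder[OF P hN])
    have "(\<Sum>m<N. err m) / N \<le> \<delta>"
      using order_trans[OF sum_mono t_dev, of "\<lambda>m. err m / N"] err by (simp add: sum_divide_distrib)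
    then show "(\<Sum>m<N. Re (op_trace (words \<kappa> \<times> words n) (op_mult (words \<kappa> \<times> words n)
        (id_tensor (tensor_power n \<N>) (\<sigma> m)) (\<lambda>x y. op_id x y - hash_decoder n P h m x y)))) / real N \<le> \<delta>"
      unfolding \<sigma>_def op_trace_decoding[OF linN trN dec] by (simp only: Re_complex_of_real err_def)
  qed
  moreover have "weakly_locked \<N>c n (2 * \<delta>) \<kappa> N \<sigma>"
    unfolding weakly_locked_def
  proof (intro allI impI)
    fix J Q assume Q: "povm (words n) J (Q :: nat \<Rightarrow> 'e list op)"
    have psd: "psd (words n) (Q j)" if "j < J" for j using Q that by (simp add: povm_def)
    define c where "c j y = outcome n (Q j) y" for j y
    define \<Omega> where "\<Omega> j = mean_outcome n (Q j)" for j
    define U where "U m j = (\<Sum>y\<in>words n. word_weight p y * c j y * v m y)" for m j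
    have \<Omega>0: "0 \<le> \<Omega> j" if "j < J" for j unfolding \<Omega>_def by (rule mean_outcome_nonneg[OF psd[OF that]])
    have csum: "(\<Sum>j<J. c j y) = 1" if "y \<in> words n" for y
      unfolding c_def by (rule outcome_povm_sum[OF Q that])
    have c0: "0 \<le> c j y" if "j < J" "y \<in> words n" for j y
      unfolding c_def by (rule outcome_nonneg[OF that(2) psd[OF that(1)]])
    have U0: "0 \<le> U m j" if "j < J" for m j
      unfolding U_def by (intro sum_nonneg mult_nonneg_nonneg ww0 c0 v0 that)
    have \<Omega>1: "(\<Sum>j<J. \<Omega> j) = 1"
    proof -
      have "(\<Sum>j<J. \<Omega> j) = (\<Sum>y\<in>words n. \<Sum>j<J. word_weight p y * c j y)"
        unfolding \<Omega>_def mean_outcome_def c_def by (rule sum.swap)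
      also have "\<dots> = (\<Sum>y\<in>words n. word_weight p y)"
        by (simp add: sum_distrib_left[symmetric] csum cong: sum.cong)
      finally show ?thesis by (simp add: sum_word_weight p_sum)
    qed
    have Usum: "(\<Sum>j<J. U m j) = t m" for m
    proof -
      have "(\<Sum>j<J. U m j) = (\<Sum>y\<in>words n. \<Sum>j<J. word_weight p y * c j y * v m y)"
        unfolding U_def by (rule sum.swap)
      also have "\<dots> = (\<Sum>y\<in>words n. word_weight p y * v m y * (\<Sum>j<J. c j y))"
        by (simp add: sum_distrib_left mult_ac)
      finally show ?thesis by (simp add: csum t_def cong: sum.cong)
    qed
    have eve: "op_trace (words n) (op_mult (words n) (eve_state \<N>c n \<kappa> (\<sigma> m)) (Q j)) =
        of_real (if t m > 0 then U m j / t m else \<Omega> j)" if j: "j < J" for m j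
    proof -
      have "op_trace (words n) (op_mult (words n) (eve_state \<N>c n \<kappa> (\<sigma> m)) (Q j)) =
          (\<Sum>y\<in>words n. of_real (\<Sum>s\<in>words \<kappa>. w m s y) * of_real (c j y))"
        unfolding \<sigma>_def op_trace_eve_state[OF linE] \<N>c c_def
        by (intro sum.cong refl) (simp only: of_real_outcome psd j)
      also have "\<dots> = of_real (\<Sum>y\<in>words n. (\<Sum>s\<in>words \<kappa>. w m s y) * c j y)" by simp
      also have "(\<Sum>y\<in>words n. (\<Sum>s\<in>words \<kappa>. w m s y) * c j y) = (if t m > 0 then U m j / t m else \<Omega> j)"
        by (simp add: wsum U_def \<Omega>_def mean_outcome_def c_def sum_divide_distrib mult_ac)
      finally show ?thesis .
    qed
    have per: "(\<Sum>j<J. cmod (op_trace (words n) (op_mult (words n) (eve_state \<N>c n \<kappa> (\<sigma> m)) (Q j)) - of_real (\<Omega> j))) / N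
        \<le> \<bar>t m - 1 / N\<bar> + (\<Sum>j<J. \<bar>U m j - \<Omega> j / N\<bar>)" for m
    proof -
      have e: "cmod (op_trace (words n) (op_mult (words n) (eve_state \<N>c n \<kappa> (\<sigma> m)) (Q j)) - of_real (\<Omega> j)) =
          \<bar>(if t m > 0 then U m j / t m else \<Omega> j) - \<Omega> j\<bar>" if "j < J" for j
        unfolding eve[OF that] of_real_diff[symmetric] norm_of_real ..
      have "(\<Sum>j<J. cmod (op_trace (words n) (op_mult (words n) (eve_state \<N>c n \<kappa> (\<sigma> m)) (Q j)) - of_real (\<Omega> j))) / N =
          (\<Sum>j<J. \<bar>(if t m > 0 then U m j / t m else \<Omega> j) - \<Omega> j\<bar> / N)"
        unfolding sum_divide_distrib by (intro sum.cong refl) (simp only: e lessThan_iff)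
      also have "\<dots> \<le> \<bar>t m - 1 / N\<bar> + (\<Sum>j<J. \<bar>U m j - \<Omega> j / N\<bar>)"
      proof (cases "t m > 0")
        case True
        have "(\<Sum>j<J. \<bar>U m j / t m - \<Omega> j\<bar> / N) \<le> (\<Sum>j<J. U m j * \<bar>1 / (N * t m) - 1\<bar> + \<bar>U m j - \<Omega> j / N\<bar>)"
        proof (intro sum_mono)
          fix j assume j: "j \<in> {..<J}"
          have "\<bar>U m j / t m - \<Omega> j\<bar> / N = \<bar>(U m j / t m - \<Omega> j) / N\<bar>" by simp
          \<comment> \<open>The first summand is the cost of scaling by \<open>N\<close> instead of
            by \<open>1 / t m\<close>. Summed over \<open>j\<close> it collapses to the deviation of
            \<open>t m\<close> from \<open>1 / N\<close>, as the \<open>U m j\<close> add up to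
            \<open>t m\<close>.\<close>
          also have "(U m j / t m - \<Omega> j) / N = U m j * (1 / (N * t m) - 1) + (U m j - \<Omega> j / N)"
            by (simp add: right_diff_distrib diff_divide_distrib mult.commute)
          also have "\<bar>U m j * (1 / (N * t m) - 1) + (U m j - \<Omega> j / N)\<bar> \<le> U m j * \<bar>1 / (N * t m) - 1\<bar> + \<bar>U m j - \<Omega> j / N\<bar>"
            using U0[of j m] j by (intro order_trans[OF abs_triangle_ineq]) (simp add: abs_mult)
          finally show "\<bar>U m j / t m - \<Omega> j\<bar> / N \<le> U m j * \<bar>1 / (N * t m) - 1\<bar> + \<bar>U m j - \<Omega> j / N\<bar>" .
        qed
        also have "\<dots> = t m * \<bar>1 / (N * t m) - 1\<bar> + (\<Sum>j<J. \<bar>U m j - \<Omega> j / N\<bar>)"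
          by (simp add: sum.distrib sum_distrib_right[symmetric] Usum)
        also have "t m * \<bar>1 / (N * t m) - 1\<bar> = \<bar>t m * (1 / (N * t m) - 1)\<bar>" using True by (simp add: abs_mult)
        also have "t m * (1 / (N * t m) - 1) = 1 / N - t m" using True N by (simp add: field_simps)
        finally show ?thesis using True by (simp add: abs_minus_commute)
      qed (simp add: sum_nonneg)
      finally show ?thesis .
    qed
    have "(\<Sum>m<N. \<Sum>j<J. cmod (op_trace (words n) (op_mult (words n) (eve_state \<N>c n \<kappa> (\<sigma> m)) (Q j)) - of_real (\<Omega> j))) / N
      \<le> (\<Sum>m<N. \<bar>t m - 1 / N\<bar>) + (\<Sum>m<N. \<Sum>j<J. \<bar>U m j - \<Omega> j / N\<bar>)"
      unfolding sum_divide_distrib[where A = "{..<N}"] sum.distrib[symmetric] by (intro sum_mono per)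
    also have "(\<Sum>m<N. \<Sum>j<J. \<bar>U m j - \<Omega> j / N\<bar>) = (\<Sum>j<J. \<Sum>m<N. \<bar>U m j - \<Omega> j / N\<bar>)" by (rule sum.swap)
    also have "\<dots> \<le> (\<Sum>j<J. \<delta> * \<Omega> j)"
      by (intro sum_mono) (use unif[OF psd] in \<open>simp add: U_def c_def \<Omega>_def\<close>)
    also have "\<dots> = \<delta>" by (simp add: sum_distrib_left[symmetric] \<Omega>1)
    finally have "(\<Sum>m<N. \<Sum>j<J. cmod (op_trace (words n) (op_mult (words n) (eve_state \<N>c n \<kappa> (\<sigma> m)) (Q j)) - of_real (\<Omega> j))) / N
      \<le> 2 * \<delta>" using t_dev by simp
    then show "\<exists>\<Omega>. prob_dist {..<J} \<Omega> \<and> (\<Sum>m<N. \<Sum>j<J. cmod (op_trace (words n)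
        (op_mult (words n) (eve_state \<N>c n \<kappa> (\<sigma> m)) (Q j)) - of_real (\<Omega> j))) / real N \<le> 2 * \<delta>"
      using \<Omega>0 \<Omega>1 by (intro exI[of _ \<Omega>]) (simp add: prob_dist_def)
  qed
  ultimately show ?thesis by blast
qed

end

subsection \<open>Asymptotics\<close>

lemma sublinear_key_length: "(\<lambda>n. real (nat \<lfloor>sqrt (real n)\<rfloor>)) \<in> o(\<lambda>n. real n)"
proof -
  have "(\<lambda>n. real (nat \<lfloor>sqrt (real n)\<rfloor>)) \<in> O(\<lambda>n. sqrt (real n))"
    by (intro bigoI[of _ 1] always_eventually allI) simp
  also have "(\<lambda>n. sqrt (real n)) \<in> o(\<lambda>n. real n)" by real_asymp
  finally show ?thesis .
qed

text \<open>With tolerance \<open>d = 1 / n\<close> the seeds must outnumber a constant times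
  \<open>n^3\<close>, so logarithmically many key qubits would do. The square root is a convenient
  sublinear length whose exponential beats every polynomial.\<close>

lemma key_length_suffices:
  fixes A :: nat
  assumes "0 < A"
  shows "\<forall>\<^sub>F n in sequentially. A ^ n * exp (- (2 ^ nat \<lfloor>sqrt (real n)\<rfloor> * (1 / real n)\<^sup>2 / 4)) \<le> ln 2"
proof -
  have A: "real A > 0" using assms by simp
  have "(\<lambda>n. exp (real n * real A - 2 powr (sqrt (real n) - 1) * (1 / real n)\<^sup>2 / 4)) \<longlonglongrightarrow> 0"
    using A by real_asymp
  then have "\<forall>\<^sub>F n in sequentially. exp (real n * real A - 2 powr (sqrt (real n) - 1) * (1 / real n)\<^sup>2 / 4) < ln 2"
    by (rule order_tendstoD) simp
  then show ?thesis
  proof eventually_elim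
    case (elim n)
    have "real A \<le> exp (real A)" using exp_ge_add_one_self[of "real A"] by linarith
    then have "real A ^ n \<le> exp (real n * real A)"
      unfolding exp_of_nat_mult by (intro power_mono) auto
    moreover have "2 powr (sqrt (real n) - 1) \<le> 2 ^ nat \<lfloor>sqrt (real n)\<rfloor>"
    proof -
      have "sqrt (real n) - 1 \<le> real (nat \<lfloor>sqrt (real n)\<rfloor>)" by linarith
      then have "2 powr (sqrt (real n) - 1) \<le> (2::real) powr real (nat \<lfloor>sqrt (real n)\<rfloor>)" by (intro powr_mono) auto
      also have "\<dots> = 2 ^ nat \<lfloor>sqrt (real n)\<rfloor>" by (rule powr_realpow) simp
      finally show ?thesis .
    qed
    then have "2 powr (sqrt (real n) - 1) * (1 / real n)\<^sup>2 / 4 \<le> 2 ^ nat \<lfloor>sqrt (real n)\<rfloor> * (1 / real n)\<^sup>2 / 4"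
      by (intro divide_right_mono mult_right_mono) auto
    ultimately have "real A ^ n * exp (- (2 ^ nat \<lfloor>sqrt (real n)\<rfloor> * (1 / real n)\<^sup>2 / 4))
      \<le> exp (real n * real A) * exp (- (2 powr (sqrt (real n) - 1) * (1 / real n)\<^sup>2 / 4))"
      by (intro mult_mono iffD2[OF exp_le_cancel_iff] iffD2[OF neg_le_iff_le]) simp_all
    also have "\<dots> = exp (real n * real A - 2 powr (sqrt (real n) - 1) * (1 / real n)\<^sup>2 / 4)"
      unfolding mult_exp_exp by simp
    finally show ?case using elim by simp
  qed
qed

lemma (in gram_ensemble) uniform_hash_rate:
  assumes R: "0 < R" "R < H_min"
  shows "\<exists>\<kappa> \<delta>. (\<lambda>n. real (\<kappa> n)) \<in> o(\<lambda>n. real n) \<and> \<delta> \<longlonglongrightarrow> 0 \<and>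
    (\<forall>\<^sub>F n in sequentially. \<exists>N h. 0 < N \<and> 2 powr (real n * R) \<le> real N \<and> uniform_hash n (\<kappa> n) N h (\<delta> n))"
proof -
  define \<Delta> where "\<Delta> = H_min - R"
  have \<Delta>: "0 < \<Delta>" using R by (simp add: \<Delta>_def)
  define a where "a = real CARD('a)"
  have a: "0 < a" by (simp add: a_def)
  \<comment> \<open>The minimiser of \<open>- s * ln 2 * \<Delta> / 2 + 2 * s^2 * a\<close>, the
    exponent per letter of the heavy-word bound; the minimum is \<open>- c\<close>.\<close>
  define s where "s = ln 2 * \<Delta> / (8 * a)"
  define c where "c = s * ln 2 * \<Delta> / 4"
  have s: "0 < s" using \<Delta> a by (simp add: s_def)
  have c: "0 < c" using s \<Delta> by (simp add: c_def)
  \<comment> \<open>The exponential rate lies halfway between \<open>R\<close> and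
    \<open>H_min\<close>: above the message rate, so that exceptional words vanish, and below the
    entropy, so that heavy words do.\<close>
  define S where "S n = 2 powr (real n * (R + \<Delta> / 2))" for n
  define N where "N n = nat \<lceil>2 powr (real n * R)\<rceil>" for n
  define \<kappa> where "\<kappa> n = nat \<lfloor>sqrt (real n)\<rfloor>" for n
  define \<delta> where "\<delta> n = 2 * (S n powr s * exp (- (s * ln 2 * H_min) + 2 * s\<^sup>2 * CARD('a)) ^ n + 1 / real n + real (N n + 1) / S n)" for n
  have N: "0 < N n" "2 powr (real n * R) \<le> real (N n)" "real (N n + 1) \<le> 2 powr (real n * R) + 2" for n
    by (auto simp: N_def of_nat_ceiling) linarith
  have S: "0 < S n" for n by (simp add: S_def)
  have "S n powr s * exp (- (s * ln 2 * H_min) + 2 * s\<^sup>2 * CARD('a)) ^ n = exp (- (c * real n))" for n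
  proof -
    have "S n powr s = exp (real n * (s * ln 2 * (R + \<Delta> / 2)))"
      by (simp add: S_def powr_powr powr_def mult_ac)
    then have "S n powr s * exp (- (s * ln 2 * H_min) + 2 * s\<^sup>2 * CARD('a)) ^ n =
       exp (real n * (s * ln 2 * (R + \<Delta> / 2) - s * ln 2 * H_min + 2 * s\<^sup>2 * a))"
      by (simp add: exp_of_nat_mult[symmetric] exp_add[symmetric] a_def algebra_simps)
    also have "2 * s\<^sup>2 * a = s * ln 2 * \<Delta> / 4" using a by (simp add: s_def power2_eq_square)
    also have "s * ln 2 * (R + \<Delta> / 2) - s * ln 2 * H_min + s * ln 2 * \<Delta> / 4 = - c"
      by (simp add: c_def \<Delta>_def algebra_simps) (simp add: field_simps)
    finally show ?thesis by (simp add: mult.commute)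
  qed
  then have \<delta>: "\<delta> n = 2 * (exp (- (c * real n)) + 1 / real n + real (N n + 1) / S n)" for n
    by (simp only: \<delta>_def)
  have "\<delta> \<longlonglongrightarrow> 0"
  proof (rule tendsto_sandwich)
    show "\<forall>\<^sub>F n in sequentially. 0 \<le> \<delta> n" using S by (intro always_eventually allI) (simp add: \<delta> add_nonneg_nonneg less_imp_le)
    show "\<forall>\<^sub>F n in sequentially. \<delta> n \<le> 2 * (exp (- (c * real n)) + 1 / real n + (2 powr (real n * R) + 2) / S n)"
      unfolding \<delta> using N(3) S
      by (intro always_eventually allI mult_left_mono add_mono divide_right_mono order_refl) (auto intro: less_imp_le)
    show "(\<lambda>n. 2 * (exp (- (c * real n)) + 1 / real n + (2 powr (real n * R) + 2) / S n)) \<longlonglongrightarrow> 0"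
    proof -
      have eq: "(2 powr (real n * R) + 2) / S n = 2 powr - (real n * (\<Delta> / 2)) + 2 * 2 powr - (real n * (R + \<Delta> / 2))" for n
      proof -
        have "2 powr (real n * R) / S n = 2 powr (real n * R - real n * (R + \<Delta> / 2))"
          unfolding S_def by (rule powr_diff[symmetric])
        also have "real n * R - real n * (R + \<Delta> / 2) = - (real n * (\<Delta> / 2))" by (simp add: distrib_left)
        finally have 1: "2 powr (real n * R) / S n = 2 powr - (real n * (\<Delta> / 2))" .
        have 2: "2 / S n = 2 * 2 powr - (real n * (R + \<Delta> / 2))"
          unfolding S_def powr_minus_divide by simp
        show ?thesis unfolding add_divide_distrib 1 2 ..
      qed
      have lim: "(\<lambda>n. 2 * (exp (- (c * real n)) + 1 / real n + (2 powr - (real n * e) + 2 * 2 powr - (real n * f)))) \<longlonglongrightarrow> 0"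
        if "0 < e" "0 < f" for e f :: real
      proof -
        have exp: "(\<lambda>n. exp (- (x * real n))) \<longlonglongrightarrow> 0" if "0 < x" for x :: real
          using that by real_asymp
        have powr: "(\<lambda>n. 2 powr - (real n * x)) \<longlonglongrightarrow> (0::real)" if "0 < x" for x
          using exp[of "ln 2 * x"] that by (simp add: powr_def mult_ac)
        have inv: "(\<lambda>n. 1 / real n) \<longlonglongrightarrow> 0" by real_asymp
        show ?thesis
          using tendsto_mult_right_zero[OF tendsto_add_zero[OF tendsto_add_zero[OF exp[OF c] inv]
              tendsto_add_zero[OF powr[OF that(1)] tendsto_mult_right_zero[OF powr[OF that(2)], of 2]]], of 2] .
      qed
      show ?thesis unfolding eq by (rule lim) (use \<Delta> R in auto)
    qed
  qed simp
  moreover have "\<forall>\<^sub>F n in sequentially. \<exists>h. uniform_hash n (\<kappa> n) (N n) h (\<delta> n)"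
    using key_length_suffices[OF zero_less_card_finite[where 'a = 'a]] eventually_gt_at_top[of 0]
  proof eventually_elim
    case (elim n)
    show ?case unfolding \<delta>_def
      by (rule uniform_hash_exists[OF N(1) _ _ S s]) (use elim in \<open>auto simp: \<kappa>_def\<close>)
  qed
  then have "\<forall>\<^sub>F n in sequentially. \<exists>N h. 0 < N \<and> 2 powr (real n * R) \<le> real N \<and> uniform_hash n (\<kappa> n) N h (\<delta> n)"
    by eventually_elim (use N in blast)
  moreover have "(\<lambda>n. real (\<kappa> n)) \<in> o(\<lambda>n. real n)" unfolding \<kappa>_def by (rule sublinear_key_length)
  ultimately show ?thesis by blast
qed

text \<open>One message without a key; it serves the case \<open>H_min \<le> 0\<close>, where the
  required number of messages is at most 1.\<close>

lemma (in gram_ensemble) trivial_uniform_hash: "uniform_hash n 0 1 (\<lambda>_ _. 0) 0"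
  by (simp add: uniform_hash_def words_0 mean_outcome_def)

theorem theorem10:
  fixes \<N> :: "'a::finite op \<Rightarrow> 'b::finite op"
    and \<N>c :: "'a op \<Rightarrow> 'e::finite op"
    and ket :: "'a \<Rightarrow> 'a cvec"
    and \<rho> :: "'a \<Rightarrow> 'e op"
    and p :: "'a \<Rightarrow> real"
  assumes "quantum_channel \<N>"
    and "complementary_channel \<N> \<N>c"
    and "orthonormal_basis ket"
    and "\<And>i. state UNIV (\<rho> i)"
    and "\<And>i j. \<N>c (ket_bra (ket i) (ket j)) = (if i = j then \<rho> i else (\<lambda>_ _. 0))"
    and "prob_dist UNIV p"
  shows "weak_locking_capacity \<N> \<N>c \<ge>
    ereal (min_output_entropy (support (average_state p \<rho>)) (ensemble_povm p \<rho>))"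
proof -
  obtain V :: "'b \<times> 'e \<Rightarrow> 'a \<Rightarrow> complex" where VN: "\<And>\<sigma>. \<N> \<sigma> = ptrace_snd UNIV (conjugate_by V \<sigma>)"
    and VE: "\<And>\<sigma>. \<N>c \<sigma> = ptrace_fst UNIV (conjugate_by V \<sigma>)"
    using assms(2) unfolding complementary_channel_def by blast
  define v where "v i z = (\<Sum>a\<in>UNIV. V z a * ket i a)" for i z
  have conj: "conjugate_by V (ket_bra (ket i) (ket j)) z z' = v i z * cnj (v j z')" for i j z z'
    by (simp add: conjugate_by_def ket_bra_def v_def sum_product mult_ac)
  have linN: "\<N> \<sigma> = (\<lambda>b b'. \<Sum>a\<in>UNIV. \<Sum>a'\<in>UNIV. \<sigma> a a' * (\<Sum>e\<in>UNIV. V (b, e) a * cnj (V (b', e) a')))" for \<sigma>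
  proof (intro ext)
    fix b b'
    have "\<N> \<sigma> b b' = (\<Sum>e\<in>UNIV. \<Sum>a\<in>UNIV. \<Sum>a'\<in>UNIV. \<sigma> a a' * (V (b, e) a * cnj (V (b', e) a')))"
      by (simp add: VN ptrace_snd_def conjugate_by_def mult_ac)
    also have "\<dots> = (\<Sum>a\<in>UNIV. \<Sum>e\<in>UNIV. \<Sum>a'\<in>UNIV. \<sigma> a a' * (V (b, e) a * cnj (V (b', e) a')))" by (rule sum.swap)
    also have "\<dots> = (\<Sum>a\<in>UNIV. \<Sum>a'\<in>UNIV. \<Sum>e\<in>UNIV. \<sigma> a a' * (V (b, e) a * cnj (V (b', e) a')))"
      by (intro sum.cong refl sum.swap)
    finally show "\<N> \<sigma> b b' = (\<Sum>a\<in>UNIV. \<Sum>a'\<in>UNIV. \<sigma> a a' * (\<Sum>e\<in>UNIV. V (b, e) a * cnj (V (b', e) a')))"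
      by (simp add: sum_distrib_left)
  qed
  have linE: "\<N>c \<sigma> = (\<lambda>e e'. \<Sum>a\<in>UNIV. \<Sum>a'\<in>UNIV. \<sigma> a a' * (\<Sum>b\<in>UNIV. V (b, e) a * cnj (V (b, e') a')))" for \<sigma>
  proof (intro ext)
    fix e e'
    have "\<N>c \<sigma> e e' = (\<Sum>b\<in>UNIV. \<Sum>a\<in>UNIV. \<Sum>a'\<in>UNIV. \<sigma> a a' * (V (b, e) a * cnj (V (b, e') a')))"
      by (simp add: VE ptrace_fst_def conjugate_by_def mult_ac)
    also have "\<dots> = (\<Sum>a\<in>UNIV. \<Sum>b\<in>UNIV. \<Sum>a'\<in>UNIV. \<sigma> a a' * (V (b, e) a * cnj (V (b, e') a')))" by (rule sum.swap)
    also have "\<dots> = (\<Sum>a\<in>UNIV. \<Sum>a'\<in>UNIV. \<Sum>b\<in>UNIV. \<sigma> a a' * (V (b, e) a * cnj (V (b, e') a')))"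
      by (intro sum.cong refl sum.swap)
    finally show "\<N>c \<sigma> e e' = (\<Sum>a\<in>UNIV. \<Sum>a'\<in>UNIV. \<sigma> a a' * (\<Sum>b\<in>UNIV. V (b, e) a * cnj (V (b, e') a')))"
      by (simp add: sum_distrib_left)
  qed
  define G where "G i = \<N> (ket_bra (ket i) (ket i))" for i
  have G: "G i = gram_op UNIV (\<lambda>_. 1) (\<lambda>e b. v i (b, e))" for i
    by (simp add: G_def VN ptrace_snd_def conj gram_op_def)
  have \<rho>: "\<rho> i = gram_op UNIV (\<lambda>_. 1) (\<lambda>b e. v i (b, e))" for i
    using assms(5)[of i i] by (simp add: VE ptrace_fst_def conj gram_op_def)
  have tr: "op_trace UNIV (\<rho> i) = 1" for i using assms(4) by (simp add: state_def)
  have trG: "op_trace UNIV (G i) = 1" for i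
  proof -
    have "op_trace UNIV (G i) = op_trace UNIV (\<rho> i)"
      unfolding G \<rho> op_trace_def gram_op_def by (rule sum.swap)
    then show ?thesis by (simp add: tr)
  qed
  \<comment> \<open>The vanishing off-diagonal outputs of \<open>\<N>c\<close> say that tracing out
    Bob from \<open>|v j><v i|\<close> gives zero. The same overlaps on Bob's side occur in the
    product of his reduced states, whose supports are therefore orthogonal.\<close>
  have orth: "op_mult UNIV (G i) (G j) = (\<lambda>_ _. 0)" if "i \<noteq> j" for i j
  proof (intro ext)
    fix b b'
    have 0: "(\<Sum>c\<in>UNIV. v j (c, e') * cnj (v i (c, e))) = 0" for e e'
      using fun_cong[OF fun_cong[OF assms(5)[of j i], of e'], of e] that by (simp add: VE ptrace_fst_def conj)
    let ?t = "\<lambda>c e e'. v i (b, e) * cnj (v j (b', e')) * (v j (c, e') * cnj (v i (c, e)))"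
    have "op_mult UNIV (G i) (G j) b b' = (\<Sum>c\<in>UNIV. \<Sum>e\<in>UNIV. \<Sum>e'\<in>UNIV. ?t c e e')"
      by (simp add: op_mult_def G gram_op_def sum_product mult_ac)
    also have "\<dots> = (\<Sum>e\<in>UNIV. \<Sum>c\<in>UNIV. \<Sum>e'\<in>UNIV. ?t c e e')" by (rule sum.swap)
    also have "\<dots> = (\<Sum>e\<in>UNIV. \<Sum>e'\<in>UNIV. \<Sum>c\<in>UNIV. ?t c e e')" by (intro sum.cong refl sum.swap)
    finally show "op_mult UNIV (G i) (G j) b b' = 0" by (simp add: sum_distrib_left[symmetric] 0)
  qed
  obtain P where ex: "(\<forall>i. P i = gram_op UNIV (\<lambda>_. 1) (\<lambda>c b. P i b c)) \<and>
      (\<forall>b b'. (\<Sum>i\<in>UNIV. P i b b') = (if b = b' then 1 else 0)) \<and>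
      (\<forall>i j. op_trace UNIV (op_mult UNIV (G i) (P j)) = (if i = j then 1 else 0))"
    using distinguishing_projectors[OF G orth trG] ..
  note P = ex[THEN conjunct1, rule_format]
    and P1 = ex[THEN conjunct2, THEN conjunct1, rule_format]
    and dec = ex[THEN conjunct2, THEN conjunct2, rule_format]
  \<comment> \<open>The Gram vectors of Eve's state are the slices of \<open>V\<close> applied to
    \<open>ket i\<close>, one for each basis label of Bob.\<close>
  interpret gram_ensemble p \<rho> "\<lambda>i b e. v i (b, e)"
    by standard (use \<rho> tr assms(6) in \<open>auto simp: prob_dist_def\<close>)
  have \<N>c: "\<N>c (ket_bra (ket i) (ket i)) = \<rho> i" for i by (simp add: assms(5))
  note code = code_of_uniform_hash[OF assms(3) linN linE trG[unfolded G_def] \<N>c P P1 dec[unfolded G_def]]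
  have ach: "achievable_rate \<N> \<N>c R" if \<kappa>: "(\<lambda>n. real (\<kappa> n)) \<in> o(\<lambda>n. real n)" and \<delta>: "\<delta> \<longlonglongrightarrow> 0"
    and ev: "\<forall>\<^sub>F n in sequentially. \<exists>N h. 0 < N \<and> 2 powr (real n * R) \<le> real N \<and> uniform_hash n (\<kappa> n) N h (\<delta> n)" for R \<kappa> \<delta>
    unfolding achievable_rate_def
  proof (rule exI[of _ \<kappa>], rule exI[of _ \<delta>], rule exI[of _ "\<lambda>n. 2 * \<delta> n"], intro conjI)
    show "(\<lambda>n. 2 * \<delta> n) \<longlonglongrightarrow> 0" using tendsto_mult_right_zero[OF \<delta>] .
    show "\<forall>\<^sub>F n in sequentially. \<exists>N \<rho> D. code \<N> n (\<delta> n) (\<kappa> n) N \<rho> D \<and>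
        weakly_locked \<N>c n (2 * \<delta> n) (\<kappa> n) N \<rho> \<and> real N \<ge> 2 powr (real n * R)"
      using ev by eventually_elim (use code in blast)
  qed fact+
  have le: "ereal R \<le> weak_locking_capacity \<N> \<N>c" if "achievable_rate \<N> \<N>c R" for R
    unfolding weak_locking_capacity_def using that by (intro Sup_upper) simp
  have "ereal H_min \<le> weak_locking_capacity \<N> \<N>c"
  proof (cases "0 < H_min")
    case True
    show ?thesis
    proof (rule dense_le)
      fix x assume x: "x < ereal H_min"
      \<comment> \<open>\<open>uniform_hash_rate\<close> works with positive rates, so an
        \<open>x\<close> that is negative or infinite is first raised to a real number in
        \<open>(0, H_min)\<close>.\<close>
      obtain r where r: "x \<le> ereal r" "0 < r" "r < H_min"
      proof (cases x)
        case (real r)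
        then have "max r 0 < H_min" using x True by simp
        then obtain r' where "max r 0 < r'" "r' < H_min" using dense by blast
        then show ?thesis using real that[of r'] by simp
      next
        case PInf
        then show ?thesis using x by simp
      next
        case MInf
        obtain r' where "0 < r'" "r' < H_min" using dense[OF True] by blast
        then show ?thesis using MInf that[of r'] by simp
      qed
      have "achievable_rate \<N> \<N>c r" using uniform_hash_rate[OF r(2,3)] ach by blast
      then show "x \<le> weak_locking_capacity \<N> \<N>c" using r(1) le order_trans by blast
    qed
  next
    case False
    have "achievable_rate \<N> \<N>c H_min"
    proof (rule ach[of "\<lambda>_. 0" "\<lambda>_. 0"])
      have "2 powr (real n * H_min) \<le> real 1" for n
        using False powr_mono[of "real n * H_min" 0 2] by (simp add: mult_nonneg_nonpos)
      then show "\<forall>\<^sub>F n in sequentially. \<exists>N h. 0 < N \<and> 2 powr (real n * H_min) \<le> real N \<and> uniform_hash n 0 N h 0"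
        using trivial_uniform_hash by (intro always_eventually allI exI[of _ 1]) auto
    qed auto
    then show ?thesis by (rule le)
  qed
  then show ?thesis by (simp add: H_min_def)
qed

end
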